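(* Let $(M,F)$ be a Finsler manifold and let $X$ be an affine vector field on $(M,F)$. Suppose that one of the following conditions holds: (1) the function $F\circ X\colon M\to\mathbb{R}$ is bounded, and $(M,F)$ is complete; (2) the functions $F\circ X$ and $F\circ(-X)$ on $M$ are both bounded, and $(M,F)$ is forward complete. Then $X$ is a Killing vector field of $(M,F)$.
   Context: $M$ is a second countable smooth Hausdorff manifold, $\tau\colon TM\to M$ is its tangent bundle, $\mathring{T}M\subset TM$ is the slit tangent bundle (the set of nonzero tangent vectors), $\mathfrak{X}(M)$ is the set of smooth vector fields on $M$, and $\varphi_*\colon TM\to TN$ denotes the derivative of a smooth map $\varphi\colon M\to N$. Finsler manifold: a Finsler function for $M$ is a continuous function $F\colon TM\to\mathbb{R}$ that is smooth on $\mathring{T}M$, positively homogeneous of degree 1 ($F(\lambda v)=\lambda F(v)$ for $\lambda>0$; $F$ is not assumed to be even), positive on $\mathring{T}M$, and such that, with $E:=\frac12F^2$, for every $p\in M$ and every nonzero $u\in T_pM$ the second derivative $(E\upharpoonright T_pM)''(u)$ is a non-degenerate (hence positive definite) symmetric bilinear form. A Finsler manifold is a manifold $M$ together with a Finsler function $F$. Lifts: for $X\in\mathfrak{X}(M)$, the vertical lift $X^{\mathsf v}$ is the velocity field on $TM$ of the flow $(t,v)\mapsto v+tX(\tau(v))$. If $\varphi^X$ is the maximal local flow of $X$, the complete lift $X^{\mathsf c}$ is the velocity field on $TM$ of the local flow $(t,v)\mapsto(\varphi^X_t)_*(v)$. Geodesics: there is a unique second-order vector field $S$ on $\mathring{T}M$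 (i.e. $\tau_*\circ S$ is the identity on $\mathring{T}M$) such that $S(X^{\mathsf v}E)-X^{\mathsf c}E=0$ on $\mathring{T}M$ for all $X\in\mathfrak{X}(M)$ (the Euler–Lagrange equation for $E$). A smooth curve $\gamma$ in $M$, with nowhere vanishing velocity and defined on an open interval, is a geodesic of $(M,F)$ if and only if $S\circ\dot\gamma=\ddot\gamma$. Completeness: $(M,F)$ is forward complete if the domains of its maximal geodesics are not bounded from above, and complete if the domain of every maximal geodesic is $\mathbb{R}$. Affine and Killing fields: $X\in\mathfrak{X}(M)$ is affine if its flow preserves geodesics; equivalently, $[X^{\mathsf c},S]=0$ on $\mathring{T}M$. $X$ is a Killing vector field if its flow preserves the Finsler function, i.e. $F\circ(\varphi^X_t)_*=F$ wherever the left-hand side is defined, for all possible $t\in\mathbb{R}$; equivalently, $X^{\mathsf c}E=0$ on $\mathring{T}M$. *)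

theory Defs
  imports "HOL-Analysis.Analysis"
begin

section \<open>Smooth maps between open sets of Euclidean spaces\<close>

text \<open>Only meant for open sets \<open>S\<close>, since \<open>frechet_derivative f (at x)\<close> is the derivative with
  respect to a full neighbourhood of \<open>x\<close>.\<close>

primrec Ck_on :: "nat \<Rightarrow> 'a::real_normed_vector set \<Rightarrow> ('a \<Rightarrow> 'b::real_normed_vector) \<Rightarrow> bool" where
  "Ck_on 0 S f \<longleftrightarrow> continuous_on S f"
| "Ck_on (Suc k) S f \<longleftrightarrow>
     (\<forall>x\<in>S. f differentiable (at x)) \<and> (\<forall>v. Ck_on k S (\<lambda>x. frechet_derivative f (at x) v))"

definition smooth_on :: "'a::real_normed_vector set \<Rightarrow> ('a \<Rightarrow> 'b::real_normed_vector) \<Rightarrow> bool" where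
  "smooth_on S f \<longleftrightarrow> (\<forall>k. Ck_on k S f)"


section \<open>Manifolds\<close>

text \<open>A manifold modelled on the Euclidean space \<open>'e\<close> is given by a smooth atlas. A chart is a pair
  \<open>(U, \<phi>)\<close>, where only the values of \<open>\<phi>\<close> on \<open>U\<close> matter. The underlying set is the union of the
  chart domains, and the topology is the unique one that makes every chart domain open and every
  chart a homeomorphism onto its image. The atlas need not be maximal.\<close>

type_synonym ('m, 'e) chart = "'m set \<times> ('m \<Rightarrow> 'e)"
type_synonym ('m, 'e) atlas = "('m, 'e) chart set"

definition points :: "('m, 'e) atlas \<Rightarrow> 'm set" where
  "points A = (\<Union>c\<in>A. fst c)"

definition charts_at :: "('m, 'e) atlas \<Rightarrow> 'm \<Rightarrow> ('m, 'e) chart set" where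
  "charts_at A p = {c \<in> A. p \<in> fst c}"

definition chart_inv :: "('m, 'e) chart \<Rightarrow> 'e \<Rightarrow> 'm" where
  "chart_inv c = inv_into (fst c) (snd c)"

definition smooth_atlas :: "('m, 'e::euclidean_space) atlas \<Rightarrow> bool" where
  "smooth_atlas A \<longleftrightarrow>
     (\<forall>c\<in>A. inj_on (snd c) (fst c)) \<and>
     (\<forall>c\<in>A. \<forall>d\<in>A. open (snd c ` (fst c \<inter> fst d)) \<and>
        smooth_on (snd c ` (fst c \<inter> fst d)) (snd d \<circ> chart_inv c))"

definition manifold_topology :: "('m, 'e::euclidean_space) atlas \<Rightarrow> 'm topology" where
  "manifold_topology A =
     topology (\<lambda>W. W \<subseteq> points A \<and> (\<forall>c\<in>A. open (snd c ` (W \<inter> fst c))))"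

lemma openin_manifold_topology:
  assumes "smooth_atlas A"
  shows "openin (manifold_topology A) W \<longleftrightarrow>
           W \<subseteq> points A \<and> (\<forall>c\<in>A. open (snd c ` (W \<inter> fst c)))"
proof -
  let ?P = "\<lambda>W. W \<subseteq> points A \<and> (\<forall>c\<in>A. open (snd c ` (W \<inter> fst c)))"
  have "?P (V \<inter> W)" if "?P V" "?P W" for V W
  proof -
    have "open (snd c ` ((V \<inter> W) \<inter> fst c))" if "c \<in> A" for c
    proof -
      have "inj_on (snd c) (fst c)"
        using assms that by (auto simp: smooth_atlas_def)
      then have "snd c ` ((V \<inter> W) \<inter> fst c) = snd c ` (V \<inter> fst c) \<inter> snd c ` (W \<inter> fst c)"
        by (auto dest: inj_onD)
      then show ?thesis
        using \<open>?P V\<close> \<open>?P W\<close> that by auto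
    qed
    then show ?thesis using \<open>?P V\<close> by blast
  qed
  moreover have "?P (\<Union>\<K>)" if "\<forall>K\<in>\<K>. ?P K" for \<K>
  proof -
    have "snd c ` (\<Union>\<K> \<inter> fst c) = (\<Union>K\<in>\<K>. snd c ` (K \<inter> fst c))" for c :: "('a, 'b) chart"
      by blast
    then show ?thesis using that by (auto intro!: open_UN)
  qed
  ultimately have "istopology ?P"
    unfolding istopology_def by blast
  then show ?thesis
    by (simp add: manifold_topology_def topology_inverse')
qed

definition smooth_manifold :: "('m, 'e::euclidean_space) atlas \<Rightarrow> bool" where
  "smooth_manifold A \<longleftrightarrow>
     smooth_atlas A \<and> Hausdorff_space (manifold_topology A) \<and>
     second_countable (manifold_topology A)"

definition standard_atlas :: "('e, 'e) atlas" where
  "standard_atlas = {(UNIV, id)}"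

text \<open>Smoothness of a map defined on an open subset \<open>W\<close> of a manifold.\<close>

definition smooth_map_on ::
    "('m, 'e::euclidean_space) atlas \<Rightarrow> 'm set \<Rightarrow> ('n, 'f::euclidean_space) atlas \<Rightarrow>
     ('m \<Rightarrow> 'n) \<Rightarrow> bool" where
  "smooth_map_on A W B f \<longleftrightarrow>
     (\<forall>p\<in>W. \<exists>c\<in>A. \<exists>d\<in>B. \<exists>N. openin (manifold_topology A) N \<and> p \<in> N \<and> N \<subseteq> W \<inter> fst c \<and>
        f ` N \<subseteq> fst d \<and> smooth_on (snd c ` N) (snd d \<circ> f \<circ> chart_inv c))"


section \<open>The tangent bundle\<close>

text \<open>A tangent vector is a pair \<open>(p, \<xi>)\<close> of a base point and a function that assigns to each chart
  around \<open>p\<close> the coordinates in that chart, subject to the usual transformation rule. The value of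
  \<open>\<xi>\<close> at all other charts is fixed to be 0, so that equality of tangent vectors is equality of
  pairs and the vector space operations of a tangent space are pointwise.\<close>

type_synonym ('m, 'e) tvec = "'m \<times> (('m, 'e) chart \<Rightarrow> 'e)"

definition tangent_bundle :: "('m, 'e::euclidean_space) atlas \<Rightarrow> ('m, 'e) tvec set" where
  "tangent_bundle A =
     {(p, \<xi>). p \<in> points A \<and> (\<forall>c. c \<notin> charts_at A p \<longrightarrow> \<xi> c = 0) \<and>
        (\<forall>c\<in>charts_at A p. \<forall>d\<in>charts_at A p.
           \<xi> d = frechet_derivative (snd d \<circ> chart_inv c) (at (snd c p)) (\<xi> c))}"

definition tangent_space :: "('m, 'e::euclidean_space) atlas \<Rightarrow> 'm \<Rightarrow> ('m, 'e) tvec set" where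
  "tangent_space A p = {v \<in> tangent_bundle A. fst v = p}"

definition tzero :: "'m \<Rightarrow> ('m, 'e::real_vector) tvec" where
  "tzero p = (p, \<lambda>c. 0)"

text \<open>Only meant for two vectors with the same base point.\<close>

definition tadd :: "('m, 'e::real_vector) tvec \<Rightarrow> ('m, 'e) tvec \<Rightarrow> ('m, 'e) tvec" where
  "tadd v w = (fst v, \<lambda>c. snd v c + snd w c)"

definition tscale :: "real \<Rightarrow> ('m, 'e::real_vector) tvec \<Rightarrow> ('m, 'e) tvec" where
  "tscale r v = (fst v, \<lambda>c. r *\<^sub>R snd v c)"

definition slit_bundle :: "('m, 'e::euclidean_space) atlas \<Rightarrow> ('m, 'e) tvec set" where
  "slit_bundle A = {v \<in> tangent_bundle A. v \<noteq> tzero (fst v)}"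

definition tangent_chart ::
    "('m, 'e::euclidean_space) atlas \<Rightarrow> ('m, 'e) chart \<Rightarrow> (('m, 'e) tvec, 'e \<times> 'e) chart" where
  "tangent_chart A c =
     ({v \<in> tangent_bundle A. fst v \<in> fst c}, \<lambda>v. (snd c (fst v), snd v c))"

definition tangent_atlas ::
    "('m, 'e::euclidean_space) atlas \<Rightarrow> (('m, 'e) tvec, 'e \<times> 'e) atlas" where
  "tangent_atlas A = tangent_chart A ` A"

text \<open>The derivative \<open>f\<^sub>* v\<close> of a map \<open>f\<close> that is smooth near the base point of \<open>v\<close>. The auxiliary
  chart \<open>c\<close> on the domain is arbitrary, since the result does not depend on it.\<close>

definition tangent_map ::
    "('m, 'e::euclidean_space) atlas \<Rightarrow> ('n, 'f::euclidean_space) atlas \<Rightarrow> ('m \<Rightarrow> 'n) \<Rightarrow>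
     ('m, 'e) tvec \<Rightarrow> ('n, 'f) tvec" where
  "tangent_map A B f v =
     (let c = (SOME c. c \<in> charts_at A (fst v)) in
      (f (fst v), \<lambda>d. if d \<in> charts_at B (f (fst v))
         then frechet_derivative (snd d \<circ> f \<circ> chart_inv c) (at (snd c (fst v))) (snd v c)
         else 0))"

text \<open>The derivative \<open>v f\<close> of a real function \<open>f\<close> in the direction of a tangent vector \<open>v\<close>.\<close>

definition tangent_deriv ::
    "('m, 'e::euclidean_space) atlas \<Rightarrow> ('m, 'e) tvec \<Rightarrow> ('m \<Rightarrow> real) \<Rightarrow> real" where
  "tangent_deriv A v f =
     (let c = (SOME c. c \<in> charts_at A (fst v)) in
      frechet_derivative (f \<circ> chart_inv c) (at (snd c (fst v))) (snd v c))"

definition velocity ::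
    "('m, 'e::euclidean_space) atlas \<Rightarrow> (real \<Rightarrow> 'm) \<Rightarrow> real \<Rightarrow> ('m, 'e) tvec" where
  "velocity A \<gamma> t =
     (\<gamma> t, \<lambda>c. if c \<in> charts_at A (\<gamma> t) then vector_derivative (snd c \<circ> \<gamma>) (at t) else 0)"


section \<open>Vector fields, flows and lifts\<close>

definition vector_field_on ::
    "('m, 'e::euclidean_space) atlas \<Rightarrow> 'm set \<Rightarrow> ('m \<Rightarrow> ('m, 'e) tvec) \<Rightarrow> bool" where
  "vector_field_on A W X \<longleftrightarrow>
     smooth_map_on A W (tangent_atlas A) X \<and> (\<forall>p\<in>W. X p \<in> tangent_space A p)"

abbreviation vector_field ::
    "('m, 'e::euclidean_space) atlas \<Rightarrow> ('m \<Rightarrow> ('m, 'e) tvec) \<Rightarrow> bool" where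
  "vector_field A X \<equiv> vector_field_on A (points A) X"

definition open_interval :: "real set \<Rightarrow> bool" where
  "open_interval I \<longleftrightarrow> open I \<and> is_interval I \<and> I \<noteq> {}"

definition integral_curve ::
    "('m, 'e::euclidean_space) atlas \<Rightarrow> ('m \<Rightarrow> ('m, 'e) tvec) \<Rightarrow> real set \<Rightarrow> (real \<Rightarrow> 'm) \<Rightarrow> bool" where
  "integral_curve A X I \<gamma> \<longleftrightarrow>
     open_interval I \<and> smooth_map_on standard_atlas I A \<gamma> \<and> (\<forall>t\<in>I. velocity A \<gamma> t = X (\<gamma> t))"

text \<open>The maximal local flow: \<open>flow_domain A X p\<close> is the domain of the maximal integral curve
  starting at \<open>p\<close>, and \<open>flow A X t p\<close> is its value at a time \<open>t\<close> of this domain.\<close>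

definition flow_domain ::
    "('m, 'e::euclidean_space) atlas \<Rightarrow> ('m \<Rightarrow> ('m, 'e) tvec) \<Rightarrow> 'm \<Rightarrow> real set" where
  "flow_domain A X p = {t. \<exists>I \<gamma>. integral_curve A X I \<gamma> \<and> 0 \<in> I \<and> \<gamma> 0 = p \<and> t \<in> I}"

definition flow ::
    "('m, 'e::euclidean_space) atlas \<Rightarrow> ('m \<Rightarrow> ('m, 'e) tvec) \<Rightarrow> real \<Rightarrow> 'm \<Rightarrow> 'm" where
  "flow A X t p =
     (THE q. \<exists>I \<gamma>. integral_curve A X I \<gamma> \<and> 0 \<in> I \<and> \<gamma> 0 = p \<and> t \<in> I \<and> \<gamma> t = q)"

definition vertical_lift ::
    "('m, 'e::euclidean_space) atlas \<Rightarrow> ('m \<Rightarrow> ('m, 'e) tvec) \<Rightarrow>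
     ('m, 'e) tvec \<Rightarrow> (('m, 'e) tvec, 'e \<times> 'e) tvec" where
  "vertical_lift A X v = velocity (tangent_atlas A) (\<lambda>t. tadd v (tscale t (X (fst v)))) 0"

definition complete_lift ::
    "('m, 'e::euclidean_space) atlas \<Rightarrow> ('m \<Rightarrow> ('m, 'e) tvec) \<Rightarrow>
     ('m, 'e) tvec \<Rightarrow> (('m, 'e) tvec, 'e \<times> 'e) tvec" where
  "complete_lift A X v = velocity (tangent_atlas A) (\<lambda>t. tangent_map A A (flow A X t) v) 0"


section \<open>Finsler manifolds\<close>

definition energy :: "(('m, 'e) tvec \<Rightarrow> real) \<Rightarrow> ('m, 'e) tvec \<Rightarrow> real" where
  "energy F v = (F v)\<^sup>2 / 2"

text \<open>The second derivative at \<open>u\<close> of the restriction of \<open>f\<close> to the tangent space containing \<open>u\<close>,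
  evaluated at the vectors \<open>v\<close>, \<open>w\<close> of the same tangent space.\<close>

definition fibre_second_deriv ::
    "(('m, 'e::real_vector) tvec \<Rightarrow> real) \<Rightarrow> ('m, 'e) tvec \<Rightarrow> ('m, 'e) tvec \<Rightarrow> ('m, 'e) tvec \<Rightarrow> real" where
  "fibre_second_deriv f u v w =
     deriv (\<lambda>s. deriv (\<lambda>t. f (tadd (tadd u (tscale s v)) (tscale t w))) 0) 0"

definition finsler_function ::
    "('m, 'e::euclidean_space) atlas \<Rightarrow> (('m, 'e) tvec \<Rightarrow> real) \<Rightarrow> bool" where
  "finsler_function A F \<longleftrightarrow>
     continuous_map (manifold_topology (tangent_atlas A)) euclideanreal F \<and>
     smooth_map_on (tangent_atlas A) (slit_bundle A) standard_atlas F \<and>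
     (\<forall>v\<in>tangent_bundle A. \<forall>r>0. F (tscale r v) = r * F v) \<and>
     (\<forall>v\<in>slit_bundle A. F v > 0) \<and>
     (\<forall>u\<in>slit_bundle A. \<forall>v\<in>tangent_space A (fst u).
        (\<forall>w\<in>tangent_space A (fst u). fibre_second_deriv (energy F) u v w = 0) \<longrightarrow>
        v = tzero (fst u))"

definition second_order_field ::
    "('m, 'e::euclidean_space) atlas \<Rightarrow>
     (('m, 'e) tvec \<Rightarrow> (('m, 'e) tvec, 'e \<times> 'e) tvec) \<Rightarrow> bool" where
  "second_order_field A S \<longleftrightarrow>
     vector_field_on (tangent_atlas A) (slit_bundle A) S \<and>
     (\<forall>v\<in>slit_bundle A. tangent_map (tangent_atlas A) A fst (S v) = v)"

definition euler_lagrange ::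
    "('m, 'e::euclidean_space) atlas \<Rightarrow> (('m, 'e) tvec \<Rightarrow> real) \<Rightarrow>
     (('m, 'e) tvec \<Rightarrow> (('m, 'e) tvec, 'e \<times> 'e) tvec) \<Rightarrow> bool" where
  "euler_lagrange A F S \<longleftrightarrow>
     (\<forall>X. vector_field A X \<longrightarrow> (\<forall>v\<in>slit_bundle A.
        tangent_deriv (tangent_atlas A) (S v)
          (\<lambda>w. tangent_deriv (tangent_atlas A) (vertical_lift A X w) (energy F)) -
        tangent_deriv (tangent_atlas A) (complete_lift A X v) (energy F) = 0))"

text \<open>The condition \<open>S \<in> extensional (slit_bundle A)\<close> fixes the irrelevant values of \<open>S\<close> outside the
  slit tangent bundle; on the slit tangent bundle \<open>S\<close> is determined by the other two conditions.\<close>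

definition canonical_spray ::
    "('m, 'e::euclidean_space) atlas \<Rightarrow> (('m, 'e) tvec \<Rightarrow> real) \<Rightarrow>
     ('m, 'e) tvec \<Rightarrow> (('m, 'e) tvec, 'e \<times> 'e) tvec" where
  "canonical_spray A F =
     (THE S. second_order_field A S \<and> euler_lagrange A F S \<and> S \<in> extensional (slit_bundle A))"

definition geodesic ::
    "('m, 'e::euclidean_space) atlas \<Rightarrow> (('m, 'e) tvec \<Rightarrow> real) \<Rightarrow>
     real set \<Rightarrow> (real \<Rightarrow> 'm) \<Rightarrow> bool" where
  "geodesic A F I \<gamma> \<longleftrightarrow>
     open_interval I \<and> smooth_map_on standard_atlas I A \<gamma> \<and>
     (\<forall>t\<in>I. velocity A \<gamma> t \<in> slit_bundle A) \<and>
     (\<forall>t\<in>I. canonical_spray A F (velocity A \<gamma> t) =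
        velocity (tangent_atlas A) (velocity A \<gamma>) t)"

definition maximal_geodesic ::
    "('m, 'e::euclidean_space) atlas \<Rightarrow> (('m, 'e) tvec \<Rightarrow> real) \<Rightarrow>
     real set \<Rightarrow> (real \<Rightarrow> 'm) \<Rightarrow> bool" where
  "maximal_geodesic A F I \<gamma> \<longleftrightarrow>
     geodesic A F I \<gamma> \<and>
     (\<forall>J \<delta>. geodesic A F J \<delta> \<and> I \<subseteq> J \<and> (\<forall>t\<in>I. \<delta> t = \<gamma> t) \<longrightarrow> J = I)"

definition finsler_complete ::
    "('m, 'e::euclidean_space) atlas \<Rightarrow> (('m, 'e) tvec \<Rightarrow> real) \<Rightarrow> bool" where
  "finsler_complete A F \<longleftrightarrow> (\<forall>I \<gamma>. maximal_geodesic A F I \<gamma> \<longrightarrow> I = UNIV)"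

definition finsler_forward_complete ::
    "('m, 'e::euclidean_space) atlas \<Rightarrow> (('m, 'e) tvec \<Rightarrow> real) \<Rightarrow> bool" where
  "finsler_forward_complete A F \<longleftrightarrow> (\<forall>I \<gamma>. maximal_geodesic A F I \<gamma> \<longrightarrow> \<not> bdd_above I)"

text \<open>The flow of \<open>X\<close> preserves geodesics. As restrictions of geodesics to smaller open intervals are
  geodesics, it is enough to consider geodesics contained in the domain of the flow map.\<close>

definition affine_field ::
    "('m, 'e::euclidean_space) atlas \<Rightarrow> (('m, 'e) tvec \<Rightarrow> real) \<Rightarrow>
     ('m \<Rightarrow> ('m, 'e) tvec) \<Rightarrow> bool" where
  "affine_field A F X \<longleftrightarrow>
     vector_field A X \<and>
     (\<forall>I \<gamma> t. geodesic A F I \<gamma> \<and> (\<forall>s\<in>I. t \<in> flow_domain A X (\<gamma> s)) \<longrightarrow>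
        geodesic A F I (flow A X t \<circ> \<gamma>))"

definition killing_field ::
    "('m, 'e::euclidean_space) atlas \<Rightarrow> (('m, 'e) tvec \<Rightarrow> real) \<Rightarrow>
     ('m \<Rightarrow> ('m, 'e) tvec) \<Rightarrow> bool" where
  "killing_field A F X \<longleftrightarrow>
     vector_field A X \<and>
     (\<forall>t. \<forall>v\<in>tangent_bundle A. t \<in> flow_domain A X (fst v) \<longrightarrow>
        F (tangent_map A A (flow A X t) v) = F v)"

end

theory Submission
  imports Defs
begin

text \<open>Let \<open>\<gamma>\<close> be a geodesic. Its energy \<open>E(\<gamma>')\<close> is constant, and by the Euler-Lagrange equation the
  function \<open>X\<^sup>vE\<close> along \<open>\<gamma>'\<close> has derivative \<open>X\<^sup>cE\<close>. Since the flow of an affine field maps geodesics to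
  geodesics, \<open>X\<^sup>cE\<close> is constant along \<open>\<gamma>'\<close>, so \<open>X\<^sup>vE\<close> is an affine function of the parameter. By convexity
  of \<open>E\<close> on the tangent spaces, \<open>X\<^sup>vE(v) \<le> E(v) + E(X)\<close> and \<open>- X\<^sup>vE(v) \<le> E(v) + E(-X)\<close>; hence under the
  completeness and boundedness hypotheses this affine function is constant and \<open>X\<^sup>cE = 0\<close>, which
  integrates to the invariance of \<open>F\<close> under the flow. Convexity rests on the fact that a nondegenerate
  vertical Hessian is positive definite.\<close>

section \<open>Calculus of smooth maps\<close>

text \<open>On the whole line an affine function that is bounded above is constant, whence the
  single bound in the complete case. On a half-line such a bound excludes one sign of the slope
  only; as \<open>F\<close> need not be even, the other sign needs the bound on F(-X).
  \<open>E\<close> is smooth only off the zero section. Hence segments through 0 are treated apart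
  in the convexity inequality, and the linearised flow comes with a quantitative bound that keeps
  nonzero vectors nonzero. \<open>flow\<close> and \<open>canonical_spray\<close> are definite
  descriptions, so existence and uniqueness have to be established for both. For the spray, the
  Euler-Lagrange equation, which quantifies over global vector fields, must be reduced to a linear
  system in one chart, which takes fields with prescribed value at a point; its solution must
  moreover depend smoothly on the vector. Affinity concerns geodesics and not the bracket of
  \<open>X\<^sup>c\<close> and \<open>S\<close>. To use it, the derivative of the flow in the
  initial point is obtained from the variational equation, and its time derivative at 0 gives the
  fibre coordinates of \<open>X\<^sup>c\<close>.\<close>

lemma frechet_derivative_cong_open:
  assumes "open S" "x \<in> S" "\<And>y. y \<in> S \<Longrightarrow> f y = g y"
  shows "frechet_derivative f (at x) = frechet_derivative g (at x)"
proof -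
  have "(f has_derivative f') (at x) \<longleftrightarrow> (g has_derivative f') (at x)" for f'
    using has_derivative_transform_within_open[of f f' x UNIV S g]
      has_derivative_transform_within_open[of g f' x UNIV S f] assms by auto
  then show ?thesis by (simp add: frechet_derivative_def)
qed

lemma differentiable_cong_open:
  assumes "open S" "x \<in> S" "\<And>y. y \<in> S \<Longrightarrow> f y = g y" "f differentiable (at x)"
  shows "g differentiable (at x)"
  using assms has_derivative_transform_within_open[of f _ x UNIV S g]
  unfolding differentiable_def by blast

lemma Ck_on_subset: "Ck_on k S f \<Longrightarrow> T \<subseteq> S \<Longrightarrow> Ck_on k T f"
  by (induction k arbitrary: f) (auto intro: continuous_on_subset)

lemma Ck_on_cong:
  assumes "open S" "\<And>x. x \<in> S \<Longrightarrow> f x = g x" "Ck_on k S f"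
  shows "Ck_on k S g"
  using assms(2,3)
proof (induction k arbitrary: f g)
  case 0
  then show ?case using continuous_on_cong by fastforce
next
  case (Suc k)
  have d: "frechet_derivative f (at x) = frechet_derivative g (at x)" if "x \<in> S" for x
    using frechet_derivative_cong_open[OF assms(1) that] Suc.prems(1) by auto
  have "Ck_on k S (\<lambda>x. frechet_derivative g (at x) v)" for v
    using Suc.IH[of "\<lambda>x. frechet_derivative f (at x) v"] d Suc.prems(2) by auto
  moreover have "g differentiable (at x)" if "x \<in> S" for x
    using differentiable_cong_open[OF assms(1) that, of f g] Suc.prems that by auto
  ultimately show ?case by simp
qed

lemma Ck_on_imp_continuous_on: "Ck_on k S f \<Longrightarrow> continuous_on S f"
  by (cases k)
    (auto intro!: continuous_at_imp_continuous_on differentiable_imp_continuous_within)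

text \<open>\<open>Ck_on (Suc k)\<close> demands differentiability and \<open>Ck_on k\<close> of the
  directional derivatives, not \<open>Ck_on k\<close> of the map itself; the descent starts from
  differentiable maps being continuous.\<close>

lemma Ck_on_SucD: "Ck_on (Suc k) S f \<Longrightarrow> Ck_on k S f"
proof (induction k arbitrary: f)
  case 0
  then show ?case using Ck_on_imp_continuous_on by fastforce
next
  case (Suc k)
  then show ?case by (metis Ck_on.simps(2))
qed

text \<open>Lets the derivative be supplied by a formula. The closure rules below are mostly
  inductions on the order in which this rule reduces one more derivative to an instance of the
  induction hypothesis.\<close>

lemma Ck_on_SucI:
  assumes "open S" "\<And>x. x \<in> S \<Longrightarrow> (f has_derivative f' x) (at x)"
    and "\<And>v. Ck_on k S (\<lambda>x. f' x v)"
  shows "Ck_on (Suc k) S f"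
proof -
  have "f' x = frechet_derivative f (at x)" if "x \<in> S" for x
    using frechet_derivative_at assms(2) that by blast
  then have "Ck_on k S (\<lambda>x. frechet_derivative f (at x) v)" for v
    using Ck_on_cong[OF assms(1) _ assms(3)[of v]] by auto
  then show ?thesis using assms(2) by (auto simp: differentiable_def)
qed

lemma Ck_on_SucE:
  assumes "Ck_on (Suc k) S f"
  shows "\<And>x. x \<in> S \<Longrightarrow> (f has_derivative frechet_derivative f (at x)) (at x)"
    and "\<And>v. Ck_on k S (\<lambda>x. frechet_derivative f (at x) v)"
  using assms by (auto simp: frechet_derivative_works)

lemma Ck_on_local:
  assumes "\<And>x. x \<in> S \<Longrightarrow> \<exists>V. open V \<and> x \<in> V \<and> Ck_on k V f"
  shows "Ck_on k S f"
  using assms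
proof (induction k arbitrary: f)
  case 0
  show ?case unfolding Ck_on.simps
  proof (rule continuous_at_imp_continuous_on, rule ballI)
    fix x assume "x \<in> S"
    then obtain V where "open V" "x \<in> V" "continuous_on V f" using 0 by auto
    then show "continuous (at x) f" by (simp add: continuous_on_eq_continuous_at)
  qed
next
  case (Suc k)
  have "Ck_on k S (\<lambda>x. frechet_derivative f (at x) v)" for v
    by (rule Suc.IH) (use Suc.prems in force)
  moreover have "f differentiable (at x)" if "x \<in> S" for x
    using Suc.prems[OF that] by auto
  ultimately show ?case by auto
qed

section \<open>Closure properties of C^k and smooth maps\<close>

lemma Ck_on_const: "Ck_on k S (\<lambda>x. c)"
  by (induction k arbitrary: c) auto

lemma Ck_on_linear:
  assumes "open S" "bounded_linear L" shows "Ck_on k S L"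
proof (cases k)
  case 0
  then show ?thesis using assms by (simp add: linear_continuous_on)
next
  case (Suc j)
  show ?thesis unfolding Suc
    by (rule Ck_on_SucI[OF assms(1), of L "\<lambda>x. L"])
      (auto intro: bounded_linear_imp_has_derivative assms Ck_on_const)
qed

lemma Ck_on_linear_compose:
  assumes "open S" "bounded_linear L" "Ck_on k S f"
  shows "Ck_on k S (\<lambda>x. L (f x))"
  using assms(3)
proof (induction k arbitrary: f)
  case 0
  then show ?case using assms(2) by (auto intro: bounded_linear.continuous_on)
next
  case (Suc k)
  show ?case
    by (rule Ck_on_SucI[OF assms(1), of _ "\<lambda>x v. L (frechet_derivative f (at x) v)"])
      (use Suc in \<open>auto intro!: bounded_linear.has_derivative[OF assms(2)]
        simp: frechet_derivative_works\<close>)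
qed

lemma Ck_on_Pair:
  assumes "open S" "Ck_on k S f" "Ck_on k S g"
  shows "Ck_on k S (\<lambda>x. (f x, g x))"
  using assms(2,3)
proof (induction k arbitrary: f g)
  case 0
  then show ?case by (auto intro: continuous_on_Pair)
next
  case (Suc k)
  show ?case
    by (rule Ck_on_SucI[OF assms(1), of _
          "\<lambda>x v. (frechet_derivative f (at x) v, frechet_derivative g (at x) v)"])
      (use Suc in \<open>auto intro!: has_derivative_Pair simp: frechet_derivative_works\<close>)
qed

lemma Ck_on_add:
  assumes "open S" "Ck_on k S f" "Ck_on k S g"
  shows "Ck_on k S (\<lambda>x. f x + g x)"
  using assms(2,3)
proof (induction k arbitrary: f g)
  case 0
  then show ?case by (auto intro: continuous_on_add)
next
  case (Suc k)
  show ?case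
    by (rule Ck_on_SucI[OF assms(1), of _
          "\<lambda>x v. frechet_derivative f (at x) v + frechet_derivative g (at x) v"])
      (use Suc in \<open>auto intro!: has_derivative_add simp: frechet_derivative_works\<close>)
qed

lemma Ck_on_sum:
  assumes "open S" "\<And>i. i \<in> I \<Longrightarrow> Ck_on k S (f i)"
  shows "Ck_on k S (\<lambda>x. \<Sum>i\<in>I. f i x)"
  using assms(2)
  by (induction I rule: infinite_finite_induct)
    (auto intro!: Ck_on_const Ck_on_add[OF assms(1)])

lemma Ck_on_bilinear:
  assumes "open S" "bounded_bilinear B" "Ck_on k S f" "Ck_on k S g"
  shows "Ck_on k S (\<lambda>x. B (f x) (g x))"
  using assms(3,4)
proof (induction k arbitrary: f g)
  case 0
  then show ?case using bounded_bilinear.continuous_on[OF assms(2)] by auto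
next
  case (Suc k)
  have *: "Ck_on k S (\<lambda>x. B (f x) (frechet_derivative g (at x) v) + B (frechet_derivative f (at x) v) (g x))"
    for v
    using Suc.prems Ck_on_SucD[OF Suc.prems(1)] Ck_on_SucD[OF Suc.prems(2)]
    by (intro Ck_on_add[OF assms(1)] Suc.IH) auto
  show ?case
    by (rule Ck_on_SucI[OF assms(1) _ *])
      (use Suc.prems in \<open>auto intro!: bounded_bilinear.FDERIV[OF assms(2)] simp: frechet_derivative_works\<close>)
qed

lemma linear_euclidean_sum:
  fixes L :: "'a::euclidean_space \<Rightarrow> 'b::real_vector"
  assumes "linear L"
  shows "L y = (\<Sum>b\<in>Basis. (y \<bullet> b) *\<^sub>R L b)"
proof -
  have "L y = L (\<Sum>b\<in>Basis. (y \<bullet> b) *\<^sub>R b)" by (simp add: euclidean_representation)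
  then show ?thesis using assms by (simp add: linear_sum linear_cmul)
qed

text \<open>\<open>Ck_on\<close> controls derivatives in fixed directions only. Expanding a moving
  direction in the standard basis makes expressions such as Df(x)(y(x)) accessible to it; the device
  recurs throughout.\<close>

lemma frechet_derivative_sum:
  fixes f :: "'a::euclidean_space \<Rightarrow> 'b::real_normed_vector"
  assumes "f differentiable (at x)"
  shows "frechet_derivative f (at x) y = (\<Sum>b\<in>Basis. (y \<bullet> b) *\<^sub>R frechet_derivative f (at x) b)"
  by (rule linear_euclidean_sum) (simp add: linear_frechet_derivative assms)

text \<open>The chain rule is written as a sum over basis vectors, so that each factor is a
  coordinate of Df or a directional derivative of \<open>g\<close> composed with \<open>f\<close>;
  the induction hypothesis, for arbitrary \<open>g\<close>, covers the latter.\<close>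

lemma Ck_on_compose:
  fixes f :: "'a::real_normed_vector \<Rightarrow> 'b::euclidean_space"
  assumes "open S" "open T" "f ` S \<subseteq> T" "Ck_on k S f" "Ck_on k T g"
  shows "Ck_on k S (\<lambda>x. g (f x))"
  using assms(4,5)
proof (induction k arbitrary: g)
  case 0
  then show ?case using continuous_on_compose2[of T g S f] assms(3) by auto
next
  case (Suc k)
  have fk: "Ck_on k S f" using Suc.prems Ck_on_SucD by blast
  let ?D = "\<lambda>x v. \<Sum>b\<in>Basis. (frechet_derivative f (at x) v \<bullet> b) *\<^sub>R frechet_derivative g (at (f x)) b"
  have *: "Ck_on k S (\<lambda>x. ?D x v)" for v
    using Suc.prems
    by (intro Ck_on_sum[OF assms(1)] Ck_on_bilinear[OF assms(1) bounded_bilinear_scaleR]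
        Ck_on_linear_compose[OF assms(1) bounded_linear_inner_left] Suc.IH fk) auto
  have "((\<lambda>x. g (f x)) has_derivative ?D x) (at x)" if "x \<in> S" for x
  proof -
    have g: "g differentiable (at (f x))" using Suc.prems assms(3) that by auto
    have "((\<lambda>x. g (f x)) has_derivative (\<lambda>v. frechet_derivative g (at (f x)) (frechet_derivative f (at x) v))) (at x)"
      using has_derivative_compose[OF Ck_on_SucE(1)[OF Suc.prems(1) that] g[unfolded frechet_derivative_works]] .
    moreover have "(\<lambda>v. frechet_derivative g (at (f x)) (frechet_derivative f (at x) v)) = ?D x"
      using frechet_derivative_sum[OF g] by blast
    ultimately show ?thesis by simp
  qed
  then show ?case by (rule Ck_on_SucI[OF assms(1) _ *])
qed

lemma smooth_on_subset: "smooth_on S f \<Longrightarrow> T \<subseteq> S \<Longrightarrow> smooth_on T f"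
  by (auto simp: smooth_on_def intro: Ck_on_subset)

lemma smooth_on_cong:
  "open S \<Longrightarrow> (\<And>x. x \<in> S \<Longrightarrow> f x = g x) \<Longrightarrow> smooth_on S f \<Longrightarrow> smooth_on S g"
  unfolding smooth_on_def using Ck_on_cong by blast

lemma smooth_on_imp_continuous_on: "smooth_on S f \<Longrightarrow> continuous_on S f"
  by (auto simp: smooth_on_def intro: Ck_on_imp_continuous_on)

lemma smooth_on_differentiable: "smooth_on S f \<Longrightarrow> x \<in> S \<Longrightarrow> f differentiable (at x)"
  unfolding smooth_on_def by (metis Ck_on.simps(2))

lemma smooth_on_has_derivative:
  "smooth_on S f \<Longrightarrow> x \<in> S \<Longrightarrow> (f has_derivative frechet_derivative f (at x)) (at x)"
  using smooth_on_differentiable frechet_derivative_works by blast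

lemma smooth_on_frechet_derivative:
  "smooth_on S f \<Longrightarrow> smooth_on S (\<lambda>x. frechet_derivative f (at x) v)"
  unfolding smooth_on_def by (metis Ck_on.simps(2))

lemma smooth_on_local:
  "(\<And>x. x \<in> S \<Longrightarrow> \<exists>V. open V \<and> x \<in> V \<and> smooth_on V f) \<Longrightarrow> smooth_on S f"
  unfolding smooth_on_def by (meson Ck_on_local)

lemma smooth_on_const: "smooth_on S (\<lambda>x. c)"
  by (simp add: smooth_on_def Ck_on_const)

lemma smooth_on_linear: "open S \<Longrightarrow> bounded_linear L \<Longrightarrow> smooth_on S L"
  by (simp add: smooth_on_def Ck_on_linear)

lemma smooth_on_linear_compose:
  "open S \<Longrightarrow> bounded_linear L \<Longrightarrow> smooth_on S f \<Longrightarrow> smooth_on S (\<lambda>x. L (f x))"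
  by (simp add: smooth_on_def Ck_on_linear_compose)

lemma smooth_on_id: "open S \<Longrightarrow> smooth_on S (\<lambda>x. x)"
  by (intro smooth_on_linear bounded_linear_ident)

lemma smooth_on_Pair:
  "open S \<Longrightarrow> smooth_on S f \<Longrightarrow> smooth_on S g \<Longrightarrow> smooth_on S (\<lambda>x. (f x, g x))"
  by (simp add: smooth_on_def Ck_on_Pair)

lemma smooth_on_add:
  "open S \<Longrightarrow> smooth_on S f \<Longrightarrow> smooth_on S g \<Longrightarrow> smooth_on S (\<lambda>x. f x + g x)"
  by (simp add: smooth_on_def Ck_on_add)

lemma smooth_on_sum:
  "open S \<Longrightarrow> (\<And>i. i \<in> I \<Longrightarrow> smooth_on S (f i)) \<Longrightarrow> smooth_on S (\<lambda>x. \<Sum>i\<in>I. f i x)"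
  by (simp add: smooth_on_def Ck_on_sum)

lemma smooth_on_bilinear:
  "open S \<Longrightarrow> bounded_bilinear B \<Longrightarrow> smooth_on S f \<Longrightarrow> smooth_on S g \<Longrightarrow>
    smooth_on S (\<lambda>x. B (f x) (g x))"
  by (simp add: smooth_on_def Ck_on_bilinear)

lemma smooth_on_scaleR:
  "open S \<Longrightarrow> smooth_on S f \<Longrightarrow> smooth_on S g \<Longrightarrow> smooth_on S (\<lambda>x. f x *\<^sub>R g x)"
  by (rule smooth_on_bilinear[OF _ bounded_bilinear_scaleR])

lemma smooth_on_diff:
  "open S \<Longrightarrow> smooth_on S f \<Longrightarrow> smooth_on S g \<Longrightarrow> smooth_on S (\<lambda>x. f x - g x)"
  using smooth_on_add[of S f "\<lambda>x. - g x"]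
    smooth_on_linear_compose[OF _ bounded_linear_minus[OF bounded_linear_ident], of S g] by simp

lemma smooth_on_compose:
  fixes f :: "'a::real_normed_vector \<Rightarrow> 'b::euclidean_space"
  shows "open S \<Longrightarrow> open T \<Longrightarrow> f ` S \<subseteq> T \<Longrightarrow> smooth_on S f \<Longrightarrow> smooth_on T g \<Longrightarrow>
    smooth_on S (\<lambda>x. g (f x))"
  by (simp add: smooth_on_def Ck_on_compose)

text \<open>Needed for the transition maps (x, y) \<mapsto> (\<tau> x, D\<tau>(x) y) of the tangent
  bundle and for the mixed second derivatives in the spray.\<close>

lemma smooth_on_frechet_derivative_apply:
  fixes f :: "'a::euclidean_space \<Rightarrow> 'b::euclidean_space"
    and \<phi> :: "'c::real_normed_vector \<Rightarrow> 'a"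
  assumes "open S" "open T" "smooth_on T f" "smooth_on S \<phi>" "smooth_on S \<psi>" "\<phi> ` S \<subseteq> T"
  shows "smooth_on S (\<lambda>z. frechet_derivative f (at (\<phi> z)) (\<psi> z))"
proof -
  have "smooth_on S (\<lambda>z. \<Sum>b\<in>Basis. (\<psi> z \<bullet> b) *\<^sub>R frechet_derivative f (at (\<phi> z)) b)"
    by (intro smooth_on_sum[OF assms(1)] smooth_on_scaleR[OF assms(1)]
        smooth_on_linear_compose[OF assms(1) bounded_linear_inner_left]
        smooth_on_compose[OF assms(1,2,6,4)] smooth_on_frechet_derivative assms)
  moreover have "(\<Sum>b\<in>Basis. (\<psi> z \<bullet> b) *\<^sub>R frechet_derivative f (at (\<phi> z)) b) = frechet_derivative f (at (\<phi> z)) (\<psi> z)"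
    if "z \<in> S" for z
    using frechet_derivative_sum[OF smooth_on_differentiable[OF assms(3)], of "\<phi> z" "\<psi> z"] assms(6) that by auto
  ultimately show ?thesis by (rule smooth_on_cong[OF assms(1), rotated])
qed

section \<open>Symmetry of second derivatives\<close>

text \<open>Mean value theorem twice: on the difference in direction \<open>w\<close> as a function
  of the step along \<open>v\<close>, then on the resulting derivative as a function of the step
  along \<open>w\<close>.\<close>

lemma second_difference_mean_value:
  fixes e :: "'a::real_normed_vector \<Rightarrow> real"
  assumes "smooth_on S e" "h > 0"
    and S: "\<And>s t. 0 \<le> s \<Longrightarrow> s \<le> h \<Longrightarrow> 0 \<le> t \<Longrightarrow> t \<le> h \<Longrightarrow> p + s *\<^sub>R v + t *\<^sub>R w \<in> S"
  shows "\<exists>s t. 0 \<le> s \<and> s \<le> h \<and> 0 \<le> t \<and> t \<le> h \<and>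
    e (p + h *\<^sub>R v + h *\<^sub>R w) - e (p + h *\<^sub>R v) - e (p + h *\<^sub>R w) + e p
    = h * h * frechet_derivative (\<lambda>x. frechet_derivative e (at x) v) (at (p + s *\<^sub>R v + t *\<^sub>R w)) w"
proof -
  let ?e = "\<lambda>x. frechet_derivative e (at x)"
  let ?g = "\<lambda>x. frechet_derivative (\<lambda>x. frechet_derivative e (at x) v) (at x)"
  have lin: "linear (?e x)" "linear (?g x)" if "x \<in> S" for x
    using assms(1) that smooth_on_differentiable smooth_on_frechet_derivative linear_frechet_derivative
    by blast+
  have d1: "((\<lambda>s. e (p + s *\<^sub>R v + t *\<^sub>R w)) has_real_derivative ?e (p + s *\<^sub>R v + t *\<^sub>R w) v) (at s)"
    if "0 \<le> s" "s \<le> h" "0 \<le> t" "t \<le> h" for s t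
  proof -
    have "((\<lambda>s. e (p + s *\<^sub>R v + t *\<^sub>R w)) has_derivative (\<lambda>r. ?e (p + s *\<^sub>R v + t *\<^sub>R w) (r *\<^sub>R v))) (at s)"
      by (rule has_derivative_compose[where g=e and f="\<lambda>s. p + s *\<^sub>R v + t *\<^sub>R w"])
        (auto intro!: derivative_eq_intros smooth_on_has_derivative[OF assms(1)] S that)
    then show ?thesis
      using linear_cmul[OF lin(1)[OF S[OF that]]]
      by (simp add: has_field_derivative_def mult_commute_abs)
  qed
  have d2: "((\<lambda>t. ?e (p + s *\<^sub>R v + t *\<^sub>R w) v) has_real_derivative ?g (p + s *\<^sub>R v + t *\<^sub>R w) w) (at t)"
    if "0 \<le> s" "s \<le> h" "0 \<le> t" "t \<le> h" for s t
  proof -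
    have "((\<lambda>t. ?e (p + s *\<^sub>R v + t *\<^sub>R w) v) has_derivative (\<lambda>r. ?g (p + s *\<^sub>R v + t *\<^sub>R w) (r *\<^sub>R w))) (at t)"
      by (rule has_derivative_compose[where g="\<lambda>x. ?e x v" and f="\<lambda>t. p + s *\<^sub>R v + t *\<^sub>R w"])
        (auto intro!: derivative_eq_intros smooth_on_has_derivative[OF smooth_on_frechet_derivative[OF assms(1)]] S that)
    then show ?thesis
      using linear_cmul[OF lin(2)[OF S[OF that]]]
      by (simp add: has_field_derivative_def mult_commute_abs)
  qed
  define \<phi> where "\<phi> s = e (p + s *\<^sub>R v + h *\<^sub>R w) - e (p + s *\<^sub>R v + 0 *\<^sub>R w)" for s
  obtain s where s: "0 < s" "s < h" "\<phi> h - \<phi> 0 = (h - 0) * (?e (p + s *\<^sub>R v + h *\<^sub>R w) v - ?e (p + s *\<^sub>R v + 0 *\<^sub>R w) v)"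
  proof -
    have "(\<phi> has_real_derivative ?e (p + s *\<^sub>R v + h *\<^sub>R w) v - ?e (p + s *\<^sub>R v + 0 *\<^sub>R w) v) (at s)"
      if "0 \<le> s" "s \<le> h" for s
      unfolding \<phi>_def by (intro DERIV_diff d1) (use that assms(2) in auto)
    from MVT2[OF assms(2) this] show ?thesis using that by blast
  qed
  obtain t where t: "0 < t" "t < h" "?e (p + s *\<^sub>R v + h *\<^sub>R w) v - ?e (p + s *\<^sub>R v + 0 *\<^sub>R w) v = (h - 0) * ?g (p + s *\<^sub>R v + t *\<^sub>R w) w"
    using MVT2[OF assms(2), of "\<lambda>t. ?e (p + s *\<^sub>R v + t *\<^sub>R w) v" "\<lambda>t. ?g (p + s *\<^sub>R v + t *\<^sub>R w) w"]
      d2 s(1,2) by auto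
  have "\<phi> h - \<phi> 0 = h * h * ?g (p + s *\<^sub>R v + t *\<^sub>R w) w"
    using s(3) t(3) by simp
  then show ?thesis
    using s(1,2) t(1,2) by (intro exI[of _ s] exI[of _ t]) (auto simp: \<phi>_def)
qed

text \<open>The second difference is symmetric in \<open>v\<close> and \<open>w\<close>, and it
  equals h^2 times either mixed derivative at suitable points near \<open>p\<close>. Continuity of
  both then makes their values at \<open>p\<close> agree up to any \<epsilon>.\<close>

lemma symmetric_second_derivative:
  fixes e :: "'a::real_normed_vector \<Rightarrow> real"
  assumes "open S" "smooth_on S e" "p \<in> S"
  shows "frechet_derivative (\<lambda>x. frechet_derivative e (at x) v) (at p) w
       = frechet_derivative (\<lambda>x. frechet_derivative e (at x) w) (at p) v"
proof -
  let ?G = "\<lambda>v w x. frechet_derivative (\<lambda>x. frechet_derivative e (at x) v) (at x) w"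
  have cont: "isCont (?G v w) p" for v w
    using smooth_on_frechet_derivative[OF smooth_on_frechet_derivative[OF assms(2)]]
      assms(1,3) smooth_on_imp_continuous_on continuous_on_eq_continuous_at by blast
  have "\<bar>?G v w p - ?G w v p\<bar> < \<epsilon>" if "\<epsilon> > 0" for \<epsilon>
  proof -
    obtain d0 where d0: "d0 > 0" "ball p d0 \<subseteq> S" using assms open_contains_ball by blast
    obtain d1 where d1: "d1 > 0" "\<And>x. dist x p < d1 \<Longrightarrow> \<bar>?G v w x - ?G v w p\<bar> < \<epsilon>/2"
      using cont[of v w] \<open>\<epsilon> > 0\<close> unfolding continuous_at_eps_delta dist_real_def by (metis half_gt_zero)
    obtain d2 where d2: "d2 > 0" "\<And>x. dist x p < d2 \<Longrightarrow> \<bar>?G w v x - ?G w v p\<bar> < \<epsilon>/2"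
      using cont[of w v] \<open>\<epsilon> > 0\<close> unfolding continuous_at_eps_delta dist_real_def by (metis half_gt_zero)
    define d where "d = min d0 (min d1 d2)"
    \<comment> \<open>Scaled so that the parallelogram spanned by h v and h w lies within
      \<open>d\<close> of \<open>p\<close>; the summand 1 covers v = w = 0.\<close>
    define h where "h = d / (2 * (norm v + norm w + 1))"
    have "d > 0" using d0 d1 d2 by (simp add: d_def)
    have nn: "norm v + norm w + 1 > 0"
      using norm_ge_zero[of v] norm_ge_zero[of w] by linarith
    have "h > 0" using nn \<open>d > 0\<close> by (simp add: h_def)
    have hd: "h * (norm v + norm w) < d"
    proof -
      have "norm v + norm w < 2 * (norm v + norm w + 1)" using nn by argo
      then have "h * (norm v + norm w) < h * (2 * (norm v + norm w + 1))"
        using \<open>h > 0\<close> by (rule mult_strict_left_mono)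
      also have "\<dots> = d" using nn by (simp add: h_def)
      finally show ?thesis .
    qed
    have near: "dist (p + s *\<^sub>R v + t *\<^sub>R w) p < d" if "0 \<le> s" "s \<le> h" "0 \<le> t" "t \<le> h" for s t
    proof -
      have "norm (s *\<^sub>R v + t *\<^sub>R w) \<le> s * norm v + t * norm w"
        using norm_triangle_ineq[of "s *\<^sub>R v" "t *\<^sub>R w"] that by simp
      also have "\<dots> \<le> h * norm v + h * norm w"
        using that by (intro add_mono mult_right_mono) auto
      finally show ?thesis using hd by (simp add: dist_norm algebra_simps)
    qed
    have near': "dist (p + s *\<^sub>R w + t *\<^sub>R v) p < d" if "0 \<le> s" "s \<le> h" "0 \<le> t" "t \<le> h" for s t
      using near[of t s] that by (simp add: algebra_simps)
    have inS: "x \<in> S" if "dist x p < d" for x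
      using that d0 by (auto simp: d_def dist_commute)
    obtain s t where st: "0 \<le> s" "s \<le> h" "0 \<le> t" "t \<le> h"
      "e (p + h *\<^sub>R v + h *\<^sub>R w) - e (p + h *\<^sub>R v) - e (p + h *\<^sub>R w) + e p = h * h * ?G v w (p + s *\<^sub>R v + t *\<^sub>R w)"
      using second_difference_mean_value[OF assms(2) \<open>h > 0\<close>, of p v w] near inS by blast
    obtain s' t' where st': "0 \<le> s'" "s' \<le> h" "0 \<le> t'" "t' \<le> h"
      "e (p + h *\<^sub>R w + h *\<^sub>R v) - e (p + h *\<^sub>R w) - e (p + h *\<^sub>R v) + e p = h * h * ?G w v (p + s' *\<^sub>R w + t' *\<^sub>R v)"
      using second_difference_mean_value[OF assms(2) \<open>h > 0\<close>, of p w v] near' inS by blast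
    have "h * h * ?G v w (p + s *\<^sub>R v + t *\<^sub>R w) = h * h * ?G w v (p + s' *\<^sub>R w + t' *\<^sub>R v)"
      using st(5) st'(5) by (simp add: algebra_simps)
    then have eq: "?G v w (p + s *\<^sub>R v + t *\<^sub>R w) = ?G w v (p + s' *\<^sub>R w + t' *\<^sub>R v)"
      using \<open>h > 0\<close> by simp
    have "\<bar>?G v w (p + s *\<^sub>R v + t *\<^sub>R w) - ?G v w p\<bar> < \<epsilon>/2"
      by (rule d1(2)) (use near[OF st(1-4)] in \<open>simp add: d_def\<close>)
    moreover have "\<bar>?G w v (p + s' *\<^sub>R w + t' *\<^sub>R v) - ?G w v p\<bar> < \<epsilon>/2"
      by (rule d2(2)) (use near'[OF st'(1-4)] in \<open>simp add: d_def\<close>)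
    ultimately show ?thesis using eq by linarith
  qed
  \<comment> \<open>With \<epsilon> equal to the distance itself, a positive distance would be
    smaller than itself.\<close>
  from this[of "\<bar>?G v w p - ?G w v p\<bar>"] show ?thesis by force
qed

subsection \<open>Parametric linear systems\<close>

text \<open>Injectivity at one parameter yields a lower bound \<open>B\<close>, and half of it
  survives nearby, uniformly in the vector. Continuity is known only for each fixed vector, so the
  distance of the operators is controlled through the finitely many basis vectors.\<close>

lemma injective_family_bounded_below:
  fixes L :: "'a::metric_space \<Rightarrow> 'e::euclidean_space \<Rightarrow> 'f::euclidean_space"
  assumes "open S" "z0 \<in> S" "\<And>z. z \<in> S \<Longrightarrow> linear (L z)" "inj (L z0)"
    and cont: "\<And>a. continuous_on S (\<lambda>z. L z a)"
  shows "\<exists>m>0. \<forall>\<^sub>F z in nhds z0. z \<in> S \<and> (\<forall>a. m * norm a \<le> norm (L z a))"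
proof -
  obtain B where B: "B > 0" "\<And>a. B * norm a \<le> norm (L z0 a)"
    using linear_inj_bounded_below_pos[OF assms(3)[OF assms(2)] assms(4)] by (metis mult.commute)
  let ?\<sigma> = "\<lambda>z. \<Sum>b\<in>Basis. norm (L z b - L z0 b)"
  have "((\<lambda>z. L z b) \<longlongrightarrow> L z0 b) (nhds z0)" for b
    using cont[of b] assms(1,2) by (metis continuous_on_eq_continuous_at isCont_def tendsto_at_iff_tendsto_nhds)
  then have "(?\<sigma> \<longlongrightarrow> (\<Sum>b\<in>Basis. norm (L z0 b - L z0 b))) (nhds z0)"
    by (intro tendsto_sum tendsto_norm tendsto_diff tendsto_const) auto
  then have "\<forall>\<^sub>F z in nhds z0. ?\<sigma> z < B / 2"
    using B(1) by (intro order_tendstoD(2)) auto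
  moreover have "\<forall>\<^sub>F z in nhds z0. z \<in> S" using assms(1,2) eventually_nhds by blast
  ultimately have "\<forall>\<^sub>F z in nhds z0. z \<in> S \<and> (\<forall>a. (B/2) * norm a \<le> norm (L z a))"
  proof eventually_elim
    case (elim z)
    have "(B/2) * norm a \<le> norm (L z a)" for a
    proof -
      have "L z a - L z0 a = (\<Sum>b\<in>Basis. (a \<bullet> b) *\<^sub>R (L z b - L z0 b))"
        using linear_euclidean_sum[OF assms(3), of z a] linear_euclidean_sum[OF assms(3), of z0 a] elim assms(2)
        by (simp add: sum_subtractf scaleR_diff_right)
      also have "norm \<dots> \<le> (\<Sum>b\<in>Basis. norm a * norm (L z b - L z0 b))"
        by (rule sum_norm_le) (simp add: mult_right_mono Basis_le_norm)
      also have "\<dots> = norm a * ?\<sigma> z" by (simp add: sum_distrib_left)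
      also have "\<dots> \<le> norm a * (B/2)" using elim by (intro mult_left_mono) auto
      finally have "norm (L z0 a) \<le> norm (L z a) + norm a * (B/2)"
        using norm_triangle_ineq4[of "L z a" "L z a - L z0 a"] by simp
      then show ?thesis using B(2)[of a] by (simp add: algebra_simps)
    qed
    then show ?case using elim by blast
  qed
  then show ?thesis using B(1) half_gt_zero by blast
qed

text \<open>Implicit differentiation of L(z) g(z) = r(z): the candidate \<open>G\<close> solves the
  formally differentiated equation. Not even continuity of \<open>g\<close> is presupposed, because
  the lower bound on \<open>L z\<close> converts an estimate for the residual into one for
  \<open>g\<close>.\<close>

lemma has_derivative_linear_solve:
  fixes L :: "'a::euclidean_space \<Rightarrow> 'e::euclidean_space \<Rightarrow> 'e"
  assumes "open S" "z0 \<in> S" "\<And>z. z \<in> S \<Longrightarrow> linear (L z)" "inj (L z0)"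
    and dL: "\<And>z a. z \<in> S \<Longrightarrow> ((\<lambda>z. L z a) has_derivative L' z a) (at z)"
    and dr: "(r has_derivative r') (at z0)"
    and g: "\<And>z. z \<in> S \<Longrightarrow> L z (g z) = r z"
    and lin: "linear G" and G: "\<And>h. L z0 (G h) = r' h - (\<Sum>b\<in>Basis. (g z0 \<bullet> b) *\<^sub>R L' z0 b h)"
  shows "(g has_derivative G) (at z0)"
proof -
  have cont: "continuous_on S (\<lambda>z. L z a)" for a
    using dL by (auto intro!: continuous_at_imp_continuous_on has_derivative_continuous)
  obtain m where m: "m > 0" "\<forall>\<^sub>F z in nhds z0. z \<in> S \<and> (\<forall>a. m * norm a \<le> norm (L z a))"
    using injective_family_bounded_below[OF assms(1-4) cont] by blast
  \<comment> \<open>On \<open>S\<close> this is \<open>L z\<close> applied to g(z) - g(z0) - G(z -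
    z0), expanded in the basis so that only derivatives of \<open>L z b\<close> for fixed
    \<open>b\<close> occur; by the equation for \<open>G\<close> its derivative at \<open>z0\<close>
    vanishes.\<close>
  define R where "R z = r z - (\<Sum>b\<in>Basis. (g z0 \<bullet> b) *\<^sub>R L z b)
       - (\<Sum>b\<in>Basis. (G (z - z0) \<bullet> b) *\<^sub>R L z b)" for z
  have bG: "bounded_linear G" using lin linear_conv_bounded_linear by blast
  have dG: "((\<lambda>z. G (z - z0) \<bullet> b) has_derivative (\<lambda>h. G h \<bullet> b)) (at z0)" for b
  proof -
    have "bounded_linear (\<lambda>h. G h \<bullet> b)"
      using bounded_linear_compose[OF bounded_linear_inner_left bG] by blast
    then show ?thesis
      by (rule bounded_linear.has_derivative[of "\<lambda>h. G h \<bullet> b"]) (auto intro!: derivative_eq_intros)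
  qed
  have "(R has_derivative (\<lambda>h. r' h - (\<Sum>b\<in>Basis. (g z0 \<bullet> b) *\<^sub>R L' z0 b h)
       - (\<Sum>b\<in>Basis. (G (z0 - z0) \<bullet> b) *\<^sub>R L' z0 b h + (G h \<bullet> b) *\<^sub>R L z0 b))) (at z0)"
    unfolding R_def using dr dL[OF assms(2)] dG
    by (intro has_derivative_diff has_derivative_sum has_derivative_scaleR has_derivative_scaleR_right) auto
  moreover have "r' h - (\<Sum>b\<in>Basis. (g z0 \<bullet> b) *\<^sub>R L' z0 b h)
       - (\<Sum>b\<in>Basis. (G (z0 - z0) \<bullet> b) *\<^sub>R L' z0 b h + (G h \<bullet> b) *\<^sub>R L z0 b) = 0" for h
    using G[of h] linear_0[OF lin] linear_euclidean_sum[OF assms(3)[OF assms(2)], of "G h"] by simp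
  ultimately have "(R has_derivative (\<lambda>h. 0)) (at z0)" by simp
  moreover have "R z0 = 0"
    using g[OF assms(2)] linear_0[OF lin] linear_euclidean_sum[OF assms(3)[OF assms(2)], of "g z0"]
    by (simp add: R_def)
  ultimately have lim: "((\<lambda>z. norm (R z) / norm (z - z0)) \<longlongrightarrow> 0) (at z0)"
    unfolding has_derivative_iff_norm by simp
  have "\<forall>\<^sub>F z in at z0. norm (norm (g z - g z0 - G (z - z0)) / norm (z - z0)) \<le> norm (norm (R z) / norm (z - z0)) * (1/m)"
  proof -
    have "\<forall>\<^sub>F z in at z0. z \<in> S \<and> (\<forall>a. m * norm a \<le> norm (L z a))"
      using m(2) eventually_at_filter eventually_mono by fastforce
    then show ?thesis
    proof eventually_elim
      case (elim z)
      let ?a = "g z - g z0 - G (z - z0)"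
      have lz: "linear (L z)" using assms(3) elim by blast
      have "L z ?a = r z - L z (g z0) - L z (G (z - z0))"
        using g elim by (simp add: linear_diff[OF lz])
      also have "\<dots> = R z"
        using linear_euclidean_sum[OF lz, of "g z0"] linear_euclidean_sum[OF lz, of "G (z - z0)"]
        by (simp add: R_def)
      finally have "m * norm ?a \<le> norm (R z)" using elim by metis
      then have "norm ?a \<le> norm (R z) / m" using m(1) by (simp add: field_simps)
      then have "norm ?a / norm (z - z0) \<le> (norm (R z) / m) / norm (z - z0)"
        by (intro divide_right_mono) auto
      then show ?case by (simp add: field_simps)
    qed
  qed
  then have "((\<lambda>z. norm (g z - g z0 - G (z - z0)) / norm (z - z0)) \<longlongrightarrow> 0) (at z0)"
    by (rule tendsto_0_le[OF lim, of _ "1/m"])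
  then show ?thesis unfolding has_derivative_iff_norm using bG by simp
qed

text \<open>The derivative of a solution solves a system with the same operators and a right-hand side that
  is one order less smooth, which gives smoothness by induction.\<close>

lemma smooth_on_linear_solve:
  fixes L :: "'a::euclidean_space \<Rightarrow> 'e::euclidean_space \<Rightarrow> 'e"
  assumes "open S" and lin: "\<And>z. z \<in> S \<Longrightarrow> linear (L z)" and inj: "\<And>z. z \<in> S \<Longrightarrow> inj (L z)"
    and L: "\<And>a. smooth_on S (\<lambda>z. L z a)" and "smooth_on S r"
    and g: "\<And>z. z \<in> S \<Longrightarrow> L z (g z) = r z"
  shows "smooth_on S g"
proof -
  define L' where "L' z a = frechet_derivative (\<lambda>z. L z a) (at z)" for z a
  have dL: "((\<lambda>z. L z a) has_derivative L' z a) (at z)" if "z \<in> S" for z a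
    unfolding L'_def using smooth_on_has_derivative[OF L that] by blast
  \<comment> \<open>\<open>r\<close> and \<open>g\<close> vary with the order: the induction
    hypothesis is applied to the directional derivatives of \<open>g\<close> and their right-hand
    sides.\<close>
  have Ck: "Ck_on k S g" if "Ck_on k S r" "\<And>z. z \<in> S \<Longrightarrow> L z (g z) = r z" for k r g
    using that
  proof (induction k arbitrary: r g)
    case 0
    have "isCont g z0" if z0: "z0 \<in> S" for z0
    proof -
      have contL: "continuous_on S (\<lambda>z. L z a)" for a using L smooth_on_imp_continuous_on by blast
      obtain m where m: "m > 0" "\<forall>\<^sub>F z in nhds z0. z \<in> S \<and> (\<forall>a. m * norm a \<le> norm (L z a))"
        using injective_family_bounded_below[OF assms(1) z0 lin inj[OF z0] contL] by blast
      \<comment> \<open>\<open>L z\<close> maps g(z) - g(z0) to this expression, so its convergence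
        to 0 and the lower bound on \<open>L z\<close> give continuity of \<open>g\<close>.\<close>
      have "((\<lambda>z. r z - L z (g z0)) \<longlongrightarrow> r z0 - L z0 (g z0)) (at z0)"
        using 0 contL[of "g z0"] assms(1) that
        by (intro tendsto_diff) (auto simp: continuous_on_eq_continuous_at isCont_def)
      then have lim: "((\<lambda>z. r z - L z (g z0)) \<longlongrightarrow> 0) (at z0)" using 0(2)[OF that] by simp
      have "\<forall>\<^sub>F z in at z0. z \<in> S \<and> (\<forall>a. m * norm a \<le> norm (L z a))"
        using m(2) eventually_at_filter eventually_mono by fastforce
      then have "\<forall>\<^sub>F z in at z0. norm (g z - g z0) \<le> norm (r z - L z (g z0)) * (1/m)"
      proof eventually_elim
        case (elim z)
        have "L z (g z - g z0) = r z - L z (g z0)" using 0(2) lin elim by (simp add: linear_diff)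
        then have "m * norm (g z - g z0) \<le> norm (r z - L z (g z0))" using elim by metis
        then show ?case using m(1) by (simp add: field_simps)
      qed
      then have "((\<lambda>z. g z - g z0) \<longlongrightarrow> 0) (at z0)" by (rule tendsto_0_le[OF lim])
      then show ?thesis using LIM_zero_iff isCont_def by blast
    qed
    then show ?case using continuous_at_imp_continuous_on by (simp add: continuous_at_imp_continuous_on)
  next
    case (Suc k)
    have gk: "Ck_on k S g" using Suc.IH Suc.prems Ck_on_SucD by blast
    let ?rhs = "\<lambda>z h. frechet_derivative r (at z) h - (\<Sum>b\<in>Basis. (g z \<bullet> b) *\<^sub>R L' z b h)"
    define G where "G z h = inv (L z) (?rhs z h)" for z h
    have surj: "surj (L z)" if "z \<in> S" for z
      using lin inj that linear_inj_imp_surj by blast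
    have LG: "L z (G z h) = ?rhs z h" if "z \<in> S" for z h
      unfolding G_def using surj[OF that] by (simp add: surj_f_inv_f)
    have linG: "linear (G z)" if "z \<in> S" for z
    proof -
      have "linear (inv (L z))" using inj_linear_imp_inv_linear lin inj that by blast
      moreover have "linear (?rhs z)"
      proof -
        have "linear (frechet_derivative r (at z))" using Suc.prems(1) that by (auto simp: linear_frechet_derivative)
        moreover have "linear (L' z b)" for b using dL[OF that] has_derivative_linear by blast
        ultimately show ?thesis
          by (intro linear_compose_sub linear_compose_sum ballI linear_compose_scale_right) auto
      qed
      ultimately have "linear (inv (L z) \<circ> ?rhs z)" using linear_compose by blast
      moreover have "inv (L z) \<circ> ?rhs z = G z" by (auto simp: G_def)
      ultimately show ?thesis by simp
    qed
    have "(g has_derivative G z) (at z)" if "z \<in> S" for z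
      by (rule has_derivative_linear_solve[where r=r and S=S and L=L and L'=L', OF assms(1) that lin inj[OF that] dL _ Suc.prems(2) linG[OF that]])
        (use LG[OF that] Ck_on_SucE(1)[OF Suc.prems(1) that] in auto)
    moreover have "Ck_on k S (\<lambda>z. G z h)" for h
    proof (rule Suc.IH[of "\<lambda>z. ?rhs z h"])
      have "Ck_on k S (\<lambda>z. frechet_derivative r (at z) h + (\<Sum>b\<in>Basis. (g z \<bullet> b) *\<^sub>R (- L' z b h)))"
        using Suc.prems(1) smooth_on_frechet_derivative[OF L] gk
        by (intro Ck_on_add[OF assms(1)] Ck_on_sum[OF assms(1)]
            Ck_on_bilinear[OF assms(1) bounded_bilinear_scaleR]
            Ck_on_linear_compose[OF assms(1) bounded_linear_inner_left]
            Ck_on_linear_compose[OF assms(1) bounded_linear_minus[OF bounded_linear_ident]])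
          (auto simp: L'_def smooth_on_def)
      then show "Ck_on k S (\<lambda>z. ?rhs z h)" by (simp add: sum_negf)
    qed (use LG in auto)
    ultimately show ?case by (rule Ck_on_SucI[OF assms(1)])
  qed
  show ?thesis unfolding smooth_on_def using Ck assms(5) g unfolding smooth_on_def by blast
qed

subsection \<open>A smooth bump function\<close>

text \<open>Polynomials in 1/t as factors make this family closed under differentiation, which
  allows a single induction over all orders; \<open>P = 1\<close> is the classical function
  exp(-1/t) extended by 0.\<close>

definition flat_exp :: "real poly \<Rightarrow> real \<Rightarrow> real" where
  "flat_exp P t = (if t \<le> 0 then 0 else poly P (1/t) * exp (- (1/t)))"

lemma poly_times_exp_tendsto_0: "((\<lambda>s::real. poly P s * exp (- s)) \<longlongrightarrow> 0) at_top"
proof -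
  have "((\<lambda>s::real. \<Sum>i\<le>degree P. coeff P i * (s ^ i / exp s)) \<longlongrightarrow> (\<Sum>i\<le>degree P. coeff P i * 0)) at_top"
    by (intro tendsto_sum tendsto_mult tendsto_const tendsto_power_div_exp_0)
  then show ?thesis by (simp add: poly_altdef exp_minus divide_inverse sum_distrib_right mult.assoc)
qed

lemma flat_exp_tendsto_0: "(flat_exp P \<longlongrightarrow> 0) (at 0)"
proof -
  have "((\<lambda>t. poly P (1/t) * exp (- (1/t))) \<longlongrightarrow> 0) (at_right (0::real))"
    using filterlim_compose[OF poly_times_exp_tendsto_0 filterlim_inverse_at_top_right]
    by (simp add: inverse_eq_divide)
  then have "(flat_exp P \<longlongrightarrow> 0) (at_right 0)"
    by (rule Lim_transform_eventually) (auto simp: flat_exp_def eventually_at_right_less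
        intro: eventually_mono[OF eventually_at_right_less])
  moreover have "(flat_exp P \<longlongrightarrow> 0) (at_left 0)"
    by (rule Lim_transform_eventually[of "\<lambda>_. 0"])
      (auto simp: flat_exp_def eventually_at_filter)
  ultimately show ?thesis by (simp add: filterlim_at_split)
qed

text \<open>With s = 1/t and ds/dt = -s^2, the derivative of P(s) exp(-s) is s^2 (P(s) - P'(s))
  exp(-s); the polynomial \<open>[:0, 0, 1:]\<close> is s^2.\<close>

lemma flat_exp_has_derivative:
  "(flat_exp P has_real_derivative flat_exp ([:0, 0, 1:] * (P - pderiv P)) t) (at t)"
proof -
  consider "t < 0" | "t = 0" | "t > 0" by linarith
  then show ?thesis
  proof cases
    case 1
    have "((\<lambda>_. 0) has_real_derivative 0) (at t)" by simp
    then have "(flat_exp P has_real_derivative 0) (at t)"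
      by (rule has_field_derivative_transform_within_open[of _ _ _ "{..<0}"]) (use 1 in \<open>auto simp: flat_exp_def\<close>)
    then show ?thesis using 1 by (simp add: flat_exp_def)
  next
    case 2
    \<comment> \<open>The difference quotient at 0 is again a flat function, now with the polynomial
      s P(s), since dividing by t multiplies by s.\<close>
    have "((\<lambda>t. (flat_exp P t - flat_exp P 0) / (t - 0)) \<longlongrightarrow> 0) (at 0)"
      by (rule Lim_transform_eventually[OF flat_exp_tendsto_0[of "pCons 0 P"]])
        (auto simp: flat_exp_def eventually_at_filter)
    then show ?thesis using 2 by (simp add: has_field_derivative_iff) (simp add: flat_exp_def)
  next
    case 3
    have "((\<lambda>t. poly P (1/t) * exp (- (1/t))) has_real_derivative
        poly P (1/t) * (exp (- (1/t)) * (1/t^2)) + (poly (pderiv P) (1/t) * (- (1/t^2))) * exp (- (1/t))) (at t)"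
      using 3 by (auto intro!: derivative_eq_intros DERIV_chain2[OF poly_DERIV] simp: power2_eq_square)
    then have "(flat_exp P has_real_derivative
        poly P (1/t) * (exp (- (1/t)) * (1/t^2)) + (poly (pderiv P) (1/t) * (- (1/t^2))) * exp (- (1/t))) (at t)"
      by (rule has_field_derivative_transform_within_open[of _ _ _ "{0<..}"]) (use 3 in \<open>auto simp: flat_exp_def\<close>)
    then show ?thesis using 3 by (simp add: flat_exp_def power2_eq_square algebra_simps)
  qed
qed

lemma smooth_on_flat_exp: "smooth_on UNIV (flat_exp P)"
proof -
  have "Ck_on k UNIV (flat_exp P)" for k
  proof (induction k arbitrary: P)
    case 0
    then show ?case
      by (auto intro!: continuous_at_imp_continuous_on DERIV_isCont[OF flat_exp_has_derivative])
  next
    case (Suc k)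
    let ?Q = "[:0, 0, 1:] * (P - pderiv P)"
    show ?case
    proof (rule Ck_on_SucI[where f'="\<lambda>t v. v * flat_exp ?Q t"])
      show "(flat_exp P has_derivative (\<lambda>v. v * flat_exp ?Q t)) (at t)" for t
        using flat_exp_has_derivative[of P t] by (simp add: has_field_derivative_def mult_commute_abs)
      show "Ck_on k UNIV (\<lambda>t. v * flat_exp ?Q t)" for v
        by (rule Ck_on_linear_compose[OF _ bounded_linear_mult_right Suc.IH]) auto
    qed auto
  qed
  then show ?thesis by (simp add: smooth_on_def)
qed

text \<open>The squared distance is a polynomial, which makes the function smooth at the centre as
  well.\<close>

definition bump :: "'a::euclidean_space \<Rightarrow> real \<Rightarrow> 'a \<Rightarrow> real" where
  "bump x0 r x = flat_exp 1 (r\<^sup>2 - (x - x0) \<bullet> (x - x0))"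

lemma smooth_on_bump: "smooth_on UNIV (bump x0 r)"
proof -
  have d: "smooth_on UNIV (\<lambda>x::'a. x - x0)"
    by (intro smooth_on_diff smooth_on_id smooth_on_const) auto
  have "smooth_on UNIV (\<lambda>x::'a. r\<^sup>2 - (x - x0) \<bullet> (x - x0))"
    by (intro smooth_on_diff smooth_on_const smooth_on_bilinear[OF _ bounded_bilinear_inner] d) auto
  from smooth_on_compose[OF _ _ _ this smooth_on_flat_exp[of 1]]
  show ?thesis unfolding bump_def[abs_def] by auto
qed

lemma bump_centre: "r > 0 \<Longrightarrow> bump x0 r x0 > 0"
  by (simp add: bump_def flat_exp_def)

lemma bump_outside: "r > 0 \<Longrightarrow> x \<notin> ball x0 r \<Longrightarrow> bump x0 r x = 0"
proof -
  assume "r > 0" "x \<notin> ball x0 r"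
  then have "r \<le> norm (x - x0)" by (simp add: dist_norm norm_minus_commute)
  then have "r\<^sup>2 \<le> (norm (x - x0))\<^sup>2" using \<open>r > 0\<close> by (intro power_mono) auto
  then show ?thesis by (simp add: bump_def flat_exp_def power2_norm_eq_inner)
qed

section \<open>Ordinary differential equations\<close>

lemma has_vector_derivative_norm_bound:
  fixes z :: "real \<Rightarrow> 'b::real_normed_vector"
  assumes "convex S" "\<And>t. t \<in> S \<Longrightarrow> (z has_vector_derivative z' t) (at t within S)"
    and "\<And>t. t \<in> S \<Longrightarrow> norm (z' t) \<le> B" "s \<in> S" "t \<in> S"
  shows "norm (z t - z s) \<le> B * \<bar>t - s\<bar>"
proof -
  have "norm (z t - z s) \<le> B * norm (t - s)"
  proof (rule differentiable_bound[OF assms(1), of z "\<lambda>t h. h *\<^sub>R z' t"])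
    show "onorm (\<lambda>h. h *\<^sub>R z' r) \<le> B" if "r \<in> S" for r
    proof (rule onorm_le)
      fix h :: real
      have "norm (h *\<^sub>R z' r) = norm (z' r) * norm h" by simp
      also have "\<dots> \<le> B * norm h" using assms(3)[OF that] by (rule mult_right_mono) simp
      finally show "norm (h *\<^sub>R z' r) \<le> B * norm h" .
    qed
  qed (use assms in \<open>auto simp: has_vector_derivative_def\<close>)
  then show ?thesis by simp
qed

text \<open>On an interval of length comparable to \<open>1/L\<close>, evaluating at a maximum point replaces
  Gronwall's inequality.\<close>

lemma short_time_gronwall:
  fixes z :: "real \<Rightarrow> 'b::real_normed_vector"
  assumes "T > 0" "L \<ge> 0" "K \<ge> 0" "T * L \<le> 1/2"
    and d: "\<And>t. t \<in> {-T..T} \<Longrightarrow> (z has_vector_derivative z' t) (at t within {-T..T})"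
    and b: "\<And>t. t \<in> {-T..T} \<Longrightarrow> norm (z' t) \<le> L * norm (z t) + K"
    and "t \<in> {-T..T}"
  shows "norm (z t) \<le> 2 * norm (z 0) + 2 * T * K"
proof -
  have "continuous_on {-T..T} (\<lambda>t. norm (z t))"
    using d has_vector_derivative_continuous continuous_on_eq_continuous_within
    by (intro continuous_on_norm) blast
  then obtain m where m: "m \<in> {-T..T}" "\<And>s. s \<in> {-T..T} \<Longrightarrow> norm (z s) \<le> norm (z m)"
    using continuous_attains_sup[of "{-T..T}" "\<lambda>t. norm (z t)"] assms(1) by auto
  have "norm (z' s) \<le> L * norm (z m) + K" if "s \<in> {-T..T}" for s
    using b[OF that] mult_left_mono[OF m(2)[OF that] assms(2)] by linarith
  then have "norm (z m - z 0) \<le> (L * norm (z m) + K) * \<bar>m - 0\<bar>"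
    using assms(1) m(1) by (intro has_vector_derivative_norm_bound[OF _ d]) auto
  also have "\<dots> \<le> (L * norm (z m) + K) * T"
    using m(1) assms by (intro mult_left_mono) auto
  also have "\<dots> = (T * L) * norm (z m) + T * K" by (simp add: algebra_simps)
  \<comment> \<open>\<open>T * L \<le> 1/2\<close> leaves half of the maximum on the right, which is
    absorbed on the left.\<close>
  also have "\<dots> \<le> (1/2) * norm (z m) + T * K"
    using assms(4) by (intro add_right_mono mult_right_mono) auto
  finally have "norm (z m) \<le> 2 * norm (z 0) + 2 * T * K"
    using norm_triangle_sub[of "z m" "z 0"] by linarith
  then show ?thesis using m(2)[OF assms(7)] by linarith
qed

section \<open>Existence of solutions\<close>

text \<open>Picard iteration in the space of bounded continuous curves. Time dependence and an
  arbitrary Banach space are allowed because the lemma serves both the differential equation itself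
  and its linearisation, whose unknown is an operator.\<close>

lemma ode_solution_exists:
  fixes G :: "real \<Rightarrow> 'b::banach \<Rightarrow> 'b"
  assumes "T > 0" "L \<ge> 0" "T * L \<le> 1/2"
    and cont: "\<And>u. continuous_on {-T..T} u \<Longrightarrow> continuous_on {-T..T} (\<lambda>t. G t (u t))"
    and lip: "\<And>t y z. t \<in> {-T..T} \<Longrightarrow> norm (G t y - G t z) \<le> L * norm (y - z)"
  shows "\<exists>u. u 0 = y0 \<and> (\<forall>t\<in>{-T..T}. (u has_vector_derivative G t (u t)) (at t within {-T..T}))"
proof -
  \<comment> \<open>Integrating from -T and later subtracting the value at 0 avoids oriented
    integrals for negative times.\<close>
  define J where "J u t = integral {-T..t} (\<lambda>s. G s (apply_bcontfun u s))"
    for u :: "real \<Rightarrow>\<^sub>C 'b" and t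
  \<comment> \<open>Clamping time to [-T, T] extends curves to bounded continuous functions on the
    whole line, which form a complete space.\<close>
  define c where "c t = max (-T) (min T t)" for t
  have c: "c t \<in> {-T..T}" for t using assms(1) by (auto simp: c_def)
  have cid: "c t = t" if "t \<in> {-T..T}" for t using that by (auto simp: c_def)
  have 0: "0 \<in> {-T..T}" using assms(1) by auto
  have J: "(J u has_vector_derivative G t (apply_bcontfun u t)) (at t within {-T..T})"
    if "t \<in> {-T..T}" for u t
    unfolding J_def
    by (rule integral_has_vector_derivative[OF cont that])
      (auto intro: continuous_on_subset[OF continuous_on_apply_bcontfun])
  have Jc: "continuous_on {-T..T} (J u)" for u
    using J has_vector_derivative_continuous continuous_on_eq_continuous_within by blast
  have cc: "continuous_on UNIV c" unfolding c_def[abs_def] by (intro continuous_intros)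
  have bc: "(\<lambda>t. y0 + J u (c t) - J u 0) \<in> bcontfun" for u
  proof -
    have "continuous_on UNIV (\<lambda>t. J u (c t))"
      by (rule continuous_on_compose2[OF Jc cc]) (use c in auto)
    then have "continuous_on UNIV (\<lambda>t. y0 + J u (c t) - J u 0)"
      by (intro continuous_intros)
    moreover have "compact ((\<lambda>r. y0 + J u r - J u 0) ` {-T..T})"
      by (intro compact_continuous_image continuous_intros Jc) auto
    then have "bounded ((\<lambda>r. y0 + J u r - J u 0) ` {-T..T})" by (rule compact_imp_bounded)
    then have "bounded (range (\<lambda>t. y0 + J u (c t) - J u 0))"
      by (rule bounded_subset) (use c in auto)
    ultimately show ?thesis by (simp add: bcontfun_def)
  qed
  define P where "P u = Bcontfun (\<lambda>t. y0 + J u (c t) - J u 0)" for u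
  have P: "apply_bcontfun (P u) t = y0 + J u (c t) - J u 0" for u t
    using Bcontfun_inverse[OF bc[of u]] by (simp add: P_def)
  have "dist (P u) (P v) \<le> (1/2) * dist u v" for u v
  proof (rule dist_bound)
    fix t
    have "norm ((J u (c t) - J v (c t)) - (J u 0 - J v 0)) \<le> (L * dist u v) * \<bar>c t - 0\<bar>"
    proof (rule has_vector_derivative_norm_bound[of "{-T..T}"])
      show "((\<lambda>t. J u t - J v t) has_vector_derivative
          (G t (apply_bcontfun u t) - G t (apply_bcontfun v t))) (at t within {-T..T})"
        if "t \<in> {-T..T}" for t
        using J[OF that] by (intro has_vector_derivative_diff) auto
      show "norm (G t (apply_bcontfun u t) - G t (apply_bcontfun v t)) \<le> L * dist u v"
        if "t \<in> {-T..T}" for t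
        using lip[OF that, of "apply_bcontfun u t" "apply_bcontfun v t"]
          mult_left_mono[OF dist_bounded[of u t v] assms(2)] by (simp add: dist_norm)
    qed (use c 0 in auto)
    also have "\<dots> \<le> (L * dist u v) * T"
      using c[of t] assms(2) by (intro mult_left_mono) auto
    also have "\<dots> = (T * L) * dist u v" by simp
    also have "\<dots> \<le> (1/2) * dist u v"
      using assms(3) by (rule mult_right_mono) simp
    finally show "dist (apply_bcontfun (P u) t) (apply_bcontfun (P v) t) \<le> (1/2) * dist u v"
      by (simp add: P dist_norm algebra_simps)
  qed
  then obtain u where u: "P u = u" using banach_fix_type[of "1/2" P] by auto
  have eq: "apply_bcontfun u t = y0 + J u (c t) - J u 0" for t using P[of u t] u by simp
  have "(apply_bcontfun u has_vector_derivative G t (apply_bcontfun u t)) (at t within {-T..T})"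
    if "t \<in> {-T..T}" for t
  proof (rule has_vector_derivative_transform[OF that])
    show "apply_bcontfun u s = y0 + J u s - J u 0" if "s \<in> {-T..T}" for s
      using eq[of s] cid[OF that] by simp
    show "((\<lambda>s. y0 + J u s - J u 0) has_vector_derivative G t (apply_bcontfun u t)) (at t within {-T..T})"
      using J[OF that, of u] by (auto intro!: derivative_eq_intros)
  qed
  moreover have "apply_bcontfun u 0 = y0" using eq[of 0] cid[OF 0] by simp
  ultimately show ?thesis by blast
qed

section \<open>Dependence of solutions on initial values\<close>

text \<open>Continuity in operator norm, which in finite dimension follows from continuity of the
  directional derivatives, is what yields bounds and uniform continuity on compact balls.\<close>

lemma smooth_on_derivative_blinfun:
  fixes f :: "'a::euclidean_space \<Rightarrow> 'b::euclidean_space"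
  assumes "smooth_on S f"
  obtains D where "\<And>x. x \<in> S \<Longrightarrow> blinfun_apply (D x) = frechet_derivative f (at x)"
    "continuous_on S D"
proof -
  let ?D = "\<lambda>x. Blinfun (frechet_derivative f (at x))"
  have 1: "blinfun_apply (?D x) = frechet_derivative f (at x)" if "x \<in> S" for x
    using smooth_on_has_derivative[OF assms that] has_derivative_bounded_linear
      bounded_linear_Blinfun_apply by blast
  have "continuous_on S (\<lambda>x. blinfun_apply (?D x) v)" for v
    using smooth_on_imp_continuous_on[OF smooth_on_frechet_derivative[OF assms, of v]]
      continuous_on_cong[OF refl, of S "\<lambda>x. blinfun_apply (?D x) v" "\<lambda>x. frechet_derivative f (at x) v"] 1
    by simp
  then have "continuous_on S ?D" by (intro continuous_on_blinfun_componentwise) auto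
  with 1 show thesis by (rule that[of ?D])
qed

text \<open>A closed ball is compact, which bounds the derivative, and convex, which turns this
  bound into a Lipschitz constant.\<close>

lemma smooth_on_lipschitz_cball:
  fixes f :: "'a::euclidean_space \<Rightarrow> 'b::euclidean_space"
  assumes "smooth_on S f" "cball x0 R \<subseteq> S"
  obtains L where "L > 0"
    "\<And>x y. x \<in> cball x0 R \<Longrightarrow> y \<in> cball x0 R \<Longrightarrow> norm (f x - f y) \<le> L * norm (x - y)"
    "\<And>x h. x \<in> cball x0 R \<Longrightarrow> norm (frechet_derivative f (at x) h) \<le> L * norm h"
proof -
  obtain D where D: "\<And>x. x \<in> S \<Longrightarrow> blinfun_apply (D x) = frechet_derivative f (at x)"
    "continuous_on S D" using smooth_on_derivative_blinfun[OF assms(1)] by blast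
  have "bounded (D ` cball x0 R)"
    by (intro compact_imp_bounded compact_continuous_image continuous_on_subset[OF D(2)] assms(2)) auto
  then obtain L where L: "L > 0" "\<And>x. x \<in> cball x0 R \<Longrightarrow> norm (D x) \<le> L"
    unfolding bounded_pos by blast
  have h: "norm (frechet_derivative f (at x) h) \<le> L * norm h" if "x \<in> cball x0 R" for x h
    using norm_blinfun[of "D x" h] mult_right_mono[OF L(2)[OF that], of "norm h"] D(1)[of x] assms(2) that
    by (metis norm_ge_zero order_trans subsetD)
  have "norm (f x - f y) \<le> L * norm (x - y)" if "x \<in> cball x0 R" "y \<in> cball x0 R" for x y
  proof (rule differentiable_bound[OF convex_cball, of x0 R f "\<lambda>x. frechet_derivative f (at x)" L])
    show "(f has_derivative frechet_derivative f (at z)) (at z within cball x0 R)" if "z \<in> cball x0 R" for z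
      using smooth_on_has_derivative[OF assms(1), of z] assms(2) that has_derivative_at_withinI by blast
    show "onorm (frechet_derivative f (at z)) \<le> L" if "z \<in> cball x0 R" for z
      using h[OF that] by (intro onorm_le) auto
  qed (use that in auto)
  then show thesis using that[OF L(1)] h by blast
qed

text \<open>\<open>w\<close> solves the equation linearised along \<open>u\<close>, and a Gronwall
  estimate for the first-order remainder shows it to be the derivative of the flow in the initial
  point. The last conclusion keeps \<open>w t x\<close> within 1/2 of the identity, hence injective;
  later it guarantees that nonzero tangent vectors stay nonzero.\<close>

theorem local_flow_exists:
  fixes f :: "'a::euclidean_space \<Rightarrow> 'a"
  assumes "open S" "smooth_on S f" "x0 \<in> S"
  obtains \<epsilon> \<delta> u w where "\<epsilon> > 0" "\<delta> > 0" "ball x0 \<delta> \<subseteq> S"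
    "\<And>x. x \<in> ball x0 \<delta> \<Longrightarrow> u 0 x = x"
    "\<And>x h. x \<in> ball x0 \<delta> \<Longrightarrow> w 0 x h = h"
    "\<And>x t. x \<in> ball x0 \<delta> \<Longrightarrow> \<bar>t\<bar> < \<epsilon> \<Longrightarrow> u t x \<in> S"
    "\<And>x t. x \<in> ball x0 \<delta> \<Longrightarrow> \<bar>t\<bar> < \<epsilon> \<Longrightarrow> ((\<lambda>t. u t x) has_vector_derivative f (u t x)) (at t)"
    "\<And>x t. x \<in> ball x0 \<delta> \<Longrightarrow> \<bar>t\<bar> < \<epsilon> \<Longrightarrow> (u t has_derivative w t x) (at x)"
    "\<And>x t h. x \<in> ball x0 \<delta> \<Longrightarrow> \<bar>t\<bar> < \<epsilon> \<Longrightarrow>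
       ((\<lambda>t. w t x h) has_vector_derivative frechet_derivative f (at (u t x)) (w t x h)) (at t)"
    "\<And>x t h. x \<in> ball x0 \<delta> \<Longrightarrow> \<bar>t\<bar> < \<epsilon> \<Longrightarrow> norm (w t x h - h) \<le> norm h / 2"
proof -
  obtain R where R: "R > 0" "cball x0 R \<subseteq> S" using assms(1,3) open_contains_cball by blast
  obtain L where L: "L > 0"
    "\<And>x y. x \<in> cball x0 R \<Longrightarrow> y \<in> cball x0 R \<Longrightarrow> norm (f x - f y) \<le> L * norm (x - y)"
    "\<And>x h. x \<in> cball x0 R \<Longrightarrow> norm (frechet_derivative f (at x) h) \<le> L * norm h"
    using smooth_on_lipschitz_cball[OF assms(2) R(2)] by blast
  obtain D where D: "\<And>x. x \<in> S \<Longrightarrow> blinfun_apply (D x) = frechet_derivative f (at x)"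
    "continuous_on S D" using smooth_on_derivative_blinfun[OF assms(2)] by blast
  have "bounded (f ` cball x0 R)"
    by (intro compact_imp_bounded compact_continuous_image continuous_on_subset[OF smooth_on_imp_continuous_on[OF assms(2)]] R) auto
  then obtain M where M: "M > 0" "\<And>x. x \<in> cball x0 R \<Longrightarrow> norm (f x) \<le> M"
    unfolding bounded_pos by blast
  \<comment> \<open>\<open>T * L \<le> 1/4\<close> makes the iteration contract and gives the bound
    1/2 on the deviation of \<open>w\<close> from the identity; \<open>M * T \<le> R/4\<close> keeps
    solutions that start in the ball of radius R/2 inside the ball of radius R.\<close>
  define T where "T = min (1 / (4 * L)) (R / (4 * M))"
  have T: "T > 0" "T * L \<le> 1/4" "M * T \<le> R/4"
  proof -
    show "T > 0" using L(1) M(1) R(1) by (simp add: T_def)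
    have "T * L \<le> (1 / (4 * L)) * L" using L(1) by (intro mult_right_mono) (auto simp: T_def)
    then show "T * L \<le> 1/4" using L(1) by simp
    have "M * T \<le> M * (R / (4 * M))" using M(1) by (intro mult_left_mono) (auto simp: T_def)
    then show "M * T \<le> R/4" using M(1) by simp
  qed
  \<comment> \<open>Composition with the nearest-point projection, which is 1-Lipschitz, makes the
    right-hand side globally Lipschitz. Solutions that start in the half ball do not leave the ball,
    so they solve the original equation.\<close>
  define F where "F y = f (closest_point (cball x0 R) y)" for y
  have cp: "closest_point (cball x0 R) y \<in> cball x0 R" for y
    using R(1) by (intro closest_point_in_set) auto
  have F_lip: "norm (F y - F z) \<le> L * norm (y - z)" for y z
  proof -
    have "norm (F y - F z) \<le> L * norm (closest_point (cball x0 R) y - closest_point (cball x0 R) z)"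
      unfolding F_def by (rule L(2)[OF cp cp])
    also have "\<dots> \<le> L * norm (y - z)"
      using closest_point_lipschitz[of "cball x0 R" y z] R(1) L(1)
      by (intro mult_left_mono) (auto simp: dist_norm)
    finally show ?thesis .
  qed
  have Fc: "continuous_on A F" for A
  proof -
    have "L-lipschitz_on A F" using F_lip L(1) by (intro lipschitz_onI) (auto simp: dist_norm)
    then show ?thesis by (rule lipschitz_on_continuous_on)
  qed
  have "\<exists>u. u 0 = x \<and> (\<forall>t\<in>{-T..T}. (u has_vector_derivative F (u t)) (at t within {-T..T}))" for x
    by (rule ode_solution_exists[OF T(1), of L "\<lambda>t. F"])
      (use L(1) T(2) F_lip in \<open>auto intro: continuous_on_compose2[OF Fc[of UNIV]]\<close>)
  then obtain v where v0: "\<And>x. v x 0 = x"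
    and vF: "\<And>x t. t \<in> {-T..T} \<Longrightarrow> (v x has_vector_derivative F (v x t)) (at t within {-T..T})"
    by metis
  have vball: "v x t \<in> ball x0 R" if "x \<in> ball x0 (R/2)" "t \<in> {-T..T}" for x t
  proof -
    have "norm (v x t - v x 0) \<le> M * \<bar>t - 0\<bar>"
      by (rule has_vector_derivative_norm_bound[OF _ vF]) (use T(1) M(2)[OF cp] that F_def in auto)
    also have "\<dots> \<le> M * T" using that(2) M(1) by (intro mult_left_mono) auto
    finally have "dist (v x t) x \<le> R/4" using T(3) v0 by (simp add: dist_norm)
    then show ?thesis using that(1) R(1) dist_triangle[of x0 "v x t" x] by (auto simp: dist_commute)
  qed
  have Ff: "F y = f y" if "y \<in> ball x0 R" for y
    using that by (simp add: F_def closest_point_self)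
  have vf: "(v x has_vector_derivative f (v x t)) (at t within {-T..T})"
    if "x \<in> ball x0 (R/2)" "t \<in> {-T..T}" for x t
    using vF[OF that(2), of x] Ff[OF vball[OF that]] by simp
  have vcont: "continuous_on {-T..T} (v x)" for x
    using vF has_vector_derivative_continuous continuous_on_eq_continuous_within by blast
  \<comment> \<open>The linearised equation is solved for operators with initial value the identity,
    so linearity in the initial vector is automatic.\<close>
  have "\<exists>W. W 0 = id_blinfun \<and> (\<forall>t\<in>{-T..T}. (W has_vector_derivative (D (v x t) o\<^sub>L W t)) (at t within {-T..T}))"
    if x: "x \<in> ball x0 (R/2)" for x
  proof (rule ode_solution_exists[OF T(1), of L])
    have Dv: "continuous_on {-T..T} (\<lambda>t. D (v x t))"
      by (rule continuous_on_compose2[OF D(2) vcont]) (use vball[OF x] R(2) in force)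
    show "continuous_on {-T..T} (\<lambda>t. D (v x t) o\<^sub>L W t)" if "continuous_on {-T..T} W" for W
      using Dv that by (rule bounded_bilinear.continuous_on[OF bounded_bilinear_blinfun_compose])
    show "norm ((D (v x t) o\<^sub>L W) - (D (v x t) o\<^sub>L Z)) \<le> L * norm (W - Z)" if "t \<in> {-T..T}" for t W Z
    proof -
      have vb: "v x t \<in> cball x0 R" using vball[OF x that] by auto
      have "norm (D (v x t)) \<le> L"
        by (rule norm_blinfun_bound) (use L(1) L(3)[OF vb] D(1)[of "v x t"] R(2) vb in auto)
      moreover have "(D (v x t) o\<^sub>L W) - (D (v x t) o\<^sub>L Z) = D (v x t) o\<^sub>L (W - Z)"
        by (rule blinfun_eqI) (simp add: blinfun.diff_left blinfun.diff_right)
      ultimately show ?thesis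
        using norm_blinfun_compose[of "D (v x t)" "W - Z"] mult_right_mono[of "norm (D (v x t))" L "norm (W - Z)"]
        by simp
    qed
  qed (use L(1) T(2) in auto)
  then obtain W where W0: "\<And>x. x \<in> ball x0 (R/2) \<Longrightarrow> W x 0 = id_blinfun"
    and WD: "\<And>x t. x \<in> ball x0 (R/2) \<Longrightarrow> t \<in> {-T..T} \<Longrightarrow>
       (W x has_vector_derivative (D (v x t) o\<^sub>L W x t)) (at t within {-T..T})"
    by metis
  define u where "u t x = v x t" for t x
  define w where "w t x h = blinfun_apply (W x t) h" for t x h
  have wd: "((\<lambda>t. w t x h) has_vector_derivative frechet_derivative f (at (v x t)) (w t x h)) (at t within {-T..T})"
    if "x \<in> ball x0 (R/2)" "t \<in> {-T..T}" for x t h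
  proof -
    have "bounded_linear (\<lambda>W. blinfun_apply W h)" by (rule blinfun.bounded_linear_left)
    from bounded_linear.has_vector_derivative[OF this WD[OF that]]
    have "((\<lambda>t. W x t h) has_vector_derivative D (v x t) (W x t h)) (at t within {-T..T})" by simp
    moreover have "v x t \<in> S" using vball[OF that] R(2) ball_subset_cball by blast
    ultimately show ?thesis using D(1) by (simp add: w_def)
  qed
  have at: "at t within {-T..T} = at t" if "\<bar>t\<bar> < T" for t
    by (rule at_within_Icc_at) (use that in auto)
  have w0: "w 0 x h = h" if "x \<in> ball x0 (R/2)" for x h using W0[OF that] by (simp add: w_def)
  show thesis
  proof (rule that[of T "R/2" u w])
    show "T > 0" "R/2 > 0" using T(1) R(1) by auto
    show "ball x0 (R/2) \<subseteq> S" using R by (auto simp: subset_iff)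
    show "u 0 x = x" for x by (simp add: u_def v0)
    show "w 0 x h = h" if "x \<in> ball x0 (R/2)" for x h by (rule w0[OF that])
    fix x t assume x: "x \<in> ball x0 (R/2)" and t: "\<bar>t\<bar> < T"
    have t': "t \<in> {-T..T}" using t by auto
    show "u t x \<in> S" using vball[OF x t'] R(2) ball_subset_cball unfolding u_def by blast
    show "((\<lambda>t. u t x) has_vector_derivative f (u t x)) (at t)"
      using vf[OF x t'] at[OF t] by (simp add: u_def)
    show "((\<lambda>t. w t x h) has_vector_derivative frechet_derivative f (at (u t x)) (w t x h)) (at t)" for h
      using wd[OF x t', of h] at[OF t] by (simp add: u_def)
    show "norm (w t x h - h) \<le> norm h / 2" for h
    proof -
      \<comment> \<open>The deviation starts at 0, and the norm of its derivative is at most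
        \<open>L\<close> times that of the deviation plus \<open>L * norm h\<close>.\<close>
      have "norm (w t x h - h) \<le> 2 * norm (w 0 x h - h) + 2 * T * (L * norm h)"
      proof (rule short_time_gronwall[of T L _ "\<lambda>t. w t x h - h" "\<lambda>t. frechet_derivative f (at (v x t)) (w t x h)"])
        show "((\<lambda>t. w t x h - h) has_vector_derivative frechet_derivative f (at (v x t)) (w t x h)) (at t within {-T..T})"
          if "t \<in> {-T..T}" for t
          using wd[OF x that, of h] by (auto intro!: derivative_eq_intros)
        show "norm (frechet_derivative f (at (v x t)) (w t x h)) \<le> L * norm (w t x h - h) + L * norm h"
          if "t \<in> {-T..T}" for t
        proof -
          have "norm (frechet_derivative f (at (v x t)) (w t x h)) \<le> L * norm (w t x h)"
            using L(3)[of "v x t"] vball[OF x that] by auto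
          also have "\<dots> \<le> L * (norm (w t x h - h) + norm h)"
            using L(1) norm_triangle_sub[of "w t x h" h] by (intro mult_left_mono) auto
          finally show ?thesis by (simp add: distrib_left)
        qed
      qed (use T L(1) t' in auto)
      also have "\<dots> = 2 * (T * L) * norm h" using w0[OF x] by simp
      also have "\<dots> \<le> 2 * (1/4) * norm h" using T(2) by (intro mult_right_mono mult_left_mono) auto
      finally show ?thesis by simp
    qed
    show "(u t has_derivative w t x) (at x)"
      unfolding has_derivative_at_alt
    proof (intro conjI allI impI)
      show "bounded_linear (w t x)" unfolding w_def by (rule blinfun.bounded_linear_right)
      fix e :: real assume "e > 0"
      \<comment> \<open>Chosen so that the final estimate
        \<open>2 * T * (\<eta> * (2 * norm (y - x)))\<close> equals
        \<open>e * norm (y - x)\<close>.\<close>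
      define \<eta> where "\<eta> = e / (4 * T)"
      have "\<eta> > 0" using \<open>e > 0\<close> T(1) by (simp add: \<eta>_def)
      have "uniformly_continuous_on (cball x0 R) D"
        by (intro compact_uniformly_continuous continuous_on_subset[OF D(2) R(2)] compact_cball)
      then obtain d0 where d0: "d0 > 0"
        "\<And>a b. a \<in> cball x0 R \<Longrightarrow> b \<in> cball x0 R \<Longrightarrow> dist b a < d0 \<Longrightarrow> dist (D b) (D a) < \<eta>"
        using \<open>\<eta> > 0\<close> unfolding uniformly_continuous_on_def by metis
      \<comment> \<open>The factor 1/2 is due to solutions separating to at most twice their initial
        distance; the second bound keeps \<open>y\<close> in the ball of radius R/2.\<close>
      define d where "d = min (d0/2) (R/2 - dist x0 x)"
      have "d > 0" using d0(1) x by (simp add: d_def)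
      moreover have "norm (u t y - u t x - w t x (y - x)) \<le> e * norm (y - x)" if y: "norm (y - x) < d" for y
      proof -
        have yb: "y \<in> ball x0 (R/2)"
          using y dist_triangle[of x0 y x] by (auto simp: d_def dist_norm norm_minus_commute)
        have lipv: "norm (v y s - v x s) \<le> 2 * norm (y - x)" if s: "s \<in> {-T..T}" for s
        proof -
          have "norm (v y s - v x s) \<le> 2 * norm (v y 0 - v x 0) + 2 * T * 0"
          proof (rule short_time_gronwall[of T L 0 "\<lambda>s. v y s - v x s" "\<lambda>s. f (v y s) - f (v x s)"])
            show "((\<lambda>s. v y s - v x s) has_vector_derivative f (v y s) - f (v x s)) (at s within {-T..T})"
              if "s \<in> {-T..T}" for s
              by (intro has_vector_derivative_diff vf x yb that)
            show "norm (f (v y s) - f (v x s)) \<le> L * norm (v y s - v x s) + 0" if "s \<in> {-T..T}" for s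
              using L(2)[of "v y s" "v x s"] vball[OF x that] vball[OF yb that] by auto
          qed (use T L(1) s in auto)
          then show ?thesis by (simp add: v0)
        qed
        have lin: "norm (f (v y s) - f (v x s) - frechet_derivative f (at (v x s)) (v y s - v x s)) \<le> \<eta> * (2 * norm (y - x))"
          if s: "s \<in> {-T..T}" for s
        proof -
          let ?a = "v x s" and ?b = "v y s"
          \<comment> \<open>A convex set that contains both solution points, and so the segment
            between them, and on which the derivative differs from its value at \<open>?a\<close> by
            at most \<eta>.\<close>
          let ?I = "ball x0 R \<inter> ball ?a d0"
          have ab: "?a \<in> ?I" "?b \<in> ?I"
            using vball[OF x s] vball[OF yb s] lipv[OF s] y d0(1) by (auto simp: d_def dist_norm norm_minus_commute)
          have cv: "convex ?I" by (intro convex_Int convex_ball)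
          have "norm (f ?b - f ?a - frechet_derivative f (at ?a) (?b - ?a)) \<le> norm (?b - ?a) * \<eta>"
          proof (rule differentiable_bound_linearization[of ?a ?b ?I f "\<lambda>z. frechet_derivative f (at z)" ?a])
            show "?a + r *\<^sub>R (?b - ?a) \<in> ?I" if "r \<in> {0..1}" for r
              using convexD_alt[OF cv ab, of r] that by (simp add: algebra_simps)
            show "(f has_derivative frechet_derivative f (at z)) (at z within ?I)" if "z \<in> ?I" for z
              using that R(2) by (auto intro!: has_derivative_at_withinI[OF smooth_on_has_derivative[OF assms(2)]])
            show "onorm (frechet_derivative f (at z) - frechet_derivative f (at ?a)) \<le> \<eta>" if z: "z \<in> ?I" for z
            proof -
              have zS: "z \<in> S" "?a \<in> S" using z ab R(2) by auto
              have "norm (D z - D ?a) \<le> \<eta>"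
                using d0(2)[of ?a z] z ab by (auto simp: dist_norm norm_minus_commute)
              moreover have "frechet_derivative f (at z) - frechet_derivative f (at ?a) = blinfun_apply (D z - D ?a)"
                using D(1)[OF zS(1)] D(1)[OF zS(2)] by (auto simp: blinfun.diff_left)
              ultimately show ?thesis by (simp add: norm_blinfun.rep_eq)
            qed
          qed (use ab in auto)
          also have "\<dots> \<le> (2 * norm (y - x)) * \<eta>" using lipv[OF s] \<open>\<eta> > 0\<close> by (intro mult_right_mono) auto
          finally show ?thesis by (simp add: mult.commute)
        qed
        \<comment> \<open>The first-order remainder vanishes at time 0; its derivative is the
          linearised operator applied to it plus the error estimated in \<open>lin\<close>.\<close>
        let ?r = "\<lambda>s. v y s - v x s - w s x (y - x)"
        let ?f' = "\<lambda>s. frechet_derivative f (at (v x s))"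
        have "norm (?r t) \<le> 2 * norm (?r 0) + 2 * T * (\<eta> * (2 * norm (y - x)))"
        proof (rule short_time_gronwall[of T L _ ?r "\<lambda>s. f (v y s) - f (v x s) - ?f' s (w s x (y - x))"])
          show "(?r has_vector_derivative f (v y s) - f (v x s) - ?f' s (w s x (y - x))) (at s within {-T..T})"
            if "s \<in> {-T..T}" for s
            by (intro has_vector_derivative_diff vf wd x yb that)
          show "norm (f (v y s) - f (v x s) - ?f' s (w s x (y - x))) \<le> L * norm (?r s) + \<eta> * (2 * norm (y - x))"
            if s: "s \<in> {-T..T}" for s
          proof -
            have vS: "v x s \<in> cball x0 R" using vball[OF x s] by auto
            have "linear (?f' s)"
              using smooth_on_differentiable[OF assms(2)] vS R(2) linear_frechet_derivative by blast
            then have "?f' s (?r s) = ?f' s (v y s - v x s) - ?f' s (w s x (y - x))" by (rule linear_diff)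
            then have "f (v y s) - f (v x s) - ?f' s (w s x (y - x))
              = ?f' s (?r s) + (f (v y s) - f (v x s) - ?f' s (v y s - v x s))" by simp
            also have "norm \<dots> \<le> norm (?f' s (?r s)) + norm (f (v y s) - f (v x s) - ?f' s (v y s - v x s))"
              by (rule norm_triangle_ineq)
            finally show ?thesis using lin[OF s] L(3)[OF vS, of "?r s"] by linarith
          qed
        qed (use T L(1) t' \<open>\<eta> > 0\<close> in auto)
        also have "\<dots> = e * norm (y - x)" using T(1) by (simp add: v0 w0[OF x] \<eta>_def)
        finally show ?thesis by (simp add: u_def)
      qed
      ultimately show "\<exists>d>0. \<forall>y. norm (y - x) < d \<longrightarrow> norm (u t y - u t x - w t x (y - x)) \<le> e * norm (y - x)"
        by blast
    qed
  qed
qed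

section \<open>Uniqueness and regularity of solutions\<close>

text \<open>Gronwall with zero inhomogeneity and zero initial difference. Only a short time is
  covered; connectedness extends this to whole intervals later.\<close>

lemma ode_local_uniqueness:
  fixes f :: "'a::euclidean_space \<Rightarrow> 'a"
  assumes "open S" "smooth_on S f" "open N" "t0 \<in> N"
    and x: "\<And>t. t \<in> N \<Longrightarrow> x t \<in> S \<and> (x has_vector_derivative f (x t)) (at t)"
    and y: "\<And>t. t \<in> N \<Longrightarrow> y t \<in> S \<and> (y has_vector_derivative f (y t)) (at t)"
    and "x t0 = y t0"
  shows "\<exists>b>0. \<forall>t. \<bar>t - t0\<bar> < b \<longrightarrow> x t = y t"
proof -
  have "x t0 \<in> S" using x assms(4) by blast
  then obtain R where R: "R > 0" "cball (x t0) R \<subseteq> S" using assms(1) open_contains_cball by blast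
  obtain L where L: "L > 0"
    "\<And>a b. a \<in> cball (x t0) R \<Longrightarrow> b \<in> cball (x t0) R \<Longrightarrow> norm (f a - f b) \<le> L * norm (a - b)"
    "\<And>a h. a \<in> cball (x t0) R \<Longrightarrow> norm (frechet_derivative f (at a) h) \<le> L * norm h"
    using smooth_on_lipschitz_cball[OF assms(2) R(2)] by blast
  have cx: "isCont x t0" and cy: "isCont y t0"
    using x y assms(4) has_vector_derivative_continuous by blast+
  obtain d1 where d1: "d1 > 0" "\<And>t. dist t t0 < d1 \<Longrightarrow> dist (x t) (x t0) < R"
    using cx R(1) unfolding continuous_at_eps_delta by blast
  obtain d2 where d2: "d2 > 0" "\<And>t. dist t t0 < d2 \<Longrightarrow> dist (y t) (x t0) < R"
    using cy R(1) assms(7) unfolding continuous_at_eps_delta by metis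
  obtain d3 where d3: "d3 > 0" "ball t0 d3 \<subseteq> N" using assms(3,4) open_contains_ball by blast
  define T where "T = min (min (d1/2) (d2/2)) (min (d3/2) (1/(2*L)))"
  have T: "T > 0" "T < d1" "T < d2" "T < d3" using d1 d2 d3 L(1) by (auto simp: T_def)
  have "T * L \<le> (1/(2*L)) * L" using L(1) by (intro mult_right_mono) (auto simp: T_def)
  then have TL: "T * L \<le> 1/2" using L(1) by simp
  have eq: "x (t0 + s) = y (t0 + s)" if s: "s \<in> {-T..T}" for s
  proof -
    have "norm (x (t0 + s) - y (t0 + s)) \<le> 2 * norm (x (t0 + 0) - y (t0 + 0)) + 2 * T * 0"
    proof (rule short_time_gronwall[of T L 0 "\<lambda>s. x (t0 + s) - y (t0 + s)" "\<lambda>s. f (x (t0 + s)) - f (y (t0 + s))"])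
      fix r assume r: "r \<in> {-T..T}"
      have rN: "t0 + r \<in> N" using r T d3 by (auto simp: dist_norm subset_iff)
      have shift: "((\<lambda>s. z (t0 + s)) has_vector_derivative z') (at r within {-T..T})"
        if "(z has_vector_derivative z') (at (t0 + r))" for z and z' :: 'a
      proof -
        have "((z \<circ> (\<lambda>s. t0 + s)) has_vector_derivative 1 *\<^sub>R z') (at r)"
          by (rule vector_diff_chain_at) (use that in \<open>auto intro!: derivative_eq_intros\<close>)
        then show ?thesis by (auto simp: o_def intro: has_vector_derivative_at_within)
      qed
      show "((\<lambda>s. x (t0 + s) - y (t0 + s)) has_vector_derivative f (x (t0 + r)) - f (y (t0 + r))) (at r within {-T..T})"
        using x[OF rN] y[OF rN] by (intro has_vector_derivative_diff shift) auto
      show "norm (f (x (t0 + r)) - f (y (t0 + r))) \<le> L * norm (x (t0 + r) - y (t0 + r)) + 0"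
        using L(2)[of "x (t0 + r)" "y (t0 + r)"] d1(2)[of "t0 + r"] d2(2)[of "t0 + r"] r T
        by (auto simp: dist_norm norm_minus_commute less_imp_le)
    qed (use T TL L(1) s in auto)
    then show ?thesis using assms(7) by simp
  qed
  have "x t = y t" if "\<bar>t - t0\<bar> < T" for t
  proof -
    have "t - t0 \<in> {-T..T}" using abs_le_D1[of "t - t0" T] abs_le_D2[of "t - t0" T] that by simp
    from eq[OF this] show ?thesis by simp
  qed
  then show ?thesis using T(1) by blast
qed

text \<open>Bootstrap: if the solution is C^k, so is its derivative f(x(t)), hence the solution is
  C^(k+1).\<close>

lemma ode_solution_smooth:
  fixes f :: "'a::euclidean_space \<Rightarrow> 'a"
  assumes "open S" "smooth_on S f" "open N"
    and x: "\<And>t. t \<in> N \<Longrightarrow> x t \<in> S \<and> (x has_vector_derivative f (x t)) (at t)"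
  shows "smooth_on N x"
proof -
  have "Ck_on k N x" for k
  proof (induction k)
    case 0
    have "isCont x t" if "t \<in> N" for t using x[OF that] has_vector_derivative_continuous by blast
    then show ?case by (auto intro: continuous_at_imp_continuous_on)
  next
    case (Suc k)
    have "Ck_on k N (\<lambda>t. f (x t))"
      using assms(2) x by (intro Ck_on_compose[OF assms(3,1) _ Suc]) (auto simp: smooth_on_def)
    then have "Ck_on k N (\<lambda>t. v *\<^sub>R f (x t))" for v
      by (rule Ck_on_linear_compose[OF assms(3) bounded_linear_scaleR_right])
    then show ?case
      using x by (intro Ck_on_SucI[OF assms(3), of x "\<lambda>t v. v *\<^sub>R f (x t)"]) (auto simp: has_vector_derivative_def)
  qed
  then show ?thesis by (simp add: smooth_on_def)
qed

section \<open>Finsler functions in coordinates\<close>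

lemma has_real_derivative_along_line:
  assumes "smooth_on S f" "p + t *\<^sub>R q \<in> S"
  shows "((\<lambda>t. f (p + t *\<^sub>R q)) has_real_derivative frechet_derivative f (at (p + t *\<^sub>R q)) q) (at t)"
proof -
  let ?D = "frechet_derivative f (at (p + t *\<^sub>R q))"
  have f: "(f has_derivative ?D) (at (p + t *\<^sub>R q))" using smooth_on_has_derivative[OF assms] .
  have "((\<lambda>t. f (p + t *\<^sub>R q)) has_derivative (\<lambda>r. ?D (r *\<^sub>R q))) (at t)"
    by (rule has_derivative_compose[where f = "\<lambda>t. p + t *\<^sub>R q" and g = f, OF _ f]) (auto intro!: derivative_eq_intros)
  moreover have "?D (r *\<^sub>R q) = r * ?D q" for r
    using linear_cmul[OF has_derivative_linear[OF f], of r q] by simp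
  ultimately show ?thesis by (simp add: has_field_derivative_def mult_commute_abs)
qed

text \<open>Product rule for a derivative applied to a moving vector: one term differentiates the
  base point with the vector frozen at \<open>\<psi> z\<close>, the other differentiates the
  vector.\<close>

lemma frechet_derivative_apply_has_derivative:
  fixes f :: "'a::euclidean_space \<Rightarrow> 'b::real_normed_vector"
  assumes "open S" "smooth_on S f" "z \<in> S" "(\<psi> has_derivative \<psi>') (at z)"
  shows "((\<lambda>z. frechet_derivative f (at z) (\<psi> z)) has_derivative
    (\<lambda>\<zeta>. frechet_derivative (\<lambda>z'. frechet_derivative f (at z') (\<psi> z)) (at z) \<zeta>
        + frechet_derivative f (at z) (\<psi>' \<zeta>))) (at z)"
proof -
  let ?P = "\<lambda>b z. frechet_derivative f (at z) b"
  have P: "(?P b has_derivative frechet_derivative (?P b) (at z)) (at z)" for b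
    using smooth_on_has_derivative[OF smooth_on_frechet_derivative[OF assms(2)] assms(3)] .
  have exp: "?P v z' = (\<Sum>b\<in>Basis. (v \<bullet> b) *\<^sub>R ?P b z')" if "z' \<in> S" for v z'
    using frechet_derivative_sum[OF smooth_on_differentiable[OF assms(2) that]] .
  have "((\<lambda>z. \<Sum>b\<in>Basis. (\<psi> z \<bullet> b) *\<^sub>R ?P b z) has_derivative
    (\<lambda>\<zeta>. \<Sum>b\<in>Basis. (\<psi> z \<bullet> b) *\<^sub>R frechet_derivative (?P b) (at z) \<zeta> + (\<psi>' \<zeta> \<bullet> b) *\<^sub>R ?P b z)) (at z)"
    by (intro has_derivative_sum has_derivative_scaleR has_derivative_inner_left assms(4) P)
  then have 1: "((\<lambda>z. ?P (\<psi> z) z) has_derivative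
    (\<lambda>\<zeta>. \<Sum>b\<in>Basis. (\<psi> z \<bullet> b) *\<^sub>R frechet_derivative (?P b) (at z) \<zeta> + (\<psi>' \<zeta> \<bullet> b) *\<^sub>R ?P b z)) (at z)"
    by (rule has_derivative_transform_within_open[OF _ assms(1,3)]) (rule exp[symmetric])
  have "((\<lambda>z'. \<Sum>b\<in>Basis. (\<psi> z \<bullet> b) *\<^sub>R ?P b z') has_derivative
    (\<lambda>\<zeta>. \<Sum>b\<in>Basis. (\<psi> z \<bullet> b) *\<^sub>R frechet_derivative (?P b) (at z) \<zeta>)) (at z)"
    by (intro has_derivative_sum has_derivative_scaleR_right P)
  then have "(?P (\<psi> z) has_derivative
    (\<lambda>\<zeta>. \<Sum>b\<in>Basis. (\<psi> z \<bullet> b) *\<^sub>R frechet_derivative (?P b) (at z) \<zeta>)) (at z)"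
    by (rule has_derivative_transform_within_open[OF _ assms(1,3)]) (rule exp[symmetric])
  then have 2: "frechet_derivative (?P (\<psi> z)) (at z) = (\<lambda>\<zeta>. \<Sum>b\<in>Basis. (\<psi> z \<bullet> b) *\<^sub>R frechet_derivative (?P b) (at z) \<zeta>)"
    by (rule frechet_derivative_at[symmetric])
  have 3: "frechet_derivative f (at z) (\<psi>' \<zeta>) = (\<Sum>b\<in>Basis. (\<psi>' \<zeta> \<bullet> b) *\<^sub>R ?P b z)" for \<zeta>
    by (rule exp[OF assms(3)])
  show ?thesis
    by (rule has_derivative_eq_rhs[OF 1]) (simp only: 2 3 sum.distrib)
qed

text \<open>The energy in the coordinates (x, y) of one chart. Smoothness is required only for y
  \<noteq> 0, and of the vertical Hessian only nondegeneracy; its positive definiteness is derived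
  below.\<close>

locale local_finsler =
  fixes \<Omega> :: "'e::euclidean_space set" and E :: "'e \<times> 'e \<Rightarrow> real"
  assumes open_\<Omega>: "open \<Omega>"
    and smooth_E: "smooth_on (\<Omega> \<times> (- {0})) E"
    and E_pos: "x \<in> \<Omega> \<Longrightarrow> y \<noteq> 0 \<Longrightarrow> E (x, y) > 0"
    and E_hom: "x \<in> \<Omega> \<Longrightarrow> y \<noteq> 0 \<Longrightarrow> r > 0 \<Longrightarrow> E (x, r *\<^sub>R y) = r\<^sup>2 * E (x, y)"
    and nondegenerate: "x \<in> \<Omega> \<Longrightarrow> y \<noteq> 0 \<Longrightarrow>
      (\<And>b. frechet_derivative (\<lambda>z. frechet_derivative E (at z) (0, b)) (at (x, y)) (0, a) = 0) \<Longrightarrow> a = 0"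
begin

abbreviation Z :: "('e \<times> 'e) set" where "Z \<equiv> \<Omega> \<times> (- {0})"

definition dE :: "'e \<times> 'e \<Rightarrow> 'e \<times> 'e \<Rightarrow> real" where
  "dE z = frechet_derivative E (at z)"

text \<open>The direction \<open>a\<close> is always vertical: \<open>ddE a z (0, b)\<close> is the
  fundamental tensor, while \<open>ddE a z (p, 0)\<close> is a mixed derivative in fibre and
  base.\<close>

definition ddE :: "'e \<Rightarrow> 'e \<times> 'e \<Rightarrow> 'e \<times> 'e \<Rightarrow> real" where
  "ddE a z = frechet_derivative (\<lambda>z. dE z (0, a)) (at z)"

lemma open_Z: "open Z"
proof -
  have "open (- {0::'e})" by (simp add: open_Compl)
  then show ?thesis using open_\<Omega> by (rule open_Times[rotated])
qed

lemma dE: "z \<in> Z \<Longrightarrow> (E has_derivative dE z) (at z)"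
  unfolding dE_def by (rule smooth_on_has_derivative[OF smooth_E])

lemma linear_dE: "z \<in> Z \<Longrightarrow> linear (dE z)"
  using dE has_derivative_linear by blast

lemma smooth_dE: "smooth_on Z (\<lambda>z. dE z \<zeta>)"
  unfolding dE_def by (rule smooth_on_frechet_derivative[OF smooth_E])

lemma ddE: "z \<in> Z \<Longrightarrow> ((\<lambda>z. dE z (0, a)) has_derivative ddE a z) (at z)"
  unfolding ddE_def by (rule smooth_on_has_derivative[OF smooth_dE])

lemma linear_ddE: "z \<in> Z \<Longrightarrow> linear (ddE a z)"
  using ddE has_derivative_linear by blast

lemma smooth_ddE: "smooth_on Z (\<lambda>z. ddE a z \<zeta>)"
  unfolding ddE_def by (rule smooth_on_frechet_derivative[OF smooth_dE])

lemma dE_apply_has_derivative: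
  assumes "z \<in> Z" "(\<psi> has_derivative \<psi>') (at z)"
  shows "((\<lambda>z. dE z (0, \<psi> z)) has_derivative (\<lambda>\<zeta>. ddE (\<psi> z) z \<zeta> + dE z (0, \<psi>' \<zeta>))) (at z)"
  unfolding dE_def ddE_def
  by (rule frechet_derivative_apply_has_derivative[OF open_Z smooth_E assms(1)])
    (intro has_derivative_Pair has_derivative_const assms(2))

lemma ddE_linear_first: "z \<in> Z \<Longrightarrow> linear (\<lambda>a. ddE a z \<zeta>)"
proof (rule linearI)
  fix a b and r :: real assume z: "z \<in> Z"
  have l: "dE z' (0, a + b) = dE z' (0, a) + dE z' (0, b)" "dE z' (0, r *\<^sub>R a) = r * dE z' (0, a)" if "z' \<in> Z" for z'
    using linear_add[OF linear_dE[OF that], of "(0, a)" "(0, b)"]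
      linear_cmul[OF linear_dE[OF that], of r "(0, a)"] by auto
  have "((\<lambda>z. dE z (0, a + b)) has_derivative (\<lambda>\<zeta>. ddE a z \<zeta> + ddE b z \<zeta>)) (at z)"
    by (rule has_derivative_transform_within_open[OF has_derivative_add[OF ddE ddE] open_Z z]) (use z l in auto)
  then show "ddE (a + b) z \<zeta> = ddE a z \<zeta> + ddE b z \<zeta>"
    using has_derivative_unique[OF ddE[OF z]] by metis
  have "((\<lambda>z. dE z (0, r *\<^sub>R a)) has_derivative (\<lambda>\<zeta>. r * ddE a z \<zeta>)) (at z)"
    by (rule has_derivative_transform_within_open[OF has_derivative_mult_right[OF ddE] open_Z z]) (use z l in auto)
  then show "ddE (r *\<^sub>R a) z \<zeta> = r *\<^sub>R ddE a z \<zeta>"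
    using has_derivative_unique[OF ddE[OF z]] by (metis real_scaleR_def)
qed

text \<open>Both sides are the derivative at t = 0 of E(x, (1 + t) y).\<close>

lemma euler: "(x, y) \<in> Z \<Longrightarrow> dE (x, y) (0, y) = 2 * E (x, y)"
proof -
  assume z: "(x, y) \<in> Z"
  have "((\<lambda>t. E ((x, y) + t *\<^sub>R (0, y))) has_real_derivative dE ((x, y) + 0 *\<^sub>R (0, y)) (0, y)) (at 0)"
    unfolding dE_def by (rule has_real_derivative_along_line[OF smooth_E]) (use z in auto)
  then have 1: "((\<lambda>t. E ((x, y) + t *\<^sub>R (0, y))) has_real_derivative dE (x, y) (0, y)) (at 0)" by simp
  have "((\<lambda>t. (1 + t)\<^sup>2 * E (x, y)) has_real_derivative 2 * E (x, y)) (at 0)"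
    by (auto intro!: derivative_eq_intros)
  then have "((\<lambda>t. E ((x, y) + t *\<^sub>R (0, y))) has_real_derivative 2 * E (x, y)) (at 0)"
  proof (rule has_field_derivative_transform_within_open[of _ _ _ "{-1<..}"])
    fix t :: real assume "t \<in> {-1<..}"
    then show "(1 + t)\<^sup>2 * E (x, y) = E ((x, y) + t *\<^sub>R (0, y))"
      using E_hom[of x y "1 + t"] z by (simp add: scaleR_left_distrib)
  qed auto
  then show ?thesis using 1 DERIV_unique by blast
qed

text \<open>Euler's relation \<open>dE z (0, snd z) = 2 * E z\<close> differentiated; the subtracted
  term arises because the direction \<open>snd z\<close> moves with \<open>z\<close>.\<close>

lemma ddE_euler:
  assumes "(x, y) \<in> Z"
  shows "ddE y (x, y) (p, q) = 2 * dE (x, y) (p, q) - dE (x, y) (0, q)"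
proof -
  have "((\<lambda>z. dE z (0, snd z)) has_derivative (\<lambda>\<zeta>. ddE (snd (x, y)) (x, y) \<zeta> + dE (x, y) (0, snd \<zeta>))) (at (x, y))"
    by (rule dE_apply_has_derivative[OF assms bounded_linear_imp_has_derivative[OF bounded_linear_snd]])
  moreover have "((\<lambda>z. dE z (0, snd z)) has_derivative (\<lambda>\<zeta>. 2 * dE (x, y) \<zeta>)) (at (x, y))"
  proof (rule has_derivative_transform_within_open[OF has_derivative_mult_right[OF dE[OF assms]] open_Z assms])
    show "2 * E z = dE z (0, snd z)" if "z \<in> Z" for z
      using euler[of "fst z" "snd z"] that by simp
  qed
  ultimately have "(\<lambda>\<zeta>. ddE (snd (x, y)) (x, y) \<zeta> + dE (x, y) (0, snd \<zeta>)) = (\<lambda>\<zeta>. 2 * dE (x, y) \<zeta>)"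
    by (rule has_derivative_unique)
  from fun_cong[OF this, of "(p, q)"] show ?thesis by simp
qed

subsection \<open>The spray coefficients\<close>

text \<open>Represents the Hessian form by an operator through the inner product, so that the
  Euler-Lagrange equations become one linear system.\<close>

definition hess :: "'e \<times> 'e \<Rightarrow> 'e \<Rightarrow> 'e" where
  "hess z g = (\<Sum>b\<in>Basis. ddE b z (0, g) *\<^sub>R b)"

definition force_term :: "'e \<times> 'e \<Rightarrow> 'e" where
  "force_term z = (\<Sum>b\<in>Basis. (dE z (b, 0) - ddE b z (snd z, 0)) *\<^sub>R b)"

text \<open>The acceleration in the geodesic equation x'' = spray(x, x'); in the usual notation of
  Finsler geometry it is -2 G(x, y).\<close>

definition spray :: "'e \<times> 'e \<Rightarrow> 'e" where
  "spray z = inv (hess z) (force_term z)"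

lemma linear_hess: "z \<in> Z \<Longrightarrow> linear (hess z)"
proof -
  assume "z \<in> Z"
  then have l: "linear (\<lambda>g. ddE b z (0, g))" for b
    using linear_compose[OF _ linear_ddE[of z b], of "\<lambda>g. (0, g)"] by (simp add: o_def linear_iff)
  show ?thesis
    unfolding hess_def[abs_def]
    by (rule linearI) (auto simp: linear_add[OF l] linear_cmul[OF l] scaleR_left_distrib sum.distrib scaleR_sum_right)
qed

lemma inner_hess: "z \<in> Z \<Longrightarrow> hess z g \<bullet> a = ddE a z (0, g)"
  using linear_euclidean_sum[OF ddE_linear_first, of z a "(0, g)"]
  by (simp add: hess_def inner_sum_left inner_commute[of a] mult.commute)

lemma inj_hess: "z \<in> Z \<Longrightarrow> inj (hess z)"
proof -
  assume z: "z \<in> Z"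
  have "g = 0" if "hess z g = 0" for g
  proof (rule nondegenerate[of "fst z" "snd z"])
    show "frechet_derivative (\<lambda>z. frechet_derivative E (at z) (0, b)) (at (fst z, snd z)) (0, g) = 0" for b
      using inner_hess[OF z, of g b] that by (simp add: ddE_def dE_def)
  qed (use z in auto)
  then show ?thesis using linear_injective_0[OF linear_hess[OF z]] by blast
qed

lemma hess_spray: "z \<in> Z \<Longrightarrow> hess z (spray z) = force_term z"
  unfolding spray_def
  using linear_inj_imp_surj[OF linear_hess inj_hess] by (simp add: surj_f_inv_f)

text \<open>Testing d/dt (dE/dy) = dE/dx against all \<open>a\<close> amounts to one equation
  between vectors, which the injective \<open>hess z\<close> solves uniquely.\<close>

lemma euler_lagrange_iff:
  assumes "z \<in> Z"
  shows "(\<forall>a. ddE a z (snd z, g) = dE z (a, 0)) \<longleftrightarrow> g = spray z"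
proof -
  have split: "ddE a z (snd z, g) = ddE a z (snd z, 0) + ddE a z (0, g)" for a
    using linear_add[OF linear_ddE[OF assms], of a "(snd z, 0)" "(0, g)"] by simp
  have la: "linear (\<lambda>a. dE z (a, 0))"
    using linear_compose[OF _ linear_dE[OF assms], of "\<lambda>a. (a, 0)"] by (simp add: o_def linear_iff)
  have f: "force_term z \<bullet> a = dE z (a, 0) - ddE a z (snd z, 0)" for a
    using linear_euclidean_sum[OF ddE_linear_first[OF assms], of a "(snd z, 0)"] linear_euclidean_sum[OF la, of a]
    by (simp add: force_term_def inner_sum_left inner_commute[of a] mult.commute right_diff_distrib sum_subtractf left_diff_distrib)
  have "(\<forall>a. ddE a z (snd z, g) = dE z (a, 0)) \<longleftrightarrow> (\<forall>a. hess z g \<bullet> a = force_term z \<bullet> a)"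
    unfolding split f inner_hess[OF assms] by (auto simp: algebra_simps)
  also have "\<dots> \<longleftrightarrow> hess z g = force_term z"
    by (metis euclidean_eqI)
  also have "\<dots> \<longleftrightarrow> g = spray z"
    using hess_spray[OF assms] inj_hess[OF assms] by (metis injD)
  finally show ?thesis .
qed

lemma smooth_spray: "smooth_on Z spray"
proof (rule smooth_on_linear_solve[OF open_Z linear_hess inj_hess _ _ hess_spray])
  show "smooth_on Z (\<lambda>z. hess z a)" for a
    unfolding hess_def
    by (intro smooth_on_sum[OF open_Z] smooth_on_scaleR[OF open_Z] smooth_on_const smooth_ddE)
  have s: "smooth_on Z (\<lambda>z. (snd z, 0::'e))"
    by (rule smooth_on_linear[OF open_Z]) (intro bounded_linear_Pair bounded_linear_snd bounded_linear_zero)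
  have d: "smooth_on Z (\<lambda>z. ddE b z (snd z, 0))" for b
    unfolding ddE_def
    by (rule smooth_on_frechet_derivative_apply[OF open_Z open_Z smooth_dE smooth_on_id[OF open_Z] s]) auto
  show "smooth_on Z force_term"
    unfolding force_term_def[abs_def]
    by (intro smooth_on_sum[OF open_Z] smooth_on_scaleR[OF open_Z] smooth_on_const smooth_on_diff[OF open_Z] smooth_dE d)
qed

text \<open>Take y itself as the test direction in the Euler-Lagrange equation and compare with the
  differentiated Euler relation.\<close>

lemma energy_conserved: "z \<in> Z \<Longrightarrow> dE z (snd z, spray z) = 0"
proof -
  assume z: "z \<in> Z"
  obtain x y where xy: "z = (x, y)" by fastforce
  have "ddE y z (y, spray z) = dE z (y, 0)" using euler_lagrange_iff[OF z, of "spray z"] xy by simp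
  moreover have "ddE y z (y, spray z) = 2 * dE z (y, spray z) - dE z (0, spray z)"
    using ddE_euler z xy by auto
  moreover have "dE z (y, spray z) = dE z (y, 0) + dE z (0, spray z)"
    using linear_add[OF linear_dE[OF z], of "(y, 0)" "(0, spray z)"] by simp
  ultimately show ?thesis using xy by simp
qed

subsection \<open>Positive definiteness of the vertical Hessian\<close>

definition hess_form :: "'e \<Rightarrow> 'e \<Rightarrow> 'e \<Rightarrow> 'e \<Rightarrow> real" where
  "hess_form x y a b = ddE a (x, y) (0, b)"

lemma hess_form_linear:
  assumes "(x, y) \<in> Z"
  shows "linear (\<lambda>a. hess_form x y a b)" "linear (hess_form x y a)"
proof -
  show "linear (\<lambda>a. hess_form x y a b)"
    unfolding hess_form_def using ddE_linear_first[OF assms] .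
  show "linear (hess_form x y a)"
    using linear_compose[OF _ linear_ddE[OF assms, of a], of "\<lambda>g. (0, g)"]
    by (simp add: o_def linear_iff hess_form_def[abs_def])
qed

lemma hess_form_sym: "(x, y) \<in> Z \<Longrightarrow> hess_form x y a b = hess_form x y b a"
  unfolding hess_form_def ddE_def dE_def
  by (rule symmetric_second_derivative[OF open_Z smooth_E])

lemma hess_form_along_line:
  assumes "(x, y + t *\<^sub>R q) \<in> Z"
  shows "((\<lambda>t. E (x, y + t *\<^sub>R q)) has_real_derivative dE (x, y + t *\<^sub>R q) (0, q)) (at t)"
    "((\<lambda>t. dE (x, y + t *\<^sub>R q) (0, q)) has_real_derivative hess_form x (y + t *\<^sub>R q) q q) (at t)"
  using has_real_derivative_along_line[OF smooth_E, of "(x, y)" t "(0, q)"]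
    has_real_derivative_along_line[OF smooth_dE, of "(x, y)" t "(0, q)" "(0, q)"] assms
  by (simp_all add: dE_def hess_form_def ddE_def)

text \<open>Nondegeneracy sharpens nonpositivity to negativity: a null vector \<open>a\<close> pairs
  nontrivially with some \<open>c\<close>, so the form on a + t c has a nonzero linear term in t and
  becomes negative for a suitable t.\<close>

lemma not_posdef_imp_negative:
  assumes z: "(x, y) \<in> Z" and "a \<noteq> 0" "hess_form x y a a \<le> 0"
  shows "\<exists>c. hess_form x y c c < 0"
proof (cases "hess_form x y a a = 0")
  case True
  obtain c where c: "hess_form x y c a \<noteq> 0"
  proof -
    have "\<not> (\<forall>b. hess_form x y b a = 0)"
      using nondegenerate[of x y a] z assms(2) by (auto simp: hess_form_def ddE_def dE_def)
    then show ?thesis using that by blast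
  qed
  define \<kappa> \<beta> where "\<kappa> = hess_form x y c a" and "\<beta> = hess_form x y c c"
  show ?thesis
  proof (cases "\<beta> < 0")
    case False
    \<comment> \<open>Modelled on the minimiser -\<kappa>/\<beta> of the quadratic polynomial in t;
      the denominator \<beta> + 1 avoids division by zero when \<beta> = 0.\<close>
    define t where "t = - \<kappa> / (\<beta> + 1)"
    note l1 = linear_add[OF hess_form_linear(1)[OF z]] linear_cmul[OF hess_form_linear(1)[OF z]]
    note l2 = linear_add[OF hess_form_linear(2)[OF z]] linear_cmul[OF hess_form_linear(2)[OF z]]
    have "hess_form x y (a + t *\<^sub>R c) (a + t *\<^sub>R c) = 2 * t * \<kappa> + t\<^sup>2 * \<beta>"
      using True hess_form_sym[OF z, of a c]
      by (simp add: l1 l2 \<kappa>_def \<beta>_def power2_eq_square algebra_simps)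
    also have "\<dots> = - \<kappa>\<^sup>2 * (\<beta> + 2) / (\<beta> + 1)\<^sup>2"
    proof -
      define n where "n = \<beta> + 1"
      have "n \<noteq> 0" and b: "\<beta> = n - 1" using False by (auto simp: n_def)
      then show ?thesis unfolding t_def b by (simp add: field_simps power2_eq_square)
    qed
    also have "\<dots> < 0"
      using False c by (intro divide_neg_pos) (auto simp: \<kappa>_def mult_neg_pos)
    finally show ?thesis by blast
  qed (auto simp: \<beta>_def)
next
  case False
  then show ?thesis using assms(3) by (intro exI[of _ a]) auto
qed

lemma hess_form_continuous: "x \<in> \<Omega> \<Longrightarrow> continuous_on (- {0}) (\<lambda>y. hess_form x y a b)"
  unfolding hess_form_def
  by (rule continuous_on_compose2[OF smooth_on_imp_continuous_on[OF smooth_ddE[of a "(0, b)"]]])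
    (auto intro!: continuous_intros)

text \<open>On the compact unit sphere the form has a positive minimum \<open>m\<close>; nearby its
  coefficients change by less than \<open>m\<close> in total, and coordinates of unit vectors are at
  most 1 in absolute value.\<close>

lemma posdef_open:
  assumes x: "x \<in> \<Omega>" and y: "y \<noteq> 0" and pd: "\<And>a. a \<noteq> 0 \<Longrightarrow> hess_form x y a a > 0"
  shows "\<forall>\<^sub>F y' in nhds y. \<forall>a. a \<noteq> 0 \<longrightarrow> hess_form x y' a a > 0"
proof -
  let ?q = "\<lambda>y a. \<Sum>b\<in>Basis. \<Sum>c\<in>Basis. (a \<bullet> b) * (a \<bullet> c) * hess_form x y b c"
  have q: "hess_form x y' a a = ?q y' a" if "y' \<noteq> 0" for y' a
  proof -
    have z': "(x, y') \<in> Z" using x that by auto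
    have "hess_form x y' a a = (\<Sum>b\<in>Basis. (a \<bullet> b) *\<^sub>R hess_form x y' b a)"
      by (rule linear_euclidean_sum[OF hess_form_linear(1)[OF z']])
    also have "\<dots> = (\<Sum>b\<in>Basis. (a \<bullet> b) *\<^sub>R (\<Sum>c\<in>Basis. (a \<bullet> c) *\<^sub>R hess_form x y' b c))"
      by (intro sum.cong refl arg_cong[where f = "scaleR _"] linear_euclidean_sum hess_form_linear z')
    finally show ?thesis by (simp add: sum_distrib_left mult.assoc)
  qed
  have "continuous_on (sphere 0 1) (?q y)" by (intro continuous_intros)
  then obtain a0 where a0: "a0 \<in> sphere 0 1" "\<And>a. a \<in> sphere 0 1 \<Longrightarrow> ?q y a0 \<le> ?q y a"
    using continuous_attains_inf[of "sphere 0 1 :: 'e set" "?q y"] by auto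
  define m where "m = ?q y a0"
  have "a0 \<noteq> 0" using a0(1) by auto
  then have "m > 0" using pd[of a0] q[OF y, of a0] by (simp add: m_def)
  have "isCont (\<lambda>y'. hess_form x y' b c) y" for b c
    using hess_form_continuous[OF x] y continuous_on_eq_continuous_at[of "- {0}"] by (metis ComplI open_Compl closed_singleton singletonD)
  then have cn: "((\<lambda>y'. hess_form x y' b c) \<longlongrightarrow> hess_form x y b c) (nhds y)" for b c
    by (metis isCont_def tendsto_at_iff_tendsto_nhds)
  have "((\<lambda>y'. \<Sum>b\<in>Basis. \<Sum>c\<in>Basis. \<bar>hess_form x y' b c - hess_form x y b c\<bar>) \<longlongrightarrow>
      (\<Sum>b\<in>Basis. \<Sum>c\<in>Basis. \<bar>hess_form x y b c - hess_form x y b c\<bar>)) (nhds y)"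
    by (intro tendsto_sum tendsto_rabs tendsto_diff cn tendsto_const)
  then have "\<forall>\<^sub>F y' in nhds y. (\<Sum>b\<in>Basis. \<Sum>c\<in>Basis. \<bar>hess_form x y' b c - hess_form x y b c\<bar>) < m"
    using \<open>m > 0\<close> by (intro order_tendstoD(2)) auto
  moreover have "\<forall>\<^sub>F y' in nhds y. y' \<noteq> 0" using y by (rule t1_space_nhds)
  ultimately show ?thesis
  proof eventually_elim
    case (elim y')
    show ?case
    proof (intro allI impI)
      fix a :: 'e assume "a \<noteq> 0"
      define n where "n = inverse (norm a) *\<^sub>R a"
      have n: "norm n = 1" "a = norm a *\<^sub>R n" using \<open>a \<noteq> 0\<close> by (auto simp: n_def)
      have "\<bar>?q y' n - ?q y n\<bar> = \<bar>\<Sum>b\<in>Basis. \<Sum>c\<in>Basis. (n \<bullet> b) * (n \<bullet> c) * (hess_form x y' b c - hess_form x y b c)\<bar>"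
        by (simp add: sum_subtractf right_diff_distrib)
      also have "\<dots> \<le> (\<Sum>b\<in>Basis. \<Sum>c\<in>Basis. \<bar>(n \<bullet> b) * (n \<bullet> c) * (hess_form x y' b c - hess_form x y b c)\<bar>)"
        by (intro order_trans[OF sum_abs] sum_mono sum_abs)
      also have "\<dots> \<le> (\<Sum>b\<in>Basis. \<Sum>c\<in>Basis. \<bar>hess_form x y' b c - hess_form x y b c\<bar>)"
      proof (intro sum_mono)
        fix b c :: 'e assume "b \<in> Basis" "c \<in> Basis"
        then have "\<bar>n \<bullet> b\<bar> * \<bar>n \<bullet> c\<bar> \<le> 1 * 1"
          using Basis_le_norm[of b n] Basis_le_norm[of c n] n(1) by (intro mult_mono) auto
        then show "\<bar>(n \<bullet> b) * (n \<bullet> c) * (hess_form x y' b c - hess_form x y b c)\<bar> \<le> \<bar>hess_form x y' b c - hess_form x y b c\<bar>"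
          unfolding abs_mult by (metis abs_ge_zero mult_1 mult_right_mono)
      qed
      finally have "\<bar>?q y' n - ?q y n\<bar> < m" using elim by linarith
      moreover have "m \<le> ?q y n" using a0(2)[of n] n(1) by (simp add: m_def)
      ultimately have "hess_form x y' n n > 0" using q elim by auto
      moreover have "hess_form x y' a a = norm a * norm a * hess_form x y' n n"
      proof -
        have z': "(x, y') \<in> Z" using x elim by auto
        have "hess_form x y' (r *\<^sub>R n) (r *\<^sub>R n) = r * r * hess_form x y' n n" for r
          using linear_cmul[OF hess_form_linear(1)[OF z'], of r n "r *\<^sub>R n"]
            linear_cmul[OF hess_form_linear(2)[OF z'], of n r n] by simp
        then show ?thesis using n(2) by metis
      qed
      ultimately show "hess_form x y' a a > 0" using \<open>a \<noteq> 0\<close> by simp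
    qed
  qed
qed

text \<open>At a minimum point of \<open>E\<close> on the Euclidean unit sphere, with minimum \<open>m\<close>, homogeneity makes
  \<open>E - m \<bar>y\<bar>\<^sup>2\<close> nonnegative with value zero, so that the Hessian dominates \<open>2 m\<close> times the inner product.\<close>

lemma posdef_somewhere:
  assumes x: "x \<in> \<Omega>"
  shows "\<exists>y. y \<noteq> 0 \<and> (\<forall>a. a \<noteq> 0 \<longrightarrow> hess_form x y a a > 0)"
proof -
  have "continuous_on (sphere 0 1) (\<lambda>y. E (x, y))"
    by (rule continuous_on_compose2[OF smooth_on_imp_continuous_on[OF smooth_E]])
      (use x in \<open>auto intro!: continuous_intros\<close>)
  then obtain y1 where y1: "y1 \<in> sphere 0 1" "\<And>y. y \<in> sphere 0 1 \<Longrightarrow> E (x, y1) \<le> E (x, y)"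
    using continuous_attains_inf[of "sphere 0 1 :: 'e set" "\<lambda>y. E (x, y)"] by auto
  define m where "m = E (x, y1)"
  have y1n: "y1 \<noteq> 0" "y1 \<bullet> y1 = 1" using y1(1) by (auto simp: norm_eq_1[symmetric])
  have "m > 0" using E_pos[OF x y1n(1)] by (simp add: m_def)
  have Em: "E (x, y) \<ge> m * (y \<bullet> y)" if "y \<noteq> 0" for y
  proof -
    define n where "n = inverse (norm y) *\<^sub>R y"
    have n: "norm n = 1" "y = norm y *\<^sub>R n" using that by (auto simp: n_def)
    have "E (x, y) = (norm y)\<^sup>2 * E (x, n)"
      using E_hom[OF x, of n "norm y"] n that by (metis norm_zero zero_less_norm_iff zero_neq_one)
    moreover have "m \<le> E (x, n)" using y1(2)[of n] n(1) by (simp add: m_def)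
    ultimately show ?thesis
      by (simp add: power2_norm_eq_inner[symmetric] mult.commute[of "(norm y)\<^sup>2"] mult_right_mono)
  qed
  have "hess_form x y1 a a > 0" if "a \<noteq> 0" for a
  proof (rule ccontr)
    assume neg: "\<not> hess_form x y1 a a > 0"
    \<comment> \<open>The difference of \<open>E\<close> and m times the squared norm along the line
      y1 + t a. If the Hessian were not positive at \<open>a\<close>, the second derivative of
      \<phi> at its minimum point t = 0 would be negative.\<close>
    define \<phi> where "\<phi> t = E (x, y1 + t *\<^sub>R a) - m * (y1 \<bullet> y1 + 2 * t * (y1 \<bullet> a) + t\<^sup>2 * (a \<bullet> a))" for t
    define \<phi>' where "\<phi>' t = dE (x, y1 + t *\<^sub>R a) (0, a) - m * (2 * (y1 \<bullet> a) + 2 * t * (a \<bullet> a))" for t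
    have "\<forall>\<^sub>F t in nhds 0. y1 + t *\<^sub>R a \<noteq> 0"
    proof -
      have "((\<lambda>t. y1 + t *\<^sub>R a) \<longlongrightarrow> y1 + 0 *\<^sub>R a) (nhds 0)"
        by (intro tendsto_intros) (simp add: filterlim_ident)
      then show ?thesis using y1n(1) tendsto_imp_eventually_ne by fastforce
    qed
    then obtain d where d: "d > 0" "\<And>t. \<bar>t\<bar> < d \<Longrightarrow> y1 + t *\<^sub>R a \<noteq> 0"
      unfolding eventually_nhds_metric by (auto simp: dist_real_def)
    have \<phi>d: "(\<phi> has_real_derivative \<phi>' t) (at t)" if "\<bar>t\<bar> < d" for t
      unfolding \<phi>_def \<phi>'_def using hess_form_along_line(1)[of x y1 t a] x d(2)[OF that]
      by (auto intro!: derivative_eq_intros)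
    have "((\<lambda>t. dE (x, y1 + t *\<^sub>R a) (0, a)) has_real_derivative hess_form x y1 a a) (at 0)"
      using hess_form_along_line(2)[of x y1 0 a] x y1n(1) by simp
    then have \<phi>'d: "(\<phi>' has_real_derivative hess_form x y1 a a - m * (2 * (a \<bullet> a))) (at 0)"
      unfolding \<phi>'_def by (auto intro!: derivative_eq_intros)
    have ge: "\<phi> t \<ge> \<phi> 0" if "\<bar>t\<bar> < d" for t
      using Em[OF d(2)[OF that]] y1n
      by (simp add: \<phi>_def m_def inner_add_left inner_add_right inner_commute power2_eq_square algebra_simps)
    have "\<phi>' 0 = 0"
      using DERIV_local_min[OF \<phi>d d(1)] ge d(1) by auto
    moreover have "hess_form x y1 a a - m * (2 * (a \<bullet> a)) < 0"
      using neg \<open>m > 0\<close> that by (smt (verit) inner_gt_zero_iff mult_pos_pos)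
    ultimately obtain e where e: "e > 0" "\<And>h. 0 < h \<Longrightarrow> h < e \<Longrightarrow> \<phi>' h < 0"
      using DERIV_neg_dec_right[OF \<phi>'d] by auto
    define t where "t = min d e / 2"
    have t: "0 < t" "t < d" "t < e" using d(1) e(1) by (auto simp: t_def)
    obtain s where s: "0 < s" "s < t" "\<phi> t - \<phi> 0 = (t - 0) * \<phi>' s"
      using MVT2[OF t(1), of \<phi> \<phi>'] \<phi>d t by auto
    have "\<phi> t - \<phi> 0 < 0" using s e(2)[of s] t by (simp add: mult_pos_neg)
    then show False using ge[of t] t by auto
  qed
  then show ?thesis using y1n(1) by blast
qed

text \<open>In dimension at least two, nondegeneracy makes the set of those \<open>y\<close> where the Hessian is positive
  definite both open and closed in the connected set of nonzero vectors. In dimension one, Euler's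
  relation suffices.\<close>

lemma hess_form_posdef:
  assumes x: "x \<in> \<Omega>" and y: "y \<noteq> 0" and a: "a \<noteq> 0"
  shows "hess_form x y a a > 0"
proof (cases "2 \<le> DIM('e)")
  case True
  define P where "P y \<longleftrightarrow> (\<forall>a. a \<noteq> 0 \<longrightarrow> hess_form x y a a > 0)" for y
  obtain y1 where y1: "y1 \<noteq> 0" "P y1" using posdef_somewhere[OF x] by (auto simp: P_def)
  have step: "\<exists>T. openin (top_of_set (- {0})) T \<and> y0 \<in> T \<and> (\<forall>x\<in>T. \<forall>y\<in>T. P x \<longrightarrow> P y)"
    if "y0 \<in> - {0}" for y0
  proof -
    have y0: "y0 \<noteq> 0" using that by simp
    have "\<exists>T. open T \<and> y0 \<in> T \<and> (\<forall>y\<in>T. y \<noteq> 0 \<longrightarrow> P y = P y0)"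
    proof (cases "P y0")
      case True
      then have "\<forall>\<^sub>F y' in nhds y0. P y'" using posdef_open[OF x y0] by (auto simp: P_def)
      then show ?thesis using True unfolding eventually_nhds by blast
    next
      case False
      \<comment> \<open>A strictly negative vector stays negative nearby by continuity, so failure
        of positivity is open as well.\<close>
      then obtain c where c: "hess_form x y0 c c < 0"
        using not_posdef_imp_negative[of x y0] x y0 by (auto simp: P_def not_less)
      have "isCont (\<lambda>y. hess_form x y c c) y0"
        using hess_form_continuous[OF x] y0 continuous_on_eq_continuous_at[of "- {0}"]
        by (metis ComplI open_Compl closed_singleton singletonD)
      then have "((\<lambda>y. hess_form x y c c) \<longlongrightarrow> hess_form x y0 c c) (nhds y0)"
        by (metis isCont_def tendsto_at_iff_tendsto_nhds)
      from order_tendstoD(2)[OF this c]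
      obtain T where T: "open T" "y0 \<in> T" "\<And>y. y \<in> T \<Longrightarrow> hess_form x y c c < 0"
        unfolding eventually_nhds by blast
      have "\<not> P y" if "y \<in> T" "y \<noteq> 0" for y
      proof -
        have "c \<noteq> 0" using T(3)[OF that(1)] linear_0[OF hess_form_linear(2)[of x y]] x that(2) by auto
        then show ?thesis using T(3)[OF that(1)] by (fastforce simp: P_def)
      qed
      then show ?thesis using T False by blast
    qed
    then obtain T where T: "open T" "y0 \<in> T" "\<forall>y\<in>T. y \<noteq> 0 \<longrightarrow> P y = P y0" by blast
    have "openin (top_of_set (- {0})) (- {0} \<inter> T)" using T(1) by (rule openin_open_Int)
    moreover have "y0 \<in> - {0} \<inter> T" using y0 T(2) by simp
    moreover have "\<forall>u\<in>- {0} \<inter> T. \<forall>v\<in>- {0} \<inter> T. P u \<longrightarrow> P v" using T(3) by simp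
    ultimately show ?thesis by blast
  qed
  have "P y"
    by (rule connected_induction_simple[OF connected_punctured_universe[OF True] _ _ y1(2) step])
      (use y y1(1) in simp_all)
  then show ?thesis using a by (simp add: P_def)
next
  case False
  then have "DIM('e) = 1" using DIM_positive[where 'a='e] by linarith
  then obtain b :: 'e where b: "Basis = {b}" using card_1_singletonE by blast
  have z: "(x, y) \<in> Z" using x y by auto
  have "(y \<bullet> b) \<noteq> 0"
  proof
    assume "y \<bullet> b = 0"
    then have "y = 0" by (subst euclidean_eq_iff) (simp add: b)
    then show False using y by simp
  qed
  then have "a = ((a \<bullet> b) / (y \<bullet> b)) *\<^sub>R y" by (subst euclidean_eq_iff) (simp add: b)
  then obtain c where c: "a = c *\<^sub>R y" by blast
  have "hess_form x y a a = c * (c * hess_form x y y y)"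
    using linear_cmul[OF hess_form_linear(1)[OF z], of c y "c *\<^sub>R y"] linear_cmul[OF hess_form_linear(2)[OF z], of y c y] c
    by simp
  also have "hess_form x y y y = 2 * E (x, y)"
    using ddE_euler[OF z, of 0 y] euler[OF z] by (simp add: hess_form_def)
  finally have "hess_form x y a a = (c * c) * (2 * E (x, y))" by simp
  moreover have "0 < c * c" using a c by (auto simp: zero_less_mult_iff linorder_neq_iff)
  ultimately show ?thesis using E_pos[OF x y] by simp
qed

section \<open>Convexity of the energy\<close>

lemma fundamental_inequality:
  assumes x: "x \<in> \<Omega>" and v: "v \<noteq> 0" and w: "w \<noteq> 0"
  shows "dE (x, v) (0, w) \<le> E (x, v) + E (x, w)"
proof -
  have z: "(x, v) \<in> Z" using x v by auto
  show ?thesis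
  proof (cases "\<exists>t\<in>{0..1}. v + t *\<^sub>R (w - v) = 0")
    case True
    then obtain t where t: "0 \<le> t" "t \<le> 1" "v + t *\<^sub>R (w - v) = 0" by auto
    have "t \<noteq> 0" "t \<noteq> 1" using t(3) v w by auto
    then have t0: "t > 0" "t < 1" using t(1,2) by auto
    define r where "r = (1 - t) / t"
    have "t * (- r) = t - 1" using t0 by (simp add: r_def)
    then have "t *\<^sub>R ((- r) *\<^sub>R v) = (t - 1) *\<^sub>R v" by (metis scaleR_scaleR)
    moreover have "t *\<^sub>R w - (t - 1) *\<^sub>R v = v + t *\<^sub>R (w - v)" by (simp add: algebra_simps)
    ultimately have "t *\<^sub>R w = t *\<^sub>R ((- r) *\<^sub>R v)" using t(3) by simp
    then have "w = (- r) *\<^sub>R v" using t0 by (metis less_irrefl scaleR_cancel_left)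
    then have "dE (x, v) (0, w) = (- r) * (2 * E (x, v))"
      using linear_cmul[OF linear_dE[OF z], of "- r" "(0, v)"] euler[OF z] by simp
    moreover have "r \<ge> 0" using t0 by (simp add: r_def)
    ultimately have "dE (x, v) (0, w) \<le> 0" using E_pos[OF x v] by (simp add: mult_nonneg_nonneg)
    then show ?thesis using E_pos[OF x v] E_pos[OF x w] by linarith
  next
    case False
    have nz: "v + t *\<^sub>R (w - v) \<noteq> 0" if "0 \<le> t" "t \<le> 1" for t using False that by auto
    have zt: "(x, v + t *\<^sub>R (w - v)) \<in> Z" if "0 \<le> t" "t \<le> 1" for t using nz[OF that] x by auto
    let ?\<phi> = "\<lambda>t. E (x, v + t *\<^sub>R (w - v))" and ?\<phi>' = "\<lambda>t. dE (x, v + t *\<^sub>R (w - v)) (0, w - v)"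
    \<comment> \<open>Two applications of the mean value theorem reach the Hessian at an
      intermediate point of the segment.\<close>
    obtain s where s: "0 < s" "s < 1" "?\<phi> 1 - ?\<phi> 0 = (1 - 0) * ?\<phi>' s"
      using MVT2[of 0 1 ?\<phi> ?\<phi>'] hess_form_along_line(1)[OF zt] by auto
    obtain r where r: "0 < r" "r < s"
      "?\<phi>' s - ?\<phi>' 0 = (s - 0) * hess_form x (v + r *\<^sub>R (w - v)) (w - v) (w - v)"
      using MVT2[OF s(1), of ?\<phi>' "\<lambda>t. hess_form x (v + t *\<^sub>R (w - v)) (w - v) (w - v)"]
        hess_form_along_line(2)[OF zt] s(2) by auto
    have "hess_form x (v + r *\<^sub>R (w - v)) (w - v) (w - v) \<ge> 0"
    proof (cases "w - v = 0")
      case True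
      then show ?thesis using linear_0[OF hess_form_linear(2)[OF zt[of r]]] r s by simp
    next
      case False
      then show ?thesis using hess_form_posdef[OF x nz[of r] False] r s by simp
    qed
    then have "?\<phi>' s \<ge> ?\<phi>' 0" using r(3) s(1) by (smt (verit) mult_nonneg_nonneg)
    then have "E (x, w) - E (x, v) \<ge> dE (x, v) (0, w - v)" using s(3) by simp
    moreover have "dE (x, v) (0, w - v) = dE (x, v) (0, w) - 2 * E (x, v)"
      using linear_diff[OF linear_dE[OF z], of "(0, w)" "(0, v)"] euler[OF z] by simp
    ultimately show ?thesis by linarith
  qed
qed

end

section \<open>Charts and smooth maps\<close>

lemma frechet_derivative_eqI: "(f has_derivative L) (at x) \<Longrightarrow> frechet_derivative f (at x) = L"
  by (rule frechet_derivative_at[symmetric])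

abbreviation chart_image :: "('m, 'e) chart \<Rightarrow> 'e set" where
  "chart_image c \<equiv> snd c ` fst c"

abbreviation overlap :: "('m, 'e) chart \<Rightarrow> ('m, 'e) chart \<Rightarrow> 'e set" where
  "overlap c d \<equiv> snd c ` (fst c \<inter> fst d)"

abbreviation transition :: "('m, 'e) chart \<Rightarrow> ('m, 'e) chart \<Rightarrow> 'e \<Rightarrow> 'e" where
  "transition c d \<equiv> snd d \<circ> chart_inv c"

lemma charts_atD: "c \<in> charts_at A p \<Longrightarrow> c \<in> A" "c \<in> charts_at A p \<Longrightarrow> p \<in> fst c"
  by (auto simp: charts_at_def)

lemma charts_atI: "c \<in> A \<Longrightarrow> p \<in> fst c \<Longrightarrow> c \<in> charts_at A p"
  by (auto simp: charts_at_def)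

lemma points_iff: "p \<in> points A \<longleftrightarrow> (\<exists>c. c \<in> charts_at A p)"
  unfolding charts_at_def points_def by blast

lemma chart_inv_image: "x \<in> chart_image c \<Longrightarrow> chart_inv c x \<in> fst c"
  "x \<in> chart_image c \<Longrightarrow> snd c (chart_inv c x) = x"
  by (auto simp: chart_inv_def f_inv_into_f inv_into_into)

lemma chart_inv_snd: "smooth_atlas A \<Longrightarrow> c \<in> A \<Longrightarrow> p \<in> fst c \<Longrightarrow> chart_inv c (snd c p) = p"
  by (auto simp: chart_inv_def smooth_atlas_def)

lemma open_chart_image: "smooth_atlas A \<Longrightarrow> c \<in> A \<Longrightarrow> open (chart_image c)"
  by (metis Int_absorb smooth_atlas_def)

lemma open_overlap: "smooth_atlas A \<Longrightarrow> c \<in> A \<Longrightarrow> d \<in> A \<Longrightarrow> open (overlap c d)"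
  by (simp add: smooth_atlas_def)

lemma smooth_transition:
  "smooth_atlas A \<Longrightarrow> c \<in> A \<Longrightarrow> d \<in> A \<Longrightarrow> smooth_on (overlap c d) (transition c d)"
  by (simp add: smooth_atlas_def)

lemma overlap_iff:
  assumes "smooth_atlas A" "c \<in> A"
  shows "x \<in> overlap c d \<longleftrightarrow> x \<in> chart_image c \<and> chart_inv c x \<in> fst d"
proof
  assume "x \<in> overlap c d"
  then obtain p where "p \<in> fst c" "p \<in> fst d" "x = snd c p" by auto
  then show "x \<in> chart_image c \<and> chart_inv c x \<in> fst d"
    using chart_inv_snd[OF assms] by auto
next
  assume "x \<in> chart_image c \<and> chart_inv c x \<in> fst d"
  then show "x \<in> overlap c d"
    by (metis IntI chart_inv_image imageI)
qed

lemma transition_compose: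
  assumes "smooth_atlas A" "c \<in> A" "d \<in> A" "x \<in> overlap c d"
  shows "chart_inv d (transition c d x) = chart_inv c x" "transition c d x \<in> overlap d c"
    "transition d e (transition c d x) = transition c e x"
proof -
  have x: "x \<in> chart_image c" "chart_inv c x \<in> fst d" using overlap_iff[OF assms(1,2)] assms(4) by auto
  show 1: "chart_inv d (transition c d x) = chart_inv c x"
    using chart_inv_snd[OF assms(1,3) x(2)] by simp
  show "transition c d x \<in> overlap d c" using chart_inv_image(1)[OF x(1)] x(2) by auto
  show "transition d e (transition c d x) = transition c e x" using 1 by (simp add: o_def)
qed

lemma transition_has_derivative:
  assumes "smooth_atlas A" "c \<in> charts_at A p" "d \<in> charts_at A p"
  shows "(transition c d has_derivative frechet_derivative (transition c d) (at (snd c p))) (at (snd c p))"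
proof -
  have "c \<in> A" "d \<in> A" "snd c p \<in> overlap c d"
    using charts_atD[OF assms(2)] charts_atD[OF assms(3)] by auto
  then show ?thesis by (intro smooth_on_has_derivative[OF smooth_transition[OF assms(1)]])
qed

lemma transition_derivative_compose:
  assumes "smooth_atlas A" "c \<in> charts_at A p" "d \<in> charts_at A p" "e \<in> charts_at A p"
  shows "frechet_derivative (transition c e) (at (snd c p)) y
    = frechet_derivative (transition d e) (at (snd d p)) (frechet_derivative (transition c d) (at (snd c p)) y)"
proof -
  note cde = charts_atD[OF assms(2)] charts_atD[OF assms(3)] charts_atD[OF assms(4)]
  have tc: "transition c d (snd c p) = snd d p" using chart_inv_snd[OF assms(1) cde(1,2)] by simp
  have "((\<lambda>x. transition d e (transition c d x)) has_derivative
     (\<lambda>y. frechet_derivative (transition d e) (at (snd d p)) (frechet_derivative (transition c d) (at (snd c p)) y))) (at (snd c p))"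
    by (rule has_derivative_compose[OF transition_has_derivative[OF assms(1,2,3)]])
      (unfold tc, rule transition_has_derivative[OF assms(1,3,4)])
  then have "(transition c e has_derivative
     (\<lambda>y. frechet_derivative (transition d e) (at (snd d p)) (frechet_derivative (transition c d) (at (snd c p)) y))) (at (snd c p))"
    by (rule has_derivative_transform_within_open[OF _ open_overlap[OF assms(1) cde(1,3)]])
      (use cde transition_compose(3)[OF assms(1) cde(1,3)] in auto)
  then show ?thesis by (simp add: frechet_derivative_eqI)
qed

lemma transition_derivative_self:
  assumes "smooth_atlas A" "c \<in> charts_at A p"
  shows "frechet_derivative (transition c c) (at (snd c p)) y = y"
proof -
  note c = charts_atD[OF assms(2)]
  have "((\<lambda>x. x) has_derivative (\<lambda>y. y)) (at (snd c p))" by simp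
  then have "(transition c c has_derivative (\<lambda>y. y)) (at (snd c p))"
    by (rule has_derivative_transform_within_open[OF _ open_chart_image[OF assms(1) c(1)]])
      (use c(2) in \<open>simp_all add: chart_inv_image(2)\<close>)
  then show ?thesis by (simp add: frechet_derivative_eqI)
qed

text \<open>In another chart \<open>d\<close> the image becomes the preimage of \<open>V\<close>
  under a transition map, which is continuous on an open set.\<close>

lemma openin_chart_inv_image:
  assumes "smooth_atlas A" "c \<in> A" "open V" "V \<subseteq> chart_image c"
  shows "openin (manifold_topology A) (chart_inv c ` V)"
  unfolding openin_manifold_topology[OF assms(1)]
proof (intro conjI ballI)
  show "chart_inv c ` V \<subseteq> points A"
    using assms(2,4) chart_inv_image(1)[of _ c] unfolding points_def by blast
  fix d assume d: "d \<in> A"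
  have "snd d ` (chart_inv c ` V \<inter> fst d) = {y \<in> overlap d c. transition d c y \<in> V}"
  proof (intro set_eqI iffI)
    fix y assume "y \<in> snd d ` (chart_inv c ` V \<inter> fst d)"
    then obtain x where x: "x \<in> V" "chart_inv c x \<in> fst d" "y = snd d (chart_inv c x)" by auto
    then show "y \<in> {y \<in> overlap d c. transition d c y \<in> V}"
      using chart_inv_snd[OF assms(1) d x(2)] chart_inv_image[of x c] assms(4) by auto
  next
    fix y assume "y \<in> {y \<in> overlap d c. transition d c y \<in> V}"
    then have y: "y \<in> overlap d c" "transition d c y \<in> V" by auto
    then have "chart_inv d y \<in> fst d" "snd d (chart_inv d y) = y" "chart_inv c (transition d c y) = chart_inv d y"
      using overlap_iff[OF assms(1) d, of y c] chart_inv_image[of y d] transition_compose(1)[OF assms(1) d assms(2)] by auto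
    then show "y \<in> snd d ` (chart_inv c ` V \<inter> fst d)" using y(2) by (metis IntI imageI)
  qed
  moreover have "open {y \<in> overlap d c. transition d c y \<in> V}"
    using continuous_open_preimage[OF smooth_on_imp_continuous_on[OF smooth_transition[OF assms(1) d assms(2)]] open_overlap[OF assms(1) d assms(2)] assms(3)]
    by (simp add: vimage_def Int_def)
  ultimately show "open (snd d ` (chart_inv c ` V \<inter> fst d))" by simp
qed

lemma topspace_manifold_topology: "smooth_atlas A \<Longrightarrow> topspace (manifold_topology A) = points A"
proof (rule subset_antisym)
  assume A: "smooth_atlas A"
  show "topspace (manifold_topology A) \<subseteq> points A"
    using openin_manifold_topology[OF A] openin_topspace by blast
  have "openin (manifold_topology A) (points A)"
    unfolding openin_manifold_topology[OF A]
  proof (intro conjI ballI)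
    fix c assume c: "c \<in> A"
    then have "points A \<inter> fst c = fst c" by (auto simp: points_def)
    then show "open (snd c ` (points A \<inter> fst c))" using open_chart_image[OF A c] by simp
  qed simp
  then show "points A \<subseteq> topspace (manifold_topology A)" by (rule openin_subset)
qed

text \<open>Neighbourhoods in the manifold are replaced by open sets \<open>V\<close> of
  coordinates, where the Euclidean calculus applies.\<close>

lemma smooth_map_onI:
  assumes "smooth_atlas A"
    and "\<And>p. p \<in> W \<Longrightarrow> \<exists>c\<in>charts_at A p. \<exists>d\<in>B. \<exists>V. open V \<and> snd c p \<in> V \<and> V \<subseteq> snd c ` (W \<inter> fst c) \<and>
      (\<forall>x\<in>V. f (chart_inv c x) \<in> fst d) \<and> smooth_on V (snd d \<circ> f \<circ> chart_inv c)"
  shows "smooth_map_on A W B f"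
  unfolding smooth_map_on_def
proof
  fix p assume "p \<in> W"
  from assms(2)[OF this] obtain c d V where c: "c \<in> charts_at A p" and d: "d \<in> B"
    and V: "open V" "snd c p \<in> V" "V \<subseteq> snd c ` (W \<inter> fst c)" "\<And>x. x \<in> V \<Longrightarrow> f (chart_inv c x) \<in> fst d"
      "smooth_on V (snd d \<circ> f \<circ> chart_inv c)" by blast
  note c' = charts_atD[OF c]
  have Vc: "V \<subseteq> chart_image c" using V(3) by auto
  have inv: "chart_inv c x \<in> W \<inter> fst c" if "x \<in> V" for x
    using V(3) that chart_inv_snd[OF assms(1) c'(1)] by auto
  have "snd c ` chart_inv c ` V = V"
    using Vc chart_inv_image(2)[of _ c] by (force simp: image_image)
  then have "openin (manifold_topology A) (chart_inv c ` V) \<and> p \<in> chart_inv c ` V \<and>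
      chart_inv c ` V \<subseteq> W \<inter> fst c \<and> f ` chart_inv c ` V \<subseteq> fst d \<and>
      smooth_on (snd c ` chart_inv c ` V) (snd d \<circ> f \<circ> chart_inv c)"
    using openin_chart_inv_image[OF assms(1) c'(1) V(1) Vc] V inv chart_inv_snd[OF assms(1) c'] by force
  then show "\<exists>c\<in>A. \<exists>d\<in>B. \<exists>N. openin (manifold_topology A) N \<and> p \<in> N \<and> N \<subseteq> W \<inter> fst c \<and>
        f ` N \<subseteq> fst d \<and> smooth_on (snd c ` N) (snd d \<circ> f \<circ> chart_inv c)"
    using c'(1) d by blast
qed

text \<open>\<open>smooth_map_on\<close> provides some pair of charts, whereas here the charts are
  prescribed. In them the map is the given representative preceded and followed by transition maps,
  on a domain shrunk so that all of these are defined.\<close>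

lemma smooth_map_onE:
  fixes A :: "('m, 'e::euclidean_space) atlas" and B :: "('n, 'f::euclidean_space) atlas"
  assumes "smooth_map_on A W B f" "smooth_atlas A" "smooth_atlas B" "p \<in> W"
    "c \<in> charts_at A p" "d \<in> charts_at B (f p)"
  obtains V where "open V" "snd c p \<in> V" "V \<subseteq> snd c ` (W \<inter> fst c)"
    "\<And>x. x \<in> V \<Longrightarrow> f (chart_inv c x) \<in> fst d" "smooth_on V (snd d \<circ> f \<circ> chart_inv c)"
proof -
  note A = assms(2) and B = assms(3)
  obtain c' d' N where c'A: "c' \<in> A" and d'B: "d' \<in> B"
    and N: "openin (manifold_topology A) N" "p \<in> N" "N \<subseteq> W \<inter> fst c'" "f ` N \<subseteq> fst d'"
      "smooth_on (snd c' ` N) (snd d' \<circ> f \<circ> chart_inv c')"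
    using assms(1,4) unfolding smooth_map_on_def by blast
  note c = charts_atD[OF assms(5)] and d = charts_atD[OF assms(6)]
  let ?N' = "snd c' ` N"
  have oN: "open ?N'"
  proof -
    have "N \<inter> fst c' = N" using N(3) by auto
    then show ?thesis using N(1) c'A unfolding openin_manifold_topology[OF A] by metis
  qed
  let ?g = "snd d' \<circ> f \<circ> chart_inv c'"
  define V1 where "V1 = overlap c c' \<inter> transition c c' -` ?N'"
  have oV1: "open V1" unfolding V1_def
    by (rule continuous_open_preimage[OF smooth_on_imp_continuous_on[OF smooth_transition[OF A c(1) c'A]]
          open_overlap[OF A c(1) c'A] oN])
  have V1N: "chart_inv c x \<in> N" if "x \<in> V1" for x
  proof -
    have "transition c c' x \<in> ?N'" using that by (simp add: V1_def)
    then obtain q where q: "transition c c' x = snd c' q" "q \<in> N" by blast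
    have "chart_inv c' (transition c c' x) = chart_inv c x"
      using transition_compose(1)[OF A c(1) c'A] that by (auto simp: V1_def)
    then show ?thesis using q chart_inv_snd[OF A c'A, of q] N(3) by auto
  qed
  define h where "h x = ?g (transition c c' x)" for x
  have hsm: "smooth_on V1 h"
    unfolding h_def
    by (rule smooth_on_compose[OF oV1 oN _ smooth_on_subset[OF smooth_transition[OF A c(1) c'A]] N(5)])
      (auto simp: V1_def)
  have heq: "h x = snd d' (f (chart_inv c x))" if "x \<in> V1" for x
    using transition_compose(1)[OF A c(1) c'A, of x] that by (simp add: h_def V1_def)
  define V where "V = V1 \<inter> h -` overlap d' d"
  have oV: "open V" unfolding V_def
    by (rule continuous_open_preimage[OF smooth_on_imp_continuous_on[OF hsm] oV1 open_overlap[OF B d'B d(1)]])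
  have pc: "chart_inv c (snd c p) = p" by (rule chart_inv_snd[OF A c])
  have "snd c p \<in> V1" using c N(2,3) pc by (auto simp: V1_def)
  moreover have "snd d' (f p) \<in> overlap d' d" using d(2) N(2,4) by auto
  ultimately have pV: "snd c p \<in> V" using heq[of "snd c p"] pc by (auto simp: V_def)
  have Vd: "f (chart_inv c x) \<in> fst d \<and> transition d' d (h x) = snd d (f (chart_inv c x))" if "x \<in> V" for x
  proof -
    have x: "x \<in> V1" "h x \<in> overlap d' d" using that by (auto simp: V_def)
    have "f (chart_inv c x) \<in> fst d'" using V1N[OF x(1)] N(4) by auto
    then have "chart_inv d' (h x) = f (chart_inv c x)"
      using heq[OF x(1)] chart_inv_snd[OF B d'B] by simp
    then show ?thesis using overlap_iff[OF B d'B, of "h x" d] x(2) by simp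
  qed
  have "smooth_on V (\<lambda>x. transition d' d (h x))"
    by (rule smooth_on_compose[OF oV open_overlap[OF B d'B d(1)] _ smooth_on_subset[OF hsm] smooth_transition[OF B d'B d(1)]])
      (auto simp: V_def)
  then have "smooth_on V (snd d \<circ> f \<circ> chart_inv c)"
    by (rule smooth_on_cong[OF oV, rotated]) (use Vd in auto)
  moreover have "V \<subseteq> snd c ` (W \<inter> fst c)"
  proof
    fix x assume "x \<in> V"
    then have x: "x \<in> V1" by (simp add: V_def)
    then have "x \<in> chart_image c" by (auto simp: V1_def)
    then have "chart_inv c x \<in> W \<inter> fst c" "snd c (chart_inv c x) = x"
      using V1N[OF x] N(3) chart_inv_image[of x c] by auto
    then show "x \<in> snd c ` (W \<inter> fst c)" by (metis imageI)
  qed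
  ultimately show thesis using that[OF oV pV] Vd by blast
qed

subsection \<open>Curves and real functions\<close>

lemma smooth_atlas_standard: "smooth_atlas standard_atlas"
  by (auto simp: smooth_atlas_def standard_atlas_def chart_inv_def o_def intro!: smooth_on_id)

lemma charts_at_standard: "charts_at standard_atlas x = {(UNIV, id)}"
  by (auto simp: charts_at_def standard_atlas_def)

lemma chart_inv_standard: "chart_inv (UNIV, id) = id"
  by (auto simp: chart_inv_def fun_eq_iff inv_into_def)

lemma smooth_curve_iff:
  assumes "smooth_atlas A"
  shows "smooth_map_on standard_atlas I A \<gamma> \<longleftrightarrow>
    (\<forall>t\<in>I. \<exists>c\<in>A. \<exists>N. open N \<and> t \<in> N \<and> N \<subseteq> I \<and> \<gamma> ` N \<subseteq> fst c \<and> smooth_on N (snd c \<circ> \<gamma>))"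
    (is "?L \<longleftrightarrow> ?R")
proof
  assume L: ?L
  show ?R
  proof
    fix t assume "t \<in> I"
    then obtain c where c: "c \<in> charts_at A (\<gamma> t)"
      using L unfolding smooth_map_on_def by (metis charts_atI image_subset_iff)
    obtain V where "open V" "t \<in> V" "V \<subseteq> I" "\<And>x. x \<in> V \<Longrightarrow> \<gamma> x \<in> fst c" "smooth_on V (snd c \<circ> \<gamma>)"
      using smooth_map_onE[OF L smooth_atlas_standard assms \<open>t \<in> I\<close>, of "(UNIV, id)" c] c
      by (auto simp: charts_at_standard chart_inv_standard)
    then show "\<exists>c\<in>A. \<exists>N. open N \<and> t \<in> N \<and> N \<subseteq> I \<and> \<gamma> ` N \<subseteq> fst c \<and> smooth_on N (snd c \<circ> \<gamma>)"
      using charts_atD(1)[OF c] by blast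
  qed
next
  assume R: ?R
  show ?L
  proof (rule smooth_map_onI[OF smooth_atlas_standard])
    fix t assume "t \<in> I"
    with R obtain c N where c: "c \<in> A" "open N" "t \<in> N" "N \<subseteq> I" "\<gamma> ` N \<subseteq> fst c" "smooth_on N (snd c \<circ> \<gamma>)"
      by blast
    then show "\<exists>b\<in>charts_at standard_atlas t. \<exists>d\<in>A. \<exists>V. open V \<and> snd b t \<in> V \<and> V \<subseteq> snd b ` (I \<inter> fst b) \<and>
        (\<forall>x\<in>V. \<gamma> (chart_inv b x) \<in> fst d) \<and> smooth_on V (snd d \<circ> \<gamma> \<circ> chart_inv b)"
      by (intro bexI[of _ "(UNIV, id)"] bexI[of _ c] exI[of _ N])
        (simp_all add: charts_at_standard chart_inv_standard image_subset_iff)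
  qed
qed

lemma smooth_curveE:
  assumes "smooth_map_on standard_atlas I A \<gamma>" "smooth_atlas A" "t \<in> I" "c \<in> charts_at A (\<gamma> t)"
  obtains N where "open N" "t \<in> N" "N \<subseteq> I" "\<And>s. s \<in> N \<Longrightarrow> \<gamma> s \<in> fst c" "smooth_on N (snd c \<circ> \<gamma>)"
  using smooth_map_onE[OF assms(1) smooth_atlas_standard assms(2,3), of "(UNIV, id)" c] assms(4)
  by (auto simp: charts_at_standard chart_inv_standard)

section \<open>Tangent vectors in coordinates\<close>

text \<open>The inverse of the tangent chart of \<open>c\<close>: a normal form for tangent vectors
  in which velocities, lifts and derivatives are computed. The value 0 at other charts is the
  convention of \<open>tangent_bundle\<close>.\<close>

definition chart_vec :: "('m, 'e::euclidean_space) atlas \<Rightarrow> ('m, 'e) chart \<Rightarrow> 'e \<Rightarrow> 'e \<Rightarrow> ('m, 'e) tvec" where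
  "chart_vec A c x y = (chart_inv c x, \<lambda>d. if d \<in> charts_at A (chart_inv c x)
     then frechet_derivative (transition c d) (at x) y else 0)"

lemma fst_chart_vec [simp]: "fst (chart_vec A c x y) = chart_inv c x"
  by (simp add: chart_vec_def)

lemma snd_chart_vec:
  "d \<in> charts_at A (chart_inv c x) \<Longrightarrow>
    snd (chart_vec A c x y) d = frechet_derivative (transition c d) (at x) y"
  by (simp add: chart_vec_def)

lemma chart_at_chart_inv: "c \<in> A \<Longrightarrow> x \<in> chart_image c \<Longrightarrow> c \<in> charts_at A (chart_inv c x)"
  by (rule charts_atI[OF _ chart_inv_image(1)])

lemma tangent_bundle_iff:
  "v \<in> tangent_bundle A \<longleftrightarrow> fst v \<in> points A \<and> (\<forall>c. c \<notin> charts_at A (fst v) \<longrightarrow> snd v c = 0) \<and>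
    (\<forall>c\<in>charts_at A (fst v). \<forall>d\<in>charts_at A (fst v).
       snd v d = frechet_derivative (transition c d) (at (snd c (fst v))) (snd v c))"
  by (simp add: tangent_bundle_def case_prod_beta)

lemma chart_vec_in_tangent_bundle:
  assumes "smooth_atlas A" "c \<in> A" "x \<in> chart_image c"
  shows "chart_vec A c x y \<in> tangent_bundle A"
proof -
  have c: "c \<in> charts_at A (chart_inv c x)" by (rule chart_at_chart_inv[OF assms(2,3)])
  then have "chart_inv c x \<in> points A" using points_iff[of "chart_inv c x" A] by blast
  moreover have tr: "frechet_derivative (transition c e) (at x) y
    = frechet_derivative (transition d e) (at (snd d (chart_inv c x))) (frechet_derivative (transition c d) (at x) y)"
    if "d \<in> charts_at A (chart_inv c x)" "e \<in> charts_at A (chart_inv c x)" for d e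
    using transition_derivative_compose[OF assms(1) c that, of y] chart_inv_image(2)[OF assms(3)] by simp
  moreover have "snd (chart_vec A c x y) d = 0" if "d \<notin> charts_at A (chart_inv c x)" for d
    using that by (simp add: chart_vec_def)
  moreover have "snd (chart_vec A c x y) e
      = frechet_derivative (transition d e) (at (snd d (chart_inv c x))) (snd (chart_vec A c x y) d)"
    if "d \<in> charts_at A (chart_inv c x)" "e \<in> charts_at A (chart_inv c x)" for d e
    unfolding snd_chart_vec[OF that(1)] snd_chart_vec[OF that(2)] by (rule tr[OF that])
  ultimately show ?thesis unfolding tangent_bundle_iff fst_chart_vec by blast
qed

lemma snd_chart_vec_same:
  assumes "smooth_atlas A" "c \<in> A" "x \<in> chart_image c"
  shows "snd (chart_vec A c x y) c = y"
  using transition_derivative_self[OF assms(1) chart_at_chart_inv[OF assms(2,3)], of y] chart_inv_image(2)[OF assms(3)]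
    snd_chart_vec[OF chart_at_chart_inv[OF assms(2,3)], of y] by simp

lemma tangent_vector_transform:
  assumes "v \<in> tangent_bundle A" "c \<in> charts_at A (fst v)" "d \<in> charts_at A (fst v)"
  shows "snd v d = frechet_derivative (transition c d) (at (snd c (fst v))) (snd v c)"
  using assms unfolding tangent_bundle_iff by blast

text \<open>The transformation rule recovers all components from the one in \<open>c\<close>, and
  components at charts away from the base point are 0.\<close>

lemma tangent_vector_eqI:
  assumes "v \<in> tangent_bundle A" "w \<in> tangent_bundle A" "fst v = fst w" "c \<in> charts_at A (fst v)"
    "snd v c = snd w c"
  shows "v = w"
proof -
  have "snd v d = snd w d" for d
  proof (cases "d \<in> charts_at A (fst v)")
    case True
    then show ?thesis using tangent_vector_transform[OF assms(1,4)] tangent_vector_transform[OF assms(2), of c d] assms by simp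
  next
    case False
    then have "snd v d = 0" using assms(1) unfolding tangent_bundle_iff by blast
    moreover have "snd w d = 0" using assms(2) False unfolding tangent_bundle_iff assms(3) by blast
    ultimately show ?thesis by simp
  qed
  then show ?thesis using assms(3) by (simp add: prod_eq_iff fun_eq_iff)
qed

lemma tangent_vector_eq_chart_vec:
  assumes "smooth_atlas A" "v \<in> tangent_bundle A" "c \<in> charts_at A (fst v)"
  shows "v = chart_vec A c (snd c (fst v)) (snd v c)"
proof (rule tangent_vector_eqI[OF assms(2) _ _ assms(3)])
  note c = charts_atD[OF assms(3)]
  have x: "snd c (fst v) \<in> chart_image c" using c by auto
  show "chart_vec A c (snd c (fst v)) (snd v c) \<in> tangent_bundle A"
    by (rule chart_vec_in_tangent_bundle[OF assms(1) c(1) x])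
  show "fst v = fst (chart_vec A c (snd c (fst v)) (snd v c))" using chart_inv_snd[OF assms(1) c] by simp
  show "snd v c = snd (chart_vec A c (snd c (fst v)) (snd v c)) c" using snd_chart_vec_same[OF assms(1) c(1) x] by simp
qed

lemma tangent_bundle_charts: "v \<in> tangent_bundle A \<Longrightarrow> \<exists>c. c \<in> charts_at A (fst v)"
  using points_iff[of "fst v" A] by (simp add: tangent_bundle_iff)

lemma tzero_in_tangent_bundle:
  assumes A: "smooth_atlas A" and p: "p \<in> points A"
  shows "tzero p \<in> tangent_bundle A"
proof -
  have "frechet_derivative (transition c d) (at (snd c p)) 0 = 0"
    if "c \<in> charts_at A p" "d \<in> charts_at A p" for c d
    using transition_has_derivative[OF A that] has_derivative_linear linear_0 by blast
  then show ?thesis using p unfolding tangent_bundle_iff tzero_def by simp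
qed

lemma slit_bundle_iff:
  assumes "smooth_atlas A" "v \<in> tangent_bundle A" "c \<in> charts_at A (fst v)"
  shows "v \<in> slit_bundle A \<longleftrightarrow> snd v c \<noteq> 0"
proof
  assume "v \<in> slit_bundle A"
  then have v: "v \<noteq> tzero (fst v)" by (simp add: slit_bundle_def)
  have "tzero (fst v) \<in> tangent_bundle A"
  proof (rule tzero_in_tangent_bundle[OF assms(1)])
    show "fst v \<in> points A" using assms(2) unfolding tangent_bundle_iff by blast
  qed
  then show "snd v c \<noteq> 0"
    using tangent_vector_eqI[OF assms(2) _ _ assms(3)] v by (auto simp: tzero_def)
next
  assume "snd v c \<noteq> 0"
  then have "v \<noteq> tzero (fst v)" by (metis snd_conv tzero_def)
  then show "v \<in> slit_bundle A" using assms(2) by (simp add: slit_bundle_def)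
qed

lemma slit_bundle_subset: "v \<in> slit_bundle A \<Longrightarrow> v \<in> tangent_bundle A"
  by (simp add: slit_bundle_def)

lemma linear_combination_in_tangent_bundle:
  assumes "smooth_atlas A" "v \<in> tangent_bundle A" "w \<in> tangent_bundle A" "fst v = fst w"
  shows "tadd v w \<in> tangent_bundle A" "tscale r v \<in> tangent_bundle A"
proof -
  have l: "linear (frechet_derivative (transition c d) (at (snd c (fst v))))"
    if "c \<in> charts_at A (fst v)" "d \<in> charts_at A (fst v)" for c d
    using transition_has_derivative[OF assms(1) that] has_derivative_linear by blast
  have p: "fst v \<in> points A" and v0: "\<And>c. c \<notin> charts_at A (fst v) \<Longrightarrow> snd v c = 0"
    using assms(2) unfolding tangent_bundle_iff by blast+
  have w0: "\<And>c. c \<notin> charts_at A (fst v) \<Longrightarrow> snd w c = 0"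
    using assms(3) unfolding tangent_bundle_iff assms(4)[symmetric] by blast
  note wt = tangent_vector_transform[OF assms(3), folded assms(4)]
  show "tscale r v \<in> tangent_bundle A"
    unfolding tangent_bundle_iff tscale_def fst_conv snd_conv
  proof (intro conjI allI ballI impI p)
    show "r *\<^sub>R snd v c = 0" if "c \<notin> charts_at A (fst v)" for c using v0[OF that] by simp
    show "r *\<^sub>R snd v d = frechet_derivative (transition c d) (at (snd c (fst v))) (r *\<^sub>R snd v c)"
      if cd: "c \<in> charts_at A (fst v)" "d \<in> charts_at A (fst v)" for c d
      unfolding linear_cmul[OF l[OF cd]] tangent_vector_transform[OF assms(2) cd] ..
  qed
  show "tadd v w \<in> tangent_bundle A"
    unfolding tangent_bundle_iff tadd_def fst_conv snd_conv
  proof (intro conjI allI ballI impI p)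
    show "snd v c + snd w c = 0" if "c \<notin> charts_at A (fst v)" for c using v0[OF that] w0[OF that] by simp
    show "snd v d + snd w d = frechet_derivative (transition c d) (at (snd c (fst v))) (snd v c + snd w c)"
      if cd: "c \<in> charts_at A (fst v)" "d \<in> charts_at A (fst v)" for c d
      unfolding linear_add[OF l[OF cd]] tangent_vector_transform[OF assms(2) cd] wt[OF cd] ..
  qed
qed

subsection \<open>The atlas of the tangent bundle\<close>

lemma tangent_chart_simps [simp]:
  "fst (tangent_chart A c) = {v \<in> tangent_bundle A. fst v \<in> fst c}"
  "snd (tangent_chart A c) = (\<lambda>v. (snd c (fst v), snd v c))"
  by (simp_all add: tangent_chart_def)

lemma tangent_chart_in_atlas: "c \<in> A \<Longrightarrow> tangent_chart A c \<in> tangent_atlas A"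
  by (simp add: tangent_atlas_def)

lemma inj_on_tangent_chart:
  assumes "smooth_atlas A" "c \<in> A"
  shows "inj_on (\<lambda>v. (snd c (fst v), snd v c)) {v \<in> tangent_bundle A. fst v \<in> fst c}"
proof (rule inj_onI)
  fix v w assume vw: "v \<in> {v \<in> tangent_bundle A. fst v \<in> fst c}" "w \<in> {v \<in> tangent_bundle A. fst v \<in> fst c}"
    "(snd c (fst v), snd v c) = (snd c (fst w), snd w c)"
  then have "fst v = fst w" using chart_inv_snd[OF assms] by (metis (lifting) Pair_inject mem_Collect_eq)
  then show "v = w" using tangent_vector_eqI[of v A w c] vw assms(2) by (auto simp: charts_at_def)
qed

lemma chart_vec_overlap_image:
  assumes "smooth_atlas A" "c \<in> A"
  shows "(\<lambda>v. (snd c (fst v), snd v c)) ` {v \<in> tangent_bundle A. fst v \<in> fst c \<and> fst v \<in> D} = snd c ` (fst c \<inter> D) \<times> UNIV"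
proof (intro set_eqI iffI)
  fix z assume "z \<in> snd c ` (fst c \<inter> D) \<times> (UNIV :: 'b set)"
  then obtain p y where z: "p \<in> fst c" "p \<in> D" "z = (snd c p, y)" by auto
  have "chart_vec A c (snd c p) y \<in> {v \<in> tangent_bundle A. fst v \<in> fst c \<and> fst v \<in> D}"
    using chart_vec_in_tangent_bundle[OF assms, of "snd c p" y] chart_inv_snd[OF assms z(1)] z by auto
  moreover have "z = (\<lambda>v. (snd c (fst v), snd v c)) (chart_vec A c (snd c p) y)"
    using snd_chart_vec_same[OF assms, of "snd c p" y] chart_inv_snd[OF assms z(1)] z by auto
  ultimately show "z \<in> (\<lambda>v. (snd c (fst v), snd v c)) ` {v \<in> tangent_bundle A. fst v \<in> fst c \<and> fst v \<in> D}" by blast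
qed auto

lemma tangent_chart_image:
  "smooth_atlas A \<Longrightarrow> c \<in> A \<Longrightarrow> chart_image (tangent_chart A c) = chart_image c \<times> UNIV"
  using chart_vec_overlap_image[of A c "fst c"] by simp

lemma chart_inv_tangent_chart:
  assumes "smooth_atlas A" "c \<in> A" "x \<in> chart_image c"
  shows "chart_inv (tangent_chart A c) (x, y) = chart_vec A c x y"
proof -
  have v: "chart_vec A c x y \<in> {v \<in> tangent_bundle A. fst v \<in> fst c}"
    using chart_vec_in_tangent_bundle[OF assms] chart_inv_image(1)[OF assms(3)] by simp
  have "(x, y) = snd (tangent_chart A c) (chart_vec A c x y)"
    using snd_chart_vec_same[OF assms] chart_inv_image(2)[OF assms(3)] by simp
  then show ?thesis
    unfolding chart_inv_def using inv_into_f_f[OF inj_on_tangent_chart[OF assms(1,2)] v] by simp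
qed

text \<open>The transition map is (x, y) \<mapsto> (\<tau> x, D\<tau>(x) y) on the product of the
  overlap with the whole model space.\<close>

lemma smooth_atlas_tangent:
  fixes A :: "('m, 'e::euclidean_space) atlas"
  assumes "smooth_atlas A"
  shows "smooth_atlas (tangent_atlas A)"
  unfolding smooth_atlas_def
proof (intro conjI ballI)
  fix C :: "(('m, 'e) tvec, 'e \<times> 'e) chart" assume "C \<in> tangent_atlas A"
  then obtain c where c: "c \<in> A" "C = tangent_chart A c" by (auto simp: tangent_atlas_def)
  then show "inj_on (snd C) (fst C)" using inj_on_tangent_chart[OF assms c(1)] by simp
  fix D :: "(('m, 'e) tvec, 'e \<times> 'e) chart" assume "D \<in> tangent_atlas A"
  then obtain d where d: "d \<in> A" "D = tangent_chart A d" by (auto simp: tangent_atlas_def)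
  have "fst C \<inter> fst D = {v \<in> tangent_bundle A. fst v \<in> fst c \<and> fst v \<in> fst d}" using c d by auto
  then have im: "snd C ` (fst C \<inter> fst D) = overlap c d \<times> UNIV"
    using chart_vec_overlap_image[OF assms c(1), of "fst d"] c d by simp
  have oo: "open (overlap c d \<times> (UNIV :: 'e set))"
    by (rule open_Times[OF open_overlap[OF assms c(1) d(1)] open_UNIV])
  show "open (snd C ` (fst C \<inter> fst D))" using oo im by simp
  have f: "smooth_on (overlap c d \<times> (UNIV :: 'e set)) fst" "smooth_on (overlap c d \<times> (UNIV :: 'e set)) snd"
    by (rule smooth_on_linear[OF oo], rule bounded_linear_fst bounded_linear_snd)+
  note tr = smooth_transition[OF assms c(1) d(1)] and o = open_overlap[OF assms c(1) d(1)]
  have "smooth_on (overlap c d \<times> UNIV) (\<lambda>z. (transition c d (fst z), frechet_derivative (transition c d) (at (fst z)) (snd z)))"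
    by (intro smooth_on_Pair oo smooth_on_compose[OF oo o _ f(1) tr]
        smooth_on_frechet_derivative_apply[OF oo o tr f]) auto
  then show "smooth_on (snd C ` (fst C \<inter> fst D)) (snd D \<circ> chart_inv C)"
    unfolding im
  proof (rule smooth_on_cong[OF oo, rotated])
    fix z assume z: "z \<in> overlap c d \<times> (UNIV :: 'e set)"
    obtain x y where xy: "z = (x, y)" by fastforce
    have x: "x \<in> chart_image c" "chart_inv c x \<in> fst d" using z xy overlap_iff[OF assms c(1), of x d] by auto
    have "d \<in> charts_at A (chart_inv c x)" using x(2) d(1) by (simp add: charts_at_def)
    then show "(transition c d (fst z), frechet_derivative (transition c d) (at (fst z)) (snd z)) = (snd D \<circ> chart_inv C) z"
      using chart_inv_tangent_chart[OF assms c(1) x(1), of y] snd_chart_vec[of d A c x y] xy c d by simp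
  qed
qed

lemma charts_at_tangent_atlas:
  "v \<in> tangent_bundle A \<Longrightarrow> charts_at (tangent_atlas A) v = tangent_chart A ` charts_at A (fst v)"
  by (auto simp: charts_at_def tangent_atlas_def)

subsection \<open>Velocities and derivatives in coordinates\<close>

text \<open>By the chain rule the derivatives of all coordinate curves are related by the
  transformation rule, so one chart suffices.\<close>

lemma velocity_eq_chart_vec:
  assumes "smooth_atlas A" "c \<in> A" "\<forall>\<^sub>F s in nhds t. \<gamma> s \<in> fst c"
    "((snd c \<circ> \<gamma>) has_vector_derivative y) (at t)"
  shows "velocity A \<gamma> t = chart_vec A c (snd c (\<gamma> t)) y"
proof -
  have ct: "\<gamma> t \<in> fst c" using eventually_nhds_x_imp_x[OF assms(3)] .
  then have c: "c \<in> charts_at A (\<gamma> t)" using assms(2) by (simp add: charts_at_def)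
  have ci: "chart_inv c (snd c (\<gamma> t)) = \<gamma> t" by (rule chart_inv_snd[OF assms(1,2) ct])
  have "vector_derivative (snd d \<circ> \<gamma>) (at t) = frechet_derivative (transition c d) (at (snd c (\<gamma> t))) y"
    if d: "d \<in> charts_at A (\<gamma> t)" for d
  proof -
    let ?D = "frechet_derivative (transition c d) (at (snd c (\<gamma> t)))"
    have e1: "(snd c \<circ> \<gamma>) t = snd c (\<gamma> t)" by simp
    have D: "(transition c d has_derivative ?D) (at (snd c (\<gamma> t)))"
      by (rule transition_has_derivative[OF assms(1) c d])
    have "((\<lambda>s. transition c d ((snd c \<circ> \<gamma>) s)) has_derivative (\<lambda>r. ?D (r *\<^sub>R y))) (at t)"
      by (rule has_derivative_compose[where g = "transition c d", OF assms(4)[unfolded has_vector_derivative_def]])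
        (unfold e1, rule D)
    moreover have "(\<lambda>r. ?D (r *\<^sub>R y)) = (\<lambda>r. r *\<^sub>R ?D y)"
      using linear_cmul[OF has_derivative_linear[OF D]] by auto
    ultimately have vd: "((\<lambda>s. transition c d ((snd c \<circ> \<gamma>) s)) has_vector_derivative ?D y) (at t)"
      by (simp add: has_vector_derivative_def)
    have "\<forall>\<^sub>F s in nhds t. transition c d ((snd c \<circ> \<gamma>) s) = (snd d \<circ> \<gamma>) s"
      using assms(3) by eventually_elim (simp add: chart_inv_snd[OF assms(1,2)])
    then obtain N where "open N" "t \<in> N" "\<And>s. s \<in> N \<Longrightarrow> transition c d ((snd c \<circ> \<gamma>) s) = (snd d \<circ> \<gamma>) s"
      unfolding eventually_nhds by blast
    then have "((snd d \<circ> \<gamma>) has_vector_derivative ?D y) (at t)"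
      using has_vector_derivative_transform_within_open[OF vd] by blast
    then show ?thesis by (rule vector_derivative_at)
  qed
  then show ?thesis by (auto simp: velocity_def chart_vec_def ci)
qed

lemma some_chart: "v \<in> tangent_bundle A \<Longrightarrow> (SOME c. c \<in> charts_at A (fst v)) \<in> charts_at A (fst v)"
  using tangent_bundle_charts someI_ex by (metis (mono_tags))

lemma has_derivative_change_chart:
  assumes "smooth_atlas A" "c \<in> charts_at A p" "c' \<in> charts_at A p"
    "((f \<circ> chart_inv c) has_derivative L) (at (snd c p))"
  shows "((f \<circ> chart_inv c') has_derivative
    (\<lambda>y. L (frechet_derivative (transition c' c) (at (snd c' p)) y))) (at (snd c' p))"
proof -
  note c = charts_atD[OF assms(2)] and c' = charts_atD[OF assms(3)]
  have "((\<lambda>x. (f \<circ> chart_inv c) (transition c' c x)) has_derivative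
    (\<lambda>y. L (frechet_derivative (transition c' c) (at (snd c' p)) y))) (at (snd c' p))"
    by (rule has_derivative_compose[where g = "f \<circ> chart_inv c", OF transition_has_derivative[OF assms(1,3,2)]])
      (use assms(4) chart_inv_snd[OF assms(1) c'] in simp)
  then show ?thesis
    by (rule has_derivative_transform_within_open[OF _ open_overlap[OF assms(1) c'(1) c(1)]])
      (use c c' transition_compose(1)[OF assms(1) c'(1) c(1)] in auto)
qed

text \<open>The definition uses an arbitrarily chosen chart; the chain rule with the transition map
  removes the choice. \<open>tangent_map_eq\<close> does the same on the source and on the target
  side.\<close>

lemma tangent_deriv_eq:
  assumes "smooth_atlas A" "v \<in> tangent_bundle A" "c \<in> charts_at A (fst v)"
    "((f \<circ> chart_inv c) has_derivative L) (at (snd c (fst v)))"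
  shows "tangent_deriv A v f = L (snd v c)"
proof -
  define c' where "c' = (SOME c. c \<in> charts_at A (fst v))"
  have c': "c' \<in> charts_at A (fst v)" unfolding c'_def by (rule some_chart[OF assms(2)])
  have "((f \<circ> chart_inv c') has_derivative
    (\<lambda>y. L (frechet_derivative (transition c' c) (at (snd c' (fst v))) y))) (at (snd c' (fst v)))"
    by (rule has_derivative_change_chart[OF assms(1,3) c' assms(4)])
  then have "frechet_derivative (f \<circ> chart_inv c') (at (snd c' (fst v))) (snd v c') = L (snd v c)"
    using tangent_vector_transform[OF assms(2) c' assms(3)] by (simp add: frechet_derivative_eqI)
  then show ?thesis by (simp add: tangent_deriv_def c'_def[symmetric])
qed

lemma tangent_map_eq:
  assumes A: "smooth_atlas A" and B: "smooth_atlas B" and v: "v \<in> tangent_bundle A"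
    and c: "c \<in> charts_at A (fst v)" and d: "d \<in> B"
    and ev: "\<forall>\<^sub>F x in nhds (snd c (fst v)). f (chart_inv c x) \<in> fst d"
    and L: "((snd d \<circ> f \<circ> chart_inv c) has_derivative L) (at (snd c (fst v)))"
  shows "tangent_map A B f v = chart_vec B d (snd d (f (fst v))) (L (snd v c))"
proof -
  define c' where "c' = (SOME c. c \<in> charts_at A (fst v))"
  have c': "c' \<in> charts_at A (fst v)" unfolding c'_def by (rule some_chart[OF v])
  have cv: "chart_inv c (snd c (fst v)) = fst v" by (rule chart_inv_snd[OF A charts_atD[OF c]])
  have "f (fst v) \<in> fst d" using eventually_nhds_x_imp_x[OF ev] cv by simp
  then have dB: "d \<in> charts_at B (f (fst v))" using d by (simp add: charts_at_def)
  have ci: "chart_inv d (snd d (f (fst v))) = f (fst v)" by (rule chart_inv_snd[OF B charts_atD[OF dB]])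
  have "frechet_derivative (snd e \<circ> f \<circ> chart_inv c') (at (snd c' (fst v))) (snd v c')
      = frechet_derivative (transition d e) (at (snd d (f (fst v)))) (L (snd v c))"
    if e: "e \<in> charts_at B (f (fst v))" for e
  proof -
    let ?D = "frechet_derivative (transition d e) (at (snd d (f (fst v))))"
    have e1: "(snd d \<circ> f \<circ> chart_inv c) (snd c (fst v)) = snd d (f (fst v))" by (simp add: cv)
    have "((\<lambda>x. transition d e ((snd d \<circ> f \<circ> chart_inv c) x)) has_derivative (\<lambda>y. ?D (L y))) (at (snd c (fst v)))"
      by (rule has_derivative_compose[where g = "transition d e", OF L])
        (unfold e1, rule transition_has_derivative[OF B dB e])
    moreover have "\<forall>\<^sub>F x in nhds (snd c (fst v)). transition d e ((snd d \<circ> f \<circ> chart_inv c) x) = (snd e \<circ> f \<circ> chart_inv c) x"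
      using ev by eventually_elim (simp add: chart_inv_snd[OF B d])
    ultimately have "(((snd e \<circ> f) \<circ> chart_inv c) has_derivative (\<lambda>y. ?D (L y))) (at (snd c (fst v)))"
      unfolding eventually_nhds by (elim exE conjE) (erule has_derivative_transform_within_open, auto)
    from has_derivative_change_chart[OF A c c' this]
    show ?thesis
      using tangent_vector_transform[OF v c' c] by (simp add: frechet_derivative_eqI)
  qed
  then show ?thesis
    by (auto simp: tangent_map_def c'_def[symmetric] chart_vec_def ci)
qed

subsection \<open>Vector fields in coordinates\<close>

text \<open>The base component of a section is the identity, so only the fibre component has to be
  tested for smoothness.\<close>

lemma vector_field_onI:
  assumes A: "smooth_atlas A" and X: "\<And>p. p \<in> W \<Longrightarrow> X p \<in> tangent_space A p"
    and sm: "\<And>p. p \<in> W \<Longrightarrow> \<exists>c\<in>charts_at A p. \<exists>V. open V \<and> snd c p \<in> V \<and> V \<subseteq> snd c ` (W \<inter> fst c) \<and>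
      smooth_on V (\<lambda>x. snd (X (chart_inv c x)) c)"
  shows "vector_field_on A W X"
proof -
  have "smooth_map_on A W (tangent_atlas A) X"
  proof (rule smooth_map_onI[OF A])
    fix p assume "p \<in> W"
    then obtain c V where c: "c \<in> charts_at A p" and V: "open V" "snd c p \<in> V" "V \<subseteq> snd c ` (W \<inter> fst c)"
      "smooth_on V (\<lambda>x. snd (X (chart_inv c x)) c)" using sm by blast
    have Xi: "X (chart_inv c x) \<in> tangent_bundle A \<and> fst (X (chart_inv c x)) = chart_inv c x \<and> chart_inv c x \<in> fst c \<and> snd c (chart_inv c x) = x"
      if "x \<in> V" for x
    proof -
      have "x \<in> snd c ` (W \<inter> fst c)" using that V(3) by blast
      then obtain q where q': "x = snd c q" "q \<in> W \<inter> fst c" by blast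
      then have q: "q \<in> W" "q \<in> fst c" "x = snd c q" by simp_all
      then have "chart_inv c x = q" using chart_inv_snd[OF A charts_atD(1)[OF c]] by simp
      then show ?thesis using X[OF q(1)] q by (simp add: tangent_space_def)
    qed
    have "smooth_on V (\<lambda>x. (x, snd (X (chart_inv c x)) c))"
      by (intro smooth_on_Pair smooth_on_id V)
    then have "smooth_on V (snd (tangent_chart A c) \<circ> X \<circ> chart_inv c)"
      by (rule smooth_on_cong[OF V(1), rotated]) (use Xi in simp)
    moreover have "\<forall>x\<in>V. X (chart_inv c x) \<in> fst (tangent_chart A c)" using Xi by simp
    ultimately show "\<exists>c\<in>charts_at A p. \<exists>d\<in>tangent_atlas A. \<exists>V. open V \<and> snd c p \<in> V \<and> V \<subseteq> snd c ` (W \<inter> fst c) \<and>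
      (\<forall>x\<in>V. X (chart_inv c x) \<in> fst d) \<and> smooth_on V (snd d \<circ> X \<circ> chart_inv c)"
      using c V tangent_chart_in_atlas[OF charts_atD(1)[OF c]] by blast
  qed
  then show ?thesis using X by (simp add: vector_field_on_def)
qed

lemma vector_field_onE:
  assumes "vector_field_on A W X" "smooth_atlas A" "p \<in> W" "c \<in> charts_at A p"
  obtains V where "open V" "snd c p \<in> V" "V \<subseteq> snd c ` (W \<inter> fst c)" "smooth_on V (\<lambda>x. snd (X (chart_inv c x)) c)"
proof -
  have X: "X p \<in> tangent_bundle A" "fst (X p) = p"
    using assms(1,3) by (auto simp: vector_field_on_def tangent_space_def)
  have d: "tangent_chart A c \<in> charts_at (tangent_atlas A) (X p)"
    using charts_at_tangent_atlas[OF X(1)] X(2) assms(4) by simp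
  have "smooth_map_on A W (tangent_atlas A) X" using assms(1) by (simp add: vector_field_on_def)
  then obtain V where V: "open V" "snd c p \<in> V" "V \<subseteq> snd c ` (W \<inter> fst c)"
    "smooth_on V (snd (tangent_chart A c) \<circ> X \<circ> chart_inv c)"
    by (rule smooth_map_onE[of A W "tangent_atlas A" X p c "tangent_chart A c"])
      (use assms(2-4) smooth_atlas_tangent[OF assms(2)] d in blast)+
  have "smooth_on V (\<lambda>x. snd ((snd (tangent_chart A c) \<circ> X \<circ> chart_inv c) x))"
    by (rule smooth_on_linear_compose[OF V(1) bounded_linear_snd V(4)])
  then show thesis using that[OF V(1-3)] by simp
qed

section \<open>Integral curves and flows\<close>

definition field_coord :: "('m, 'e) chart \<Rightarrow> ('m \<Rightarrow> ('m, 'e) tvec) \<Rightarrow> 'e \<Rightarrow> 'e" where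
  "field_coord c X x = snd (X (chart_inv c x)) c"

lemma smooth_field_coord:
  assumes "smooth_atlas A" "vector_field A X" "c \<in> A"
  shows "smooth_on (chart_image c) (field_coord c X)"
proof (rule smooth_on_local)
  fix x assume x: "x \<in> chart_image c"
  have p: "c \<in> charts_at A (chart_inv c x)" by (rule chart_at_chart_inv[OF assms(3) x])
  then have "chart_inv c x \<in> points A" using points_iff[of "chart_inv c x" A] by blast
  from vector_field_onE[OF assms(2,1) this p] chart_inv_image(2)[OF x]
  show "\<exists>V. open V \<and> x \<in> V \<and> smooth_on V (field_coord c X)"
    unfolding field_coord_def by metis
qed

lemma vector_field_tangent:
  assumes "vector_field A X" "p \<in> points A"
  shows "X p \<in> tangent_bundle A" "fst (X p) = p"
  using assms by (auto simp: vector_field_on_def tangent_space_def)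

lemma vector_field_eq_chart_vec:
  assumes "smooth_atlas A" "vector_field A X" "c \<in> charts_at A p"
  shows "X p = chart_vec A c (snd c p) (field_coord c X (snd c p))"
proof -
  have p: "p \<in> points A" using points_iff[of p A] assms(3) by blast
  show ?thesis
    using tangent_vector_eq_chart_vec[OF assms(1) vector_field_tangent(1)[OF assms(2) p], of c]
      vector_field_tangent(2)[OF assms(2) p] assms(3) chart_inv_snd[OF assms(1) charts_atD[OF assms(3)]]
    by (simp add: field_coord_def)
qed

text \<open>The interface between curves on the manifold and the Euclidean theory of differential
  equations; being local, it is suited to shifting and gluing curves.\<close>

definition solves_in_chart :: "('m, 'e::euclidean_space) chart \<Rightarrow> ('m \<Rightarrow> ('m, 'e) tvec) \<Rightarrow> real set \<Rightarrow> (real \<Rightarrow> 'm) \<Rightarrow> bool" where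
  "solves_in_chart c X N \<gamma> \<longleftrightarrow> open N \<and>
    (\<forall>s\<in>N. \<gamma> s \<in> fst c \<and> ((snd c \<circ> \<gamma>) has_vector_derivative field_coord c X (snd c (\<gamma> s))) (at s))"

lemma solves_in_chart_cong:
  assumes "solves_in_chart c X N \<gamma>" "\<And>s. s \<in> N \<Longrightarrow> \<delta> s = \<gamma> s"
  shows "solves_in_chart c X N \<delta>"
  unfolding solves_in_chart_def
proof (intro conjI ballI)
  show N: "open N" using assms(1) by (simp add: solves_in_chart_def)
  fix s assume s: "s \<in> N"
  show "\<delta> s \<in> fst c" using assms s by (simp add: solves_in_chart_def)
  have "((snd c \<circ> \<gamma>) has_vector_derivative field_coord c X (snd c (\<gamma> s))) (at s)"
    using assms(1) s by (simp add: solves_in_chart_def)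
  then have "((snd c \<circ> \<delta>) has_vector_derivative field_coord c X (snd c (\<gamma> s))) (at s)"
    by (rule has_vector_derivative_transform_within_open[OF _ N s]) (simp add: assms(2))
  then show "((snd c \<circ> \<delta>) has_vector_derivative field_coord c X (snd c (\<delta> s))) (at s)"
    using assms(2)[OF s] by simp
qed

lemma integral_curve_solves_in_chart:
  assumes A: "smooth_atlas A" and X: "vector_field A X" and ic: "integral_curve A X I \<gamma>"
    and t: "t \<in> I" and c: "c \<in> charts_at A (\<gamma> t)"
  obtains N where "t \<in> N" "N \<subseteq> I" "solves_in_chart c X N \<gamma>"
proof -
  have sm: "smooth_map_on standard_atlas I A \<gamma>" and vel: "\<And>t. t \<in> I \<Longrightarrow> velocity A \<gamma> t = X (\<gamma> t)"
    using ic by (auto simp: integral_curve_def)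
  obtain N where N: "open N" "t \<in> N" "N \<subseteq> I" "\<And>s. s \<in> N \<Longrightarrow> \<gamma> s \<in> fst c" "smooth_on N (snd c \<circ> \<gamma>)"
    using smooth_curveE[OF sm A t c] by blast
  have "((snd c \<circ> \<gamma>) has_vector_derivative field_coord c X (snd c (\<gamma> s))) (at s)" if s: "s \<in> N" for s
  proof -
    let ?y = "vector_derivative (snd c \<circ> \<gamma>) (at s)"
    have d: "((snd c \<circ> \<gamma>) has_vector_derivative ?y) (at s)"
      using smooth_on_differentiable[OF N(5) s] vector_derivative_works by blast
    have ev: "\<forall>\<^sub>F r in nhds s. \<gamma> r \<in> fst c" using N(1,4) s unfolding eventually_nhds by blast
    have im: "snd c (\<gamma> s) \<in> chart_image c" using N(4)[OF s] by simp
    have "X (\<gamma> s) = chart_vec A c (snd c (\<gamma> s)) ?y"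
      using velocity_eq_chart_vec[OF A charts_atD(1)[OF c] ev d] vel[of s] N(3) s by auto
    then have "field_coord c X (snd c (\<gamma> s)) = ?y"
      using snd_chart_vec_same[OF A charts_atD(1)[OF c] im, of ?y] chart_inv_snd[OF A charts_atD(1)[OF c] N(4)[OF s]]
      by (simp add: field_coord_def)
    then show ?thesis using d by simp
  qed
  then have "solves_in_chart c X N \<gamma>" using N by (simp add: solves_in_chart_def)
  then show thesis using that N by blast
qed

lemma integral_curveI:
  assumes A: "smooth_atlas A" and X: "vector_field A X" and I: "open_interval I"
    and loc: "\<And>t. t \<in> I \<Longrightarrow> \<exists>c\<in>A. \<exists>N. t \<in> N \<and> N \<subseteq> I \<and> solves_in_chart c X N \<gamma>"
  shows "integral_curve A X I \<gamma>"
  unfolding integral_curve_def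
proof (intro conjI ballI I)
  show "smooth_map_on standard_atlas I A \<gamma>"
    unfolding smooth_curve_iff[OF A]
  proof
    fix t assume "t \<in> I"
    then obtain c N where c: "c \<in> A" and N: "t \<in> N" "N \<subseteq> I" "solves_in_chart c X N \<gamma>" using loc by blast
    have "smooth_on N (snd c \<circ> \<gamma>)"
      by (rule ode_solution_smooth[OF open_chart_image[OF A c] smooth_field_coord[OF A X c]])
        (use N(3) in \<open>auto simp: solves_in_chart_def\<close>)
    moreover have "open N" "\<gamma> ` N \<subseteq> fst c" using N(3) unfolding solves_in_chart_def by blast+
    ultimately show "\<exists>c\<in>A. \<exists>N. open N \<and> t \<in> N \<and> N \<subseteq> I \<and> \<gamma> ` N \<subseteq> fst c \<and> smooth_on N (snd c \<circ> \<gamma>)"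
      using c N by blast
  qed
  fix t assume "t \<in> I"
  then obtain c N where c: "c \<in> A" and N: "t \<in> N" "N \<subseteq> I" "solves_in_chart c X N \<gamma>" using loc by blast
  have "\<forall>\<^sub>F s in nhds t. \<gamma> s \<in> fst c" using N unfolding solves_in_chart_def eventually_nhds by blast
  moreover have "((snd c \<circ> \<gamma>) has_vector_derivative field_coord c X (snd c (\<gamma> t))) (at t)" "\<gamma> t \<in> fst c"
    using N by (auto simp: solves_in_chart_def)
  ultimately show "velocity A \<gamma> t = X (\<gamma> t)"
    using velocity_eq_chart_vec[OF A c] vector_field_eq_chart_vec[OF A X charts_atI[OF c]] by metis
qed

lemma smooth_curve_chart:
  assumes "smooth_atlas A" "smooth_map_on standard_atlas I A \<gamma>" "t \<in> I"
  obtains c where "c \<in> charts_at A (\<gamma> t)"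
  using assms(2,3) unfolding smooth_map_on_def by (metis charts_atI image_subset_iff)

lemma integral_curve_chart:
  assumes "smooth_atlas A" "integral_curve A X I \<gamma>" "t \<in> I"
  obtains c where "c \<in> charts_at A (\<gamma> t)"
  using smooth_curve_chart[OF assms(1) _ assms(3)] assms(2) unfolding integral_curve_def by blast

lemma smooth_curve_continuous:
  assumes A: "smooth_atlas A" and sm: "smooth_map_on standard_atlas I A \<gamma>" and t: "t \<in> I"
    and W: "openin (manifold_topology A) W" "\<gamma> t \<in> W"
  obtains N where "open N" "t \<in> N" "N \<subseteq> I" "\<And>s. s \<in> N \<Longrightarrow> \<gamma> s \<in> W"
proof -
  obtain c where c: "c \<in> charts_at A (\<gamma> t)" using smooth_curve_chart[OF A sm t] .
  obtain N where N: "open N" "t \<in> N" "N \<subseteq> I" "\<And>s. s \<in> N \<Longrightarrow> \<gamma> s \<in> fst c" "smooth_on N (snd c \<circ> \<gamma>)"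
    using smooth_curveE[OF sm A t c] by blast
  have oW: "open (snd c ` (W \<inter> fst c))"
    using W(1) charts_atD(1)[OF c] unfolding openin_manifold_topology[OF A] by blast
  let ?M = "N \<inter> (snd c \<circ> \<gamma>) -` (snd c ` (W \<inter> fst c))"
  have "open ?M"
    by (rule continuous_open_preimage[OF smooth_on_imp_continuous_on[OF N(5)] N(1) oW])
  moreover have "t \<in> ?M" using N(2) W(2) charts_atD(2)[OF c] by simp
  moreover have "\<gamma> s \<in> W" if "s \<in> ?M" for s
  proof -
    have "snd c (\<gamma> s) \<in> snd c ` (W \<inter> fst c)" using that by simp
    then obtain q where q: "snd c (\<gamma> s) = snd c q" "q \<in> W" "q \<in> fst c" by blast
    then have "\<gamma> s = q" using chart_inv_snd[OF A charts_atD(1)[OF c]] N(4)[of s] that by (metis IntD1)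
    then show ?thesis using q by simp
  qed
  ultimately show thesis using that[of ?M] N(3) by blast
qed

section \<open>Uniqueness of integral curves and the group property of the flow\<close>

text \<open>On the connected intersection of the intervals, the agreement set is open by uniqueness
  for differential equations and its complement is open by the Hausdorff property.\<close>

lemma integral_curve_unique:
  assumes A: "smooth_atlas A" and H: "Hausdorff_space (manifold_topology A)" and X: "vector_field A X"
    and g: "integral_curve A X I \<gamma>" and d: "integral_curve A X J \<delta>"
    and t0: "t0 \<in> I" "t0 \<in> J" "\<gamma> t0 = \<delta> t0" and t: "t \<in> I" "t \<in> J"
  shows "\<gamma> t = \<delta> t"
proof -
  have sg: "smooth_map_on standard_atlas I A \<gamma>" and sd: "smooth_map_on standard_atlas J A \<delta>"
    using g d by (simp_all add: integral_curve_def)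
  have cn: "connected (I \<inter> J)" and oIJ: "open (I \<inter> J)"
    using g d by (auto simp: integral_curve_def open_interval_def is_interval_Int is_interval_connected)
  have step: "\<exists>T. openin (top_of_set (I \<inter> J)) T \<and> s \<in> T \<and> (\<forall>x\<in>T. \<forall>y\<in>T. \<gamma> x = \<delta> x \<longrightarrow> \<gamma> y = \<delta> y)"
    if s: "s \<in> I \<inter> J" for s
  proof -
    have sI: "s \<in> I" "s \<in> J" using s by auto
    obtain c where c: "c \<in> charts_at A (\<gamma> s)" using smooth_curve_chart[OF A sg sI(1)] .
    obtain d' where d': "d' \<in> charts_at A (\<delta> s)" using smooth_curve_chart[OF A sd sI(2)] .
    have "\<exists>T. open T \<and> s \<in> T \<and> T \<subseteq> I \<inter> J \<and> (\<forall>x\<in>T. \<forall>y\<in>T. \<gamma> x = \<delta> x \<longrightarrow> \<gamma> y = \<delta> y)"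
    proof (cases "\<gamma> s = \<delta> s")
      case True
      obtain N where N: "s \<in> N" "N \<subseteq> I" "solves_in_chart c X N \<gamma>"
        using integral_curve_solves_in_chart[OF A X g sI(1) c] .
      obtain M where M: "s \<in> M" "M \<subseteq> J" "solves_in_chart c X M \<delta>"
        using integral_curve_solves_in_chart[OF A X d sI(2), of c] c True by metis
      note cA = charts_atD(1)[OF c]
      have oNM: "open (N \<inter> M)" using N(3) M(3) by (auto simp: solves_in_chart_def)
      have "\<exists>b>0. \<forall>r. \<bar>r - s\<bar> < b \<longrightarrow> (snd c \<circ> \<gamma>) r = (snd c \<circ> \<delta>) r"
      proof (rule ode_local_uniqueness[OF open_chart_image[OF A cA] smooth_field_coord[OF A X cA] oNM])
        show "s \<in> N \<inter> M" using N M by simp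
        show "(snd c \<circ> \<gamma>) r \<in> chart_image c \<and> (snd c \<circ> \<gamma> has_vector_derivative field_coord c X ((snd c \<circ> \<gamma>) r)) (at r)"
          "(snd c \<circ> \<delta>) r \<in> chart_image c \<and> (snd c \<circ> \<delta> has_vector_derivative field_coord c X ((snd c \<circ> \<delta>) r)) (at r)"
          if "r \<in> N \<inter> M" for r using N(3) M(3) that by (auto simp: solves_in_chart_def)
        show "(snd c \<circ> \<gamma>) s = (snd c \<circ> \<delta>) s" using True by simp
      qed
      then obtain b where b: "b > 0" "\<And>r. \<bar>r - s\<bar> < b \<Longrightarrow> snd c (\<gamma> r) = snd c (\<delta> r)" by auto
      have "\<gamma> r = \<delta> r" if "r \<in> N \<inter> M \<inter> ball s b" for r
      proof -
        have "\<gamma> r \<in> fst c" "\<delta> r \<in> fst c" using N(3) M(3) that by (auto simp: solves_in_chart_def)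
        moreover have "snd c (\<gamma> r) = snd c (\<delta> r)" using b(2)[of r] that by (simp add: dist_real_def abs_minus_commute)
        ultimately show ?thesis using chart_inv_snd[OF A cA] by metis
      qed
      then show ?thesis
        using oNM N M b(1) by (intro exI[of _ "N \<inter> M \<inter> ball s b"]) auto
    next
      case False
      have "\<gamma> s \<in> points A" using points_iff[of "\<gamma> s" A] c by blast
      moreover have "\<delta> s \<in> points A" using points_iff[of "\<delta> s" A] d' by blast
      ultimately obtain U V where UV: "openin (manifold_topology A) U" "openin (manifold_topology A) V"
        "\<gamma> s \<in> U" "\<delta> s \<in> V" "disjnt U V"
        using H False unfolding Hausdorff_space_def topspace_manifold_topology[OF A] by blast
      obtain N where N: "open N" "s \<in> N" "N \<subseteq> I" "\<And>r. r \<in> N \<Longrightarrow> \<gamma> r \<in> U"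
        using smooth_curve_continuous[OF A sg sI(1) UV(1,3)] by blast
      obtain M where M: "open M" "s \<in> M" "M \<subseteq> J" "\<And>r. r \<in> M \<Longrightarrow> \<delta> r \<in> V"
        using smooth_curve_continuous[OF A sd sI(2) UV(2,4)] by blast
      have "\<gamma> r \<noteq> \<delta> r" if "r \<in> N \<inter> M" for r
        using N(4)[of r] M(4)[of r] UV(5) that by (auto simp: disjnt_iff)
      then show ?thesis using N M by (intro exI[of _ "N \<inter> M"]) auto
    qed
    then obtain T where "open T" "s \<in> T" "T \<subseteq> I \<inter> J" "\<forall>x\<in>T. \<forall>y\<in>T. \<gamma> x = \<delta> x \<longrightarrow> \<gamma> y = \<delta> y" by blast
    then show ?thesis by (intro exI[of _ T]) (simp add: openin_open_eq[OF oIJ])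
  qed
  show ?thesis
    by (rule connected_induction_simple[OF cn _ _ t0(3) step]) (use t0 t in auto)
qed

text \<open>Uniqueness of integral curves makes the definite description in \<open>flow\<close>
  meaningful: any integral curve through the point computes it.\<close>

lemma flow_eq:
  assumes A: "smooth_atlas A" and H: "Hausdorff_space (manifold_topology A)" and X: "vector_field A X"
    and g: "integral_curve A X I \<gamma>" "0 \<in> I" "t \<in> I"
  shows "t \<in> flow_domain A X (\<gamma> 0)" "flow A X t (\<gamma> 0) = \<gamma> t"
proof -
  show "t \<in> flow_domain A X (\<gamma> 0)" using g by (auto simp: flow_domain_def)
  show "flow A X t (\<gamma> 0) = \<gamma> t" unfolding flow_def
  proof (rule the_equality)
    show "\<exists>I \<delta>. integral_curve A X I \<delta> \<and> 0 \<in> I \<and> \<delta> 0 = \<gamma> 0 \<and> t \<in> I \<and> \<delta> t = \<gamma> t" using g by blast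
  next
    fix q assume "\<exists>J \<delta>. integral_curve A X J \<delta> \<and> 0 \<in> J \<and> \<delta> 0 = \<gamma> 0 \<and> t \<in> J \<and> \<delta> t = q"
    then obtain J \<delta> where "integral_curve A X J \<delta>" "0 \<in> J" "\<delta> 0 = \<gamma> 0" "t \<in> J" "\<delta> t = q" by blast
    then show "q = \<gamma> t" using integral_curve_unique[OF A H X g(1), of J \<delta> 0 t] g(2,3) by simp
  qed
qed

lemma flow_domainE:
  assumes "t \<in> flow_domain A X p"
  obtains I \<gamma> where "integral_curve A X I \<gamma>" "0 \<in> I" "\<gamma> 0 = p" "t \<in> I"
  using assms by (auto simp: flow_domain_def)

lemma open_interval_shift:
  assumes "open_interval I"
  shows "open_interval {s. s - a \<in> I}"
proof -
  have eq: "{s. s - a \<in> I} = (\<lambda>x. a + x) ` I"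
    by (force simp: image_iff intro: bexI[of _ "_ - a"])
  have "open ((\<lambda>x. a + x) ` I)" using assms by (intro open_translation) (simp add: open_interval_def)
  moreover have "connected ((\<lambda>x. a + x) ` I)"
    using assms by (intro connected_continuous_image continuous_intros)
      (simp add: open_interval_def is_interval_connected)
  ultimately show ?thesis using assms by (simp add: eq open_interval_def is_interval_connected_1)
qed

lemma open_interval_Un:
  assumes "open_interval I" "open_interval J" "t \<in> I" "t \<in> J"
  shows "open_interval (I \<union> J)"
proof -
  have "connected (I \<union> J)"
    using assms by (intro connected_Un) (auto simp: open_interval_def is_interval_connected)
  then show ?thesis using assms by (auto simp: open_interval_def is_interval_connected_1)
qed

lemma integral_curve_shift:
  assumes A: "smooth_atlas A" and X: "vector_field A X" and g: "integral_curve A X I \<gamma>"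
  shows "integral_curve A X {s. s - a \<in> I} (\<lambda>s. \<gamma> (s - a))"
proof (rule integral_curveI[OF A X])
  show "open_interval {s. s - a \<in> I}" using g by (intro open_interval_shift) (simp add: integral_curve_def)
  fix t assume "t \<in> {s. s - a \<in> I}"
  then have t: "t - a \<in> I" by simp
  obtain c where c: "c \<in> charts_at A (\<gamma> (t - a))" using integral_curve_chart[OF A g t] .
  obtain N where N: "t - a \<in> N" "N \<subseteq> I" "solves_in_chart c X N \<gamma>"
    using integral_curve_solves_in_chart[OF A X g t c] .
  let ?M = "(\<lambda>s. s - a) -` N"
  have "solves_in_chart c X ?M (\<lambda>s. \<gamma> (s - a))"
    unfolding solves_in_chart_def
  proof (intro conjI ballI)
    show "open ?M" using N(3) by (intro open_vimage continuous_intros) (simp add: solves_in_chart_def)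
    fix s assume s: "s \<in> ?M"
    show "\<gamma> (s - a) \<in> fst c" using N(3) s by (simp add: solves_in_chart_def)
    have "(((snd c \<circ> \<gamma>) \<circ> (\<lambda>s. s - a)) has_vector_derivative 1 *\<^sub>R field_coord c X (snd c (\<gamma> (s - a)))) (at s)"
      using N(3) s by (intro vector_diff_chain_at) (auto intro!: derivative_eq_intros simp: solves_in_chart_def)
    then show "(snd c \<circ> (\<lambda>s. \<gamma> (s - a)) has_vector_derivative field_coord c X (snd c (\<gamma> (s - a)))) (at s)"
      by (simp add: o_def)
  qed
  then show "\<exists>c\<in>A. \<exists>N. t \<in> N \<and> N \<subseteq> {s. s - a \<in> I} \<and> solves_in_chart c X N (\<lambda>s. \<gamma> (s - a))"
    using charts_atD(1)[OF c] N(1,2) by (intro bexI[of _ c] exI[of _ ?M]) auto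
qed

lemma integral_curve_glue:
  assumes A: "smooth_atlas A" and H: "Hausdorff_space (manifold_topology A)" and X: "vector_field A X"
    and g: "integral_curve A X I \<gamma>" and d: "integral_curve A X J \<delta>"
    and t: "t \<in> I" "t \<in> J" "\<gamma> t = \<delta> t"
  shows "integral_curve A X (I \<union> J) (\<lambda>s. if s \<in> I then \<gamma> s else \<delta> s)"
proof (rule integral_curveI[OF A X])
  let ?z = "\<lambda>s. if s \<in> I then \<gamma> s else \<delta> s"
  show "open_interval (I \<union> J)"
    using g d t by (intro open_interval_Un[of I J t]) (simp_all add: integral_curve_def)
  have zJ: "?z s = \<delta> s" if "s \<in> J" for s
    using integral_curve_unique[OF A H X g d t, of s] that by simp
  fix s assume "s \<in> I \<union> J"
  then consider "s \<in> I" | "s \<in> J" by blast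
  then show "\<exists>c\<in>A. \<exists>N. s \<in> N \<and> N \<subseteq> I \<union> J \<and> solves_in_chart c X N ?z"
  proof cases
    case 1
    obtain c where c: "c \<in> charts_at A (\<gamma> s)" using integral_curve_chart[OF A g 1] .
    obtain N where N: "s \<in> N" "N \<subseteq> I" "solves_in_chart c X N \<gamma>"
      using integral_curve_solves_in_chart[OF A X g 1 c] .
    have "solves_in_chart c X N ?z" by (rule solves_in_chart_cong[OF N(3)]) (use N(2) in auto)
    then show ?thesis using N charts_atD(1)[OF c] by blast
  next
    case 2
    obtain c where c: "c \<in> charts_at A (\<delta> s)" using integral_curve_chart[OF A d 2] .
    obtain N where N: "s \<in> N" "N \<subseteq> J" "solves_in_chart c X N \<delta>"
      using integral_curve_solves_in_chart[OF A X d 2 c] .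
    have "solves_in_chart c X N ?z" by (rule solves_in_chart_cong[OF N(3)]) (use N(2) zJ in blast)
    then show ?thesis using N charts_atD(1)[OF c] by blast
  qed
qed

text \<open>An integral curve through the point reached at time \<open>t\<close>, shifted by
  \<open>t\<close>, is glued to the original one; this also shows that the time \<open>t + s\<close>
  is admissible.\<close>

lemma flow_add:
  assumes A: "smooth_atlas A" and H: "Hausdorff_space (manifold_topology A)" and X: "vector_field A X"
    and t: "t \<in> flow_domain A X p" and s: "s \<in> flow_domain A X (flow A X t p)"
  shows "t + s \<in> flow_domain A X p" "flow A X (t + s) p = flow A X s (flow A X t p)"
proof -
  obtain I \<gamma> where g: "integral_curve A X I \<gamma>" "0 \<in> I" "\<gamma> 0 = p" "t \<in> I" using flow_domainE[OF t] .
  have ft: "flow A X t p = \<gamma> t" using flow_eq(2)[OF A H X g(1,2,4)] g(3) by simp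
  obtain J \<delta> where d: "integral_curve A X J \<delta>" "0 \<in> J" "\<delta> 0 = \<gamma> t" "s \<in> J"
    using flow_domainE[OF s] unfolding ft .
  have fs: "flow A X s (flow A X t p) = \<delta> s" using flow_eq(2)[OF A H X d(1,2,4)] d(3) ft by simp
  let ?J = "{r. r - t \<in> J}" and ?d = "\<lambda>r. \<delta> (r - t)"
  have sh: "integral_curve A X ?J ?d" by (rule integral_curve_shift[OF A X d(1)])
  let ?z = "\<lambda>r. if r \<in> I then \<gamma> r else ?d r"
  have tt: "t \<in> ?J" "\<gamma> t = ?d t" using d(2,3) by auto
  have z: "integral_curve A X (I \<union> ?J) ?z" by (rule integral_curve_glue[OF A H X g(1) sh g(4) tt])
  have "?z (t + s) = \<delta> s"
    using integral_curve_unique[OF A H X g(1) sh g(4) tt, of "t + s"] d(4) by simp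
  then show "t + s \<in> flow_domain A X p" "flow A X (t + s) p = flow A X s (flow A X t p)"
    using flow_eq[OF A H X z, of "t + s"] g(2,3) d(4) fs by simp_all
qed

section \<open>The flow in a chart\<close>

text \<open>Collects the local flow \<open>u\<close>, its derivative \<open>w\<close> in the initial
  point and their identification with the flow on the manifold. One \<epsilon> serves all points of
  the ball, on which the arguments about pieces of curves rely.\<close>

definition chart_flow :: "('m, 'e::euclidean_space) atlas \<Rightarrow> ('m \<Rightarrow> ('m, 'e) tvec) \<Rightarrow> ('m, 'e) chart \<Rightarrow> 'm \<Rightarrow>
    real \<Rightarrow> real \<Rightarrow> (real \<Rightarrow> 'e \<Rightarrow> 'e) \<Rightarrow> (real \<Rightarrow> 'e \<Rightarrow> 'e \<Rightarrow> 'e) \<Rightarrow> bool" where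
  "chart_flow A X c p \<epsilon> \<delta> u w \<longleftrightarrow> \<epsilon> > 0 \<and> \<delta> > 0 \<and> ball (snd c p) \<delta> \<subseteq> chart_image c \<and>
    (\<forall>x\<in>ball (snd c p) \<delta>. u 0 x = x \<and> (\<forall>h. w 0 x h = h) \<and>
      (\<forall>t. \<bar>t\<bar> < \<epsilon> \<longrightarrow> u t x \<in> chart_image c \<and>
        ((\<lambda>t. u t x) has_vector_derivative field_coord c X (u t x)) (at t) \<and>
        (u t has_derivative w t x) (at x) \<and>
        (\<forall>h. ((\<lambda>t. w t x h) has_vector_derivative frechet_derivative (field_coord c X) (at (u t x)) (w t x h)) (at t) \<and>
          norm (w t x h - h) \<le> norm h / 2) \<and>
        t \<in> flow_domain A X (chart_inv c x) \<and> flow A X t (chart_inv c x) = chart_inv c (u t x)))"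

lemma chart_flowD:
  assumes "chart_flow A X c p \<epsilon> \<delta> u w"
  shows "\<epsilon> > 0" "\<delta> > 0" "ball (snd c p) \<delta> \<subseteq> chart_image c"
    "\<And>x. x \<in> ball (snd c p) \<delta> \<Longrightarrow> u 0 x = x"
    "\<And>x h. x \<in> ball (snd c p) \<delta> \<Longrightarrow> w 0 x h = h"
    "\<And>x t. x \<in> ball (snd c p) \<delta> \<Longrightarrow> \<bar>t\<bar> < \<epsilon> \<Longrightarrow> u t x \<in> chart_image c"
    "\<And>x t. x \<in> ball (snd c p) \<delta> \<Longrightarrow> \<bar>t\<bar> < \<epsilon> \<Longrightarrow>
       ((\<lambda>t. u t x) has_vector_derivative field_coord c X (u t x)) (at t)"
    "\<And>x t. x \<in> ball (snd c p) \<delta> \<Longrightarrow> \<bar>t\<bar> < \<epsilon> \<Longrightarrow> (u t has_derivative w t x) (at x)"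
    "\<And>x t h. x \<in> ball (snd c p) \<delta> \<Longrightarrow> \<bar>t\<bar> < \<epsilon> \<Longrightarrow>
       ((\<lambda>t. w t x h) has_vector_derivative frechet_derivative (field_coord c X) (at (u t x)) (w t x h)) (at t)"
    "\<And>x t h. x \<in> ball (snd c p) \<delta> \<Longrightarrow> \<bar>t\<bar> < \<epsilon> \<Longrightarrow> norm (w t x h - h) \<le> norm h / 2"
    "\<And>x t. x \<in> ball (snd c p) \<delta> \<Longrightarrow> \<bar>t\<bar> < \<epsilon> \<Longrightarrow> t \<in> flow_domain A X (chart_inv c x)"
    "\<And>x t. x \<in> ball (snd c p) \<delta> \<Longrightarrow> \<bar>t\<bar> < \<epsilon> \<Longrightarrow> flow A X t (chart_inv c x) = chart_inv c (u t x)"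
  using assms unfolding chart_flow_def by blast+

theorem chart_flow_exists:
  assumes A: "smooth_atlas A" and H: "Hausdorff_space (manifold_topology A)" and X: "vector_field A X"
    and c: "c \<in> charts_at A p"
  shows "\<exists>\<epsilon> \<delta> u w. chart_flow A X c p \<epsilon> \<delta> u w"
proof -
  note cA = charts_atD(1)[OF c]
  have x0: "snd c p \<in> chart_image c" using charts_atD(2)[OF c] by simp
  show ?thesis
  proof (rule local_flow_exists[OF open_chart_image[OF A cA] smooth_field_coord[OF A X cA] x0])
    fix \<epsilon> \<delta> u w
    assume *: "\<epsilon> > 0" "\<delta> > 0" "ball (snd c p) \<delta> \<subseteq> chart_image c"
      "\<And>x. x \<in> ball (snd c p) \<delta> \<Longrightarrow> u 0 x = x"
      "\<And>x h. x \<in> ball (snd c p) \<delta> \<Longrightarrow> w 0 x h = h"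
      "\<And>x t. x \<in> ball (snd c p) \<delta> \<Longrightarrow> \<bar>t\<bar> < \<epsilon> \<Longrightarrow> u t x \<in> chart_image c"
      "\<And>x t. x \<in> ball (snd c p) \<delta> \<Longrightarrow> \<bar>t\<bar> < \<epsilon> \<Longrightarrow>
         ((\<lambda>t. u t x) has_vector_derivative field_coord c X (u t x)) (at t)"
      "\<And>x t. x \<in> ball (snd c p) \<delta> \<Longrightarrow> \<bar>t\<bar> < \<epsilon> \<Longrightarrow> (u t has_derivative w t x) (at x)"
      "\<And>x t h. x \<in> ball (snd c p) \<delta> \<Longrightarrow> \<bar>t\<bar> < \<epsilon> \<Longrightarrow>
         ((\<lambda>t. w t x h) has_vector_derivative frechet_derivative (field_coord c X) (at (u t x)) (w t x h)) (at t)"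
      "\<And>x t h. x \<in> ball (snd c p) \<delta> \<Longrightarrow> \<bar>t\<bar> < \<epsilon> \<Longrightarrow> norm (w t x h - h) \<le> norm h / 2"
    have fl: "t \<in> flow_domain A X (chart_inv c x) \<and> flow A X t (chart_inv c x) = chart_inv c (u t x)"
      if x: "x \<in> ball (snd c p) \<delta>" and t: "\<bar>t\<bar> < \<epsilon>" for x t
    proof -
      let ?I = "{-\<epsilon><..<\<epsilon>}" and ?g = "\<lambda>t. chart_inv c (u t x)"
      have ab: "\<bar>s\<bar> < \<epsilon>" if "s \<in> ?I" for s using that by auto
      have gi: "snd c (?g s) = u s x" "?g s \<in> fst c" if "s \<in> ?I" for s
        using chart_inv_image[OF *(6)[OF x ab[OF that]]] by simp_all
      have "solves_in_chart c X ?I ?g"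
        unfolding solves_in_chart_def
      proof (intro conjI ballI)
        fix s assume s: "s \<in> ?I"
        show "?g s \<in> fst c" by (rule gi(2)[OF s])
        have "((\<lambda>t. u t x) has_vector_derivative field_coord c X (u s x)) (at s)" by (rule *(7)[OF x ab[OF s]])
        then have "((snd c \<circ> ?g) has_vector_derivative field_coord c X (u s x)) (at s)"
          by (rule has_vector_derivative_transform_within_open[OF _ open_greaterThanLessThan s]) (use gi(1) in simp)
        then show "((snd c \<circ> ?g) has_vector_derivative field_coord c X (snd c (?g s))) (at s)"
          using gi(1)[OF s] by simp
      qed simp
      moreover have "open_interval ?I" using *(1) by (auto simp: open_interval_def is_interval_oo)
      ultimately have "integral_curve A X ?I ?g"
        using cA by (intro integral_curveI[OF A X]) blast+
      moreover have "0 \<in> ?I" "t \<in> ?I" using *(1) t by (auto simp: abs_less_iff)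
      ultimately show ?thesis using flow_eq[OF A H X, of ?I ?g t] *(4)[OF x] by simp
    qed
    have "chart_flow A X c p \<epsilon> \<delta> u w"
      unfolding chart_flow_def
      by (intro conjI ballI allI impI) (rule * | use fl in blast)+
    then show "\<exists>\<epsilon> \<delta> u w. chart_flow A X c p \<epsilon> \<delta> u w" by blast
  qed
qed

lemma flow_zero:
  assumes A: "smooth_atlas A" and H: "Hausdorff_space (manifold_topology A)" and X: "vector_field A X"
    and p: "p \<in> points A"
  shows "0 \<in> flow_domain A X p" "flow A X 0 p = p"
proof -
  obtain c where c: "c \<in> charts_at A p" using p points_iff[of p A] by blast
  have ci: "chart_inv c (snd c p) = p" by (rule chart_inv_snd[OF A charts_atD[OF c]])
  obtain \<epsilon> \<delta> u w where "chart_flow A X c p \<epsilon> \<delta> u w" using chart_flow_exists[OF A H X c] by blast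
  note * = chart_flowD[OF this]
  have x: "snd c p \<in> ball (snd c p) \<delta>" using *(2) by simp
  show "0 \<in> flow_domain A X p" "flow A X 0 p = p"
    using *(11)[OF x, of 0] *(12)[OF x, of 0] *(1) *(4)[OF x] ci by simp_all
qed

lemma tangent_map_local_flow:
  assumes A: "smooth_atlas A" and c: "c \<in> A" and v: "v \<in> tangent_bundle A" "fst v \<in> fst c"
    and V: "open V" "snd c (fst v) \<in> V" "V \<subseteq> chart_image c"
    and f: "\<And>x. x \<in> V \<Longrightarrow> f (chart_inv c x) = chart_inv c (u x)" "\<And>x. x \<in> V \<Longrightarrow> u x \<in> chart_image c"
    and d: "(u has_derivative L) (at (snd c (fst v)))"
  shows "tangent_map A A f v = chart_vec A c (u (snd c (fst v))) (L (snd v c))"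
proof -
  have fv: "f (fst v) = chart_inv c (u (snd c (fst v)))"
    using f(1)[OF V(2)] chart_inv_snd[OF A c v(2)] by simp
  have "tangent_map A A f v = chart_vec A c (snd c (f (fst v))) (L (snd v c))"
  proof (rule tangent_map_eq[OF A A v(1) charts_atI[OF c v(2)] c])
    show "\<forall>\<^sub>F x in nhds (snd c (fst v)). f (chart_inv c x) \<in> fst c"
      unfolding eventually_nhds using V f chart_inv_image(1) by metis
    show "(snd c \<circ> f \<circ> chart_inv c has_derivative L) (at (snd c (fst v)))"
      by (rule has_derivative_transform_within_open[OF d V(1,2)]) (simp add: f chart_inv_image(2))
  qed
  then show ?thesis using fv chart_inv_image(2)[OF f(2)[OF V(2)]] by simp
qed

section \<open>Lifts in coordinates\<close>

lemma velocity_of_chart_vec: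
  assumes A: "smooth_atlas A" and c: "c \<in> A" and ab: "open N" "t \<in> N"
    "\<And>s. s \<in> N \<Longrightarrow> a s \<in> chart_image c" "\<And>s. s \<in> N \<Longrightarrow> \<gamma> s = chart_vec A c (a s) (b s)"
    and d: "(a has_vector_derivative a') (at t)" "(b has_vector_derivative b') (at t)"
  shows "velocity (tangent_atlas A) \<gamma> t
    = chart_vec (tangent_atlas A) (tangent_chart A c) (a t, b t) (a', b')"
proof -
  let ?C = "tangent_chart A c"
  have g: "\<gamma> s \<in> fst ?C" "snd ?C (\<gamma> s) = (a s, b s)" if "s \<in> N" for s
    using chart_vec_in_tangent_bundle[OF A c ab(3)[OF that], of "b s"] snd_chart_vec_same[OF A c ab(3)[OF that], of "b s"]
      chart_inv_image[OF ab(3)[OF that]] ab(4)[OF that] by simp_all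
  have "((\<lambda>s. (a s, b s)) has_vector_derivative (a', b')) (at t)"
    by (rule has_vector_derivative_Pair[OF d])
  then have "((snd ?C \<circ> \<gamma>) has_vector_derivative (a', b')) (at t)"
    by (rule has_vector_derivative_transform_within_open[OF _ ab(1,2)]) (use g(2) in simp)
  moreover have "\<forall>\<^sub>F s in nhds t. \<gamma> s \<in> fst ?C" using g(1) ab(1,2) unfolding eventually_nhds by blast
  ultimately show ?thesis
    using velocity_eq_chart_vec[OF smooth_atlas_tangent[OF A] tangent_chart_in_atlas[OF c], of \<gamma> t "(a', b')"]
      g(2)[OF ab(2)] by simp
qed

text \<open>The curve v + t X has constant base point and is affine in the fibre.\<close>

lemma vertical_lift_eq:
  assumes A: "smooth_atlas A" and X: "vector_field A X" and v: "v \<in> tangent_bundle A" and c: "c \<in> charts_at A (fst v)"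
  shows "vertical_lift A X v = chart_vec (tangent_atlas A) (tangent_chart A c) (snd c (fst v), snd v c)
     (0, field_coord c X (snd c (fst v)))"
proof -
  let ?x = "snd c (fst v)" and ?X = "field_coord c X (snd c (fst v))"
  have p: "fst v \<in> points A" using v by (simp add: tangent_bundle_iff)
  note Xp = vector_field_tangent[OF X p]
  have cX: "snd (X (fst v)) c = ?X" using chart_inv_snd[OF A charts_atD[OF c]] by (simp add: field_coord_def)
  have g: "tadd v (tscale t (X (fst v))) = chart_vec A c ?x (snd v c + t *\<^sub>R ?X)" for t
  proof -
    have "tscale t (X (fst v)) \<in> tangent_bundle A"
      by (rule linear_combination_in_tangent_bundle(2)[OF A Xp(1) Xp(1)]) simp
    then have b: "tadd v (tscale t (X (fst v))) \<in> tangent_bundle A"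
      by (rule linear_combination_in_tangent_bundle(1)[OF A v]) (simp add: tscale_def Xp(2))
    from tangent_vector_eq_chart_vec[OF A b, of c] c show ?thesis by (simp add: tadd_def tscale_def cX)
  qed
  have im: "?x \<in> chart_image c" using charts_atD(2)[OF c] by simp
  have db: "((\<lambda>t. snd v c + t *\<^sub>R ?X) has_vector_derivative ?X) (at 0)"
    by (auto intro!: derivative_eq_intros simp: has_vector_derivative_def)
  show ?thesis
    unfolding vertical_lift_def
    using velocity_of_chart_vec[OF A charts_atD(1)[OF c] open_UNIV UNIV_I, of "\<lambda>_. ?x" _ "\<lambda>t. snd v c + t *\<^sub>R ?X" 0 0 ?X]
      g im db by simp
qed

text \<open>The fibre component of the curve is \<open>w t x y\<close>, whose time derivative at 0
  is given by the linearised equation.\<close>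

lemma complete_lift_eq:
  assumes A: "smooth_atlas A" and H: "Hausdorff_space (manifold_topology A)" and X: "vector_field A X"
    and v: "v \<in> tangent_bundle A" and c: "c \<in> charts_at A (fst v)"
  shows "complete_lift A X v = chart_vec (tangent_atlas A) (tangent_chart A c) (snd c (fst v), snd v c)
     (field_coord c X (snd c (fst v)), frechet_derivative (field_coord c X) (at (snd c (fst v))) (snd v c))"
proof -
  let ?x = "snd c (fst v)" and ?y = "snd v c"
  note cA = charts_atD(1)[OF c]
  obtain \<epsilon> \<delta> u w where "chart_flow A X c (fst v) \<epsilon> \<delta> u w" using chart_flow_exists[OF A H X c] by blast
  note * = chart_flowD[OF this]
  have x: "?x \<in> ball ?x \<delta>" using *(2) by simp
  have z: "\<bar>0::real\<bar> < \<epsilon>" using *(1) by simp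
  have tm: "tangent_map A A (flow A X t) v = chart_vec A c (u t ?x) (w t ?x ?y)" if t: "\<bar>t\<bar> < \<epsilon>" for t
    by (rule tangent_map_local_flow[OF A cA v charts_atD(2)[OF c] open_ball x *(3)])
      (use *(6)[OF _ t] *(8)[OF x t] *(12)[OF _ t] in blast)+
  have "velocity (tangent_atlas A) (\<lambda>t. tangent_map A A (flow A X t) v) 0
    = chart_vec (tangent_atlas A) (tangent_chart A c) (u 0 ?x, w 0 ?x ?y)
       (field_coord c X (u 0 ?x), frechet_derivative (field_coord c X) (at (u 0 ?x)) (w 0 ?x ?y))"
    by (rule velocity_of_chart_vec[OF A cA open_ball[of 0 \<epsilon>] _ _ _ *(7)[OF x z] *(9)[OF x z]])
      (use *(1) *(6)[OF x] tm in \<open>simp_all add: dist_real_def\<close>)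
  then show ?thesis unfolding complete_lift_def by (simp add: *(4)[OF x] *(5)[OF x])
qed

section \<open>Global vector fields with prescribed value\<close>

lemma continuous_map_chart_inv:
  assumes A: "smooth_atlas A" and c: "c \<in> A"
  shows "continuous_map (top_of_set (chart_image c)) (manifold_topology A) (chart_inv c)"
  unfolding continuous_map_def
proof (intro conjI allI impI)
  show "chart_inv c \<in> topspace (top_of_set (chart_image c)) \<rightarrow> topspace (manifold_topology A)"
    using chart_inv_image(1)[of _ c] c by (auto simp: topspace_manifold_topology[OF A] points_def)
  fix W assume "openin (manifold_topology A) W"
  then have oW: "open (snd c ` (W \<inter> fst c))" using c unfolding openin_manifold_topology[OF A] by blast
  have "{x \<in> topspace (top_of_set (chart_image c)). chart_inv c x \<in> W} = snd c ` (W \<inter> fst c)"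
  proof (intro set_eqI iffI)
    fix x assume "x \<in> {x \<in> topspace (top_of_set (chart_image c)). chart_inv c x \<in> W}"
    then have x: "x \<in> chart_image c" "chart_inv c x \<in> W" by simp_all
    show "x \<in> snd c ` (W \<inter> fst c)"
      by (rule image_eqI[of _ _ "chart_inv c x"]) (use chart_inv_image[OF x(1)] x(2) in simp_all)
  next
    fix x assume "x \<in> snd c ` (W \<inter> fst c)"
    then obtain q where "x = snd c q" "q \<in> W" "q \<in> fst c" by blast
    then show "x \<in> {x \<in> topspace (top_of_set (chart_image c)). chart_inv c x \<in> W}"
      using chart_inv_snd[OF A c] by simp
  qed
  then show "openin (top_of_set (chart_image c)) {x \<in> topspace (top_of_set (chart_image c)). chart_inv c x \<in> W}"
    using oW open_subset[of "snd c ` (W \<inter> fst c)" "chart_image c"] by auto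
qed

lemma snd_chart_vec_zero:
  assumes A: "smooth_atlas A" and c: "c \<in> charts_at A p" and d: "d \<in> charts_at A p"
  shows "snd (chart_vec A c (snd c p) 0) d = 0"
proof -
  have "linear (frechet_derivative (transition c d) (at (snd c p)))"
    using transition_has_derivative[OF A c d] has_derivative_linear by blast
  then show ?thesis
    using snd_chart_vec[of d A c "snd c p" 0] d chart_inv_snd[OF A charts_atD[OF c]] linear_0 by metis
qed

text \<open>A constant field times a bump function in the chart, extended by zero. Smoothness at
  points outside the chart rests on the image \<open>K\<close> of a closed ball being compact, hence
  closed by the Hausdorff property: the field vanishes off \<open>K\<close>.\<close>

lemma exists_vector_field:
  assumes A: "smooth_atlas A" and H: "Hausdorff_space (manifold_topology A)"
    and c: "c \<in> charts_at A p"
  obtains X where "vector_field A X" "field_coord c X (snd c p) = a"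
proof -
  note cA = charts_atD(1)[OF c]
  let ?x0 = "snd c p"
  have "?x0 \<in> chart_image c" using charts_atD(2)[OF c] by simp
  then obtain r where r: "r > 0" "cball ?x0 r \<subseteq> chart_image c"
    using open_chart_image[OF A cA] open_contains_cball by blast
  \<comment> \<open>Divided by the value at the centre, so that the field takes the value
    \<open>a\<close> there.\<close>
  define \<psi> where "\<psi> x = (bump ?x0 r x / bump ?x0 r ?x0) *\<^sub>R a" for x
  define X where "X q = (if q \<in> fst c then chart_vec A c (snd c q) (\<psi> (snd c q)) else tzero q)" for q
  have sm: "smooth_on V \<psi>" if "open V" for V
    unfolding \<psi>_def
    by (intro smooth_on_scaleR[OF that] smooth_on_const
        smooth_on_linear_compose[OF that bounded_linear_divide] smooth_on_subset[OF smooth_on_bump]) simp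
  have Xc: "field_coord c X x = \<psi> x" if "x \<in> chart_image c" for x
    using chart_inv_image[OF that] snd_chart_vec_same[OF A cA that] by (simp add: field_coord_def X_def)
  define K where "K = chart_inv c ` cball ?x0 r"
  have "compactin (top_of_set (chart_image c)) (cball ?x0 r)"
    using r(2) by (simp add: compactin_subtopology)
  then have "compactin (manifold_topology A) K"
    unfolding K_def by (rule image_compactin[OF _ continuous_map_chart_inv[OF A cA]])
  then have "closedin (manifold_topology A) K" by (rule compactin_imp_closedin[OF H])
  \<comment> \<open>An open set on which the field vanishes; together with the chart domain it
    covers the manifold.\<close>
  then have oK: "openin (manifold_topology A) (points A - K)"
    using topspace_manifold_topology[OF A] by (simp add: closedin_def)
  have "vector_field A X"
  proof (rule vector_field_onI[OF A])
    fix q assume q: "q \<in> points A"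
    show "X q \<in> tangent_space A q"
    proof (cases "q \<in> fst c")
      case True
      then show ?thesis
        using chart_vec_in_tangent_bundle[OF A cA, of "snd c q"] chart_inv_snd[OF A cA True]
        by (simp add: X_def tangent_space_def)
    next
      case False
      then show ?thesis using tzero_in_tangent_bundle[OF A q] by (simp add: X_def tangent_space_def tzero_def)
    qed
    show "\<exists>d\<in>charts_at A q. \<exists>V. open V \<and> snd d q \<in> V \<and> V \<subseteq> snd d ` (points A \<inter> fst d) \<and>
      smooth_on V (\<lambda>x. snd (X (chart_inv d x)) d)"
    proof (cases "q \<in> fst c")
      case True
      have "smooth_on (chart_image c) (\<lambda>x. snd (X (chart_inv c x)) c)"
        by (rule smooth_on_cong[OF open_chart_image[OF A cA] _ sm[OF open_chart_image[OF A cA]]])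
          (use Xc in \<open>simp add: field_coord_def\<close>)
      moreover have "points A \<inter> fst c = fst c" using cA unfolding points_def by blast
      ultimately show ?thesis
        using open_chart_image[OF A cA] True charts_atI[OF cA True] by (intro bexI[of _ c] exI[of _ "chart_image c"]) auto
    next
      case False
      obtain d where d: "d \<in> charts_at A q" using q points_iff[of q A] by blast
      note dA = charts_atD(1)[OF d]
      let ?V = "snd d ` ((points A - K) \<inter> fst d)"
      have oV: "open ?V" using oK dA unfolding openin_manifold_topology[OF A] by blast
      have "K \<subseteq> fst c" using r(2) chart_inv_image(1)[of _ c] unfolding K_def by blast
      then have qV: "snd d q \<in> ?V" using False q charts_atD(2)[OF d] by blast
      have "snd (X (chart_inv d x)) d = 0" if "x \<in> ?V" for x
      proof -
        from that obtain q' where q': "x = snd d q'" "q' \<in> points A" "q' \<notin> K" "q' \<in> fst d" by blast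
        have dx: "chart_inv d x = q'" using chart_inv_snd[OF A dA q'(4)] q'(1) by simp
        show ?thesis
        proof (cases "q' \<in> fst c")
          case True
          have "snd c q' \<notin> cball ?x0 r"
            using q'(3) chart_inv_snd[OF A cA True] unfolding K_def by (metis imageI)
          then have "\<psi> (snd c q') = 0" using bump_outside[OF r(1), of "snd c q'" ?x0] by (simp add: \<psi>_def)
          then show ?thesis
            using snd_chart_vec_zero[OF A charts_atI[OF cA True] charts_atI[OF dA q'(4)]] True dx by (simp add: X_def)
        next
          case False
          then show ?thesis by (simp add: X_def dx tzero_def)
        qed
      qed
      then have "smooth_on ?V (\<lambda>x. snd (X (chart_inv d x)) d)"
        by (intro smooth_on_cong[OF oV _ smooth_on_const[of _ 0]]) simp
      then show ?thesis using oV qV d by (intro bexI[of _ d] exI[of _ ?V]) auto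
    qed
  qed
  moreover have "field_coord c X ?x0 = a"
    using Xc[of ?x0] charts_atD(2)[OF c] bump_centre[OF r(1), of ?x0] by (simp add: \<psi>_def)
  ultimately show thesis using that by blast
qed

section \<open>The canonical spray of a Finsler manifold\<close>

locale finsler_manifold =
  fixes A :: "('m, 'e::euclidean_space) atlas" and F :: "('m, 'e) tvec \<Rightarrow> real"
  assumes manifold: "smooth_manifold A" and finsler: "finsler_function A F"
begin

abbreviation TA where "TA \<equiv> tangent_atlas A"

definition Ec :: "('m, 'e) chart \<Rightarrow> 'e \<times> 'e \<Rightarrow> real" where
  "Ec c z = energy F (chart_vec A c (fst z) (snd z))"

lemma atlas: "smooth_atlas A" and Hausdorff: "Hausdorff_space (manifold_topology A)"
  using manifold by (simp_all add: smooth_manifold_def)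

lemma atlas_TA: "smooth_atlas TA"
  by (rule smooth_atlas_tangent[OF atlas])

lemma F_homogeneous: "v \<in> tangent_bundle A \<Longrightarrow> r > 0 \<Longrightarrow> F (tscale r v) = r * F v"
  using finsler by (simp add: finsler_function_def)

lemma F_positive: "v \<in> slit_bundle A \<Longrightarrow> F v > 0"
  using finsler by (simp add: finsler_function_def)

text \<open>Homogeneity with factor 2 gives F(0) = 2 F(0).\<close>

lemma F_zero: "p \<in> points A \<Longrightarrow> F (tzero p) = 0"
  using F_homogeneous[OF tzero_in_tangent_bundle[OF atlas], of p 2] by (simp add: tscale_def tzero_def)

lemma F_nonneg: "v \<in> tangent_bundle A \<Longrightarrow> F v \<ge> 0"
proof (cases "v \<in> slit_bundle A")
  case True
  then show ?thesis using F_positive[of v] by simp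
next
  case False
  assume v: "v \<in> tangent_bundle A"
  then have "v = tzero (fst v)" using False unfolding slit_bundle_def by blast
  then have "F v = F (tzero (fst v))" by (rule arg_cong)
  moreover have "F (tzero (fst v)) = 0" using v by (intro F_zero) (simp add: tangent_bundle_iff)
  ultimately show ?thesis by linarith
qed

lemma chart_vec_add_scale:
  assumes c: "c \<in> A" and x: "x \<in> chart_image c"
  shows "tadd (chart_vec A c x y) (tscale r (chart_vec A c x a)) = chart_vec A c x (y + r *\<^sub>R a)"
    "tscale r (chart_vec A c x y) = chart_vec A c x (r *\<^sub>R y)"
proof -
  note ct = chart_at_chart_inv[OF c x]
  note cv = chart_vec_in_tangent_bundle[OF atlas c x] and sv = snd_chart_vec_same[OF atlas c x]
  have ts: "tscale r (chart_vec A c x b) \<in> tangent_bundle A" for b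
    by (rule linear_combination_in_tangent_bundle(2)[OF atlas cv cv]) simp
  show "tscale r (chart_vec A c x y) = chart_vec A c x (r *\<^sub>R y)"
    by (rule tangent_vector_eqI[OF ts cv, of _ _ c]) (use ct sv in \<open>simp_all add: tscale_def\<close>)
  have "tadd (chart_vec A c x y) (tscale r (chart_vec A c x a)) \<in> tangent_bundle A"
    by (rule linear_combination_in_tangent_bundle(1)[OF atlas cv ts]) (simp add: tscale_def)
  then show "tadd (chart_vec A c x y) (tscale r (chart_vec A c x a)) = chart_vec A c x (y + r *\<^sub>R a)"
    by (rule tangent_vector_eqI[OF _ cv, of _ _ c]) (use ct sv in \<open>simp_all add: tscale_def tadd_def\<close>)
qed

lemma chart_vec_slit_iff:
  assumes c: "c \<in> A" and x: "x \<in> chart_image c"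
  shows "chart_vec A c x y \<in> slit_bundle A \<longleftrightarrow> y \<noteq> 0"
  using slit_bundle_iff[OF atlas chart_vec_in_tangent_bundle[OF atlas c x], of c y]
    chart_at_chart_inv[OF c x] snd_chart_vec_same[OF atlas c x] by simp

lemma smooth_Ec:
  assumes c: "c \<in> A"
  shows "smooth_on (chart_image c \<times> (- {0})) (Ec c)"
proof (rule smooth_on_local)
  fix z assume "z \<in> chart_image c \<times> (- {0::'e})"
  then obtain x y where z: "z = (x, y)" "x \<in> chart_image c" "y \<noteq> 0" by blast
  let ?v = "chart_vec A c x y" and ?C = "tangent_chart A c"
  have v: "?v \<in> slit_bundle A" using chart_vec_slit_iff[OF c z(2)] z(3) by blast
  note vb = slit_bundle_subset[OF v]
  have C: "?C \<in> charts_at TA ?v"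
    using charts_at_tangent_atlas[OF vb] chart_at_chart_inv[OF c z(2)] by simp
  have sz: "snd ?C ?v = z" using snd_chart_vec_same[OF atlas c z(2)] chart_inv_image(2)[OF z(2)] z(1) by simp
  have "smooth_map_on TA (slit_bundle A) standard_atlas F" using finsler by (simp add: finsler_function_def)
  then obtain V where V: "open V" "z \<in> V" "V \<subseteq> snd ?C ` (slit_bundle A \<inter> fst ?C)"
    "smooth_on V (F \<circ> chart_inv ?C)"
    using smooth_map_onE[OF _ atlas_TA smooth_atlas_standard v C, of F "(UNIV, id)"] sz
    by (auto simp: charts_at_standard)
  have "smooth_on V (\<lambda>z. (F \<circ> chart_inv ?C) z * (F \<circ> chart_inv ?C) z)"
    by (rule smooth_on_bilinear[OF V(1) bounded_bilinear_mult V(4) V(4)])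
  then have "smooth_on V (\<lambda>z. (F \<circ> chart_inv ?C) z * (F \<circ> chart_inv ?C) z / 2)"
    by (rule smooth_on_linear_compose[OF V(1) bounded_linear_divide])
  then have "smooth_on V (Ec c)"
  proof (rule smooth_on_cong[OF V(1), rotated])
    fix z' assume "z' \<in> V"
    then have "z' \<in> chart_image ?C" using V(3) by blast
    then have "fst z' \<in> chart_image c" unfolding tangent_chart_image[OF atlas c] by auto
    then show "(F \<circ> chart_inv ?C) z' * (F \<circ> chart_inv ?C) z' / 2 = Ec c z'"
      using chart_inv_tangent_chart[OF atlas c, of "fst z'" "snd z'"]
      by (simp add: Ec_def energy_def power2_eq_square)
  qed
  then show "\<exists>V. open V \<and> z \<in> V \<and> smooth_on V (Ec c)" using V by blast
qed

text \<open>The inner derivative in \<open>fibre_second_deriv\<close> is the one along its last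
  argument, hence \<open>b\<close> is the direction that is differentiated first.\<close>

lemma fibre_second_deriv_eq:
  assumes c: "c \<in> A" and x: "x \<in> chart_image c" and y: "y \<noteq> 0"
  shows "fibre_second_deriv (energy F) (chart_vec A c x y) (chart_vec A c x a) (chart_vec A c x b)
    = frechet_derivative (\<lambda>z. frechet_derivative (Ec c) (at z) (0, b)) (at (x, y)) (0, a)"
proof -
  note smE = smooth_Ec[OF c]
  let ?Z = "chart_image c \<times> (- {0::'e})"
  have e: "energy F (tadd (tadd (chart_vec A c x y) (tscale s (chart_vec A c x a))) (tscale t (chart_vec A c x b)))
     = Ec c ((x, y + s *\<^sub>R a) + t *\<^sub>R (0, b))" for s t
    by (simp add: chart_vec_add_scale(1)[OF c x] Ec_def)
  have d1: "deriv (\<lambda>t. Ec c ((x, y + s *\<^sub>R a) + t *\<^sub>R (0, b))) 0 = frechet_derivative (Ec c) (at ((x, y) + s *\<^sub>R (0, a))) (0, b)"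
    if "y + s *\<^sub>R a \<noteq> 0" for s
    using DERIV_imp_deriv[OF has_real_derivative_along_line[OF smE, of "(x, y + s *\<^sub>R a)" 0 "(0, b)"]] x that by simp
  \<comment> \<open>The inner derivative is computed only where y + s a \<noteq> 0; this open set
    contains s = 0, which is all that the outer derivative sees.\<close>
  have oS: "open {s. y + s *\<^sub>R a \<noteq> 0}"
    by (intro open_Collect_neq continuous_intros)
  have "((\<lambda>s. frechet_derivative (Ec c) (at ((x, y) + s *\<^sub>R (0, a))) (0, b)) has_real_derivative
     frechet_derivative (\<lambda>z. frechet_derivative (Ec c) (at z) (0, b)) (at ((x, y) + 0 *\<^sub>R (0, a))) (0, a)) (at 0)"
    by (rule has_real_derivative_along_line[OF smooth_on_frechet_derivative[OF smE]]) (use x y in simp)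
  then have "((\<lambda>s. deriv (\<lambda>t. Ec c ((x, y + s *\<^sub>R a) + t *\<^sub>R (0, b))) 0) has_real_derivative
     frechet_derivative (\<lambda>z. frechet_derivative (Ec c) (at z) (0, b)) (at ((x, y) + 0 *\<^sub>R (0, a))) (0, a)) (at 0)"
    by (rule has_field_derivative_transform_within_open[OF _ oS]) (use y d1 in simp_all)
  from DERIV_imp_deriv[OF this] show ?thesis unfolding fibre_second_deriv_def e by simp
qed

text \<open>Every tangent vector at the base point has the form \<open>chart_vec A c x b\<close>, so
  nondegeneracy on the tangent space becomes nondegeneracy in coordinates.\<close>

lemma local_finsler: "c \<in> A \<Longrightarrow> local_finsler (chart_image c) (Ec c)"
proof
  assume c: "c \<in> A"
  show "open (chart_image c)" by (rule open_chart_image[OF atlas c])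
  show "smooth_on (chart_image c \<times> (- {0})) (Ec c)" by (rule smooth_Ec[OF c])
  fix x y assume x: "x \<in> chart_image c" and y: "y \<noteq> (0::'e)"
  let ?v = "chart_vec A c x y"
  have v: "?v \<in> slit_bundle A" using chart_vec_slit_iff[OF c x] y by blast
  show "Ec c (x, y) > 0" using F_positive[OF v] by (simp add: Ec_def energy_def)
  show "Ec c (x, r *\<^sub>R y) = r\<^sup>2 * Ec c (x, y)" if "r > 0" for r
    using F_homogeneous[OF slit_bundle_subset[OF v] that] chart_vec_add_scale(2)[OF c x, of r y]
    by (simp add: Ec_def energy_def power_mult_distrib)
  fix a assume h: "\<And>b. frechet_derivative (\<lambda>z. frechet_derivative (Ec c) (at z) (0, b)) (at (x, y)) (0, a) = 0"
  have "fibre_second_deriv (energy F) ?v (chart_vec A c x a) w = 0" if w: "w \<in> tangent_space A (fst ?v)" for w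
  proof -
    have wb: "w \<in> tangent_bundle A" "fst w = chart_inv c x" using w by (simp_all add: tangent_space_def)
    have "w = chart_vec A c x (snd w c)"
      using tangent_vector_eq_chart_vec[OF atlas wb(1), of c] wb(2) chart_at_chart_inv[OF c x] chart_inv_image(2)[OF x] by simp
    then show ?thesis using fibre_second_deriv_eq[OF c x y, of a "snd w c"] h by simp
  qed
  moreover have "chart_vec A c x a \<in> tangent_space A (fst ?v)"
    using chart_vec_in_tangent_bundle[OF atlas c x] by (simp add: tangent_space_def)
  ultimately have "chart_vec A c x a = tzero (fst ?v)"
    using finsler v unfolding finsler_function_def by blast
  then show "a = 0" using snd_chart_vec_same[OF atlas c x, of a] by (simp add: tzero_def)
qed

abbreviation "dEc c \<equiv> local_finsler.dE (Ec c)"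
abbreviation "ddEc c \<equiv> local_finsler.ddE (Ec c)"
abbreviation "Gc c \<equiv> local_finsler.spray (Ec c)"
abbreviation "Zc c \<equiv> chart_image c \<times> (- {0::'e})"
abbreviation "coords c v \<equiv> (snd c (fst v), snd v c)"

lemma coords_in_Z: "v \<in> slit_bundle A \<Longrightarrow> c \<in> charts_at A (fst v) \<Longrightarrow> coords c v \<in> Zc c"
  using slit_bundle_iff[OF atlas slit_bundle_subset] charts_atD(2)[of c A] by simp

lemma TA_chart: "v \<in> tangent_bundle A \<Longrightarrow> c \<in> charts_at A (fst v) \<Longrightarrow> tangent_chart A c \<in> charts_at TA v"
  using charts_at_tangent_atlas by blast

lemma chart_vec_coords: "v \<in> tangent_bundle A \<Longrightarrow> c \<in> charts_at A (fst v) \<Longrightarrow> chart_vec A c (snd c (fst v)) (snd v c) = v"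
  using tangent_vector_eq_chart_vec[OF atlas] by simp

lemma chart_inv_coords: "v \<in> tangent_bundle A \<Longrightarrow> c \<in> charts_at A (fst v) \<Longrightarrow> chart_inv (tangent_chart A c) (coords c v) = v"
  using chart_inv_tangent_chart[OF atlas, of c "snd c (fst v)" "snd v c"] chart_vec_coords charts_atD[of c A] by simp

text \<open>\<open>chart_vec\<close> for the tangent bundle itself; \<zeta> consists of the base and
  fibre components of a tangent vector at \<open>v\<close>.\<close>

lemma double_chart_vec:
  assumes v: "v \<in> tangent_bundle A" and c: "c \<in> charts_at A (fst v)"
  shows "chart_vec TA (tangent_chart A c) (coords c v) \<zeta> \<in> tangent_bundle TA"
    "fst (chart_vec TA (tangent_chart A c) (coords c v) \<zeta>) = v"
    "snd (chart_vec TA (tangent_chart A c) (coords c v) \<zeta>) (tangent_chart A c) = \<zeta>"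
proof -
  note cA = charts_atD(1)[OF c]
  have im: "coords c v \<in> chart_image (tangent_chart A c)"
    unfolding tangent_chart_image[OF atlas cA] using charts_atD(2)[OF c] by simp
  show "chart_vec TA (tangent_chart A c) (coords c v) \<zeta> \<in> tangent_bundle TA"
    by (rule chart_vec_in_tangent_bundle[OF atlas_TA tangent_chart_in_atlas[OF cA] im])
  show "fst (chart_vec TA (tangent_chart A c) (coords c v) \<zeta>) = v" using chart_inv_coords[OF v c] by simp
  show "snd (chart_vec TA (tangent_chart A c) (coords c v) \<zeta>) (tangent_chart A c) = \<zeta>"
    by (rule snd_chart_vec_same[OF atlas_TA tangent_chart_in_atlas[OF cA] im])
qed

lemma tangent_deriv_energy:
  assumes v: "v \<in> slit_bundle A" and c: "c \<in> charts_at A (fst v)"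
  shows "tangent_deriv TA (chart_vec TA (tangent_chart A c) (coords c v) \<zeta>) (energy F) = dEc c (coords c v) \<zeta>"
proof -
  interpret L: local_finsler "chart_image c" "Ec c" by (rule local_finsler[OF charts_atD(1)[OF c]])
  note vb = slit_bundle_subset[OF v] and cA = charts_atD(1)[OF c]
  note d = double_chart_vec[OF vb c, of \<zeta>]
  have "(energy F \<circ> chart_inv (tangent_chart A c) has_derivative dEc c (coords c v)) (at (coords c v))"
  proof (rule has_derivative_transform_within_open[OF L.dE[OF coords_in_Z[OF v c]] L.open_Z coords_in_Z[OF v c]])
    fix z assume "z \<in> Zc c"
    then show "Ec c z = (energy F \<circ> chart_inv (tangent_chart A c)) z"
      using chart_inv_tangent_chart[OF atlas cA, of "fst z" "snd z"] by (auto simp: Ec_def)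
  qed
  then show ?thesis
    using tangent_deriv_eq[OF atlas_TA d(1), of "tangent_chart A c" "energy F" "dEc c (coords c v)"]
      d(2,3) TA_chart[OF vb c] by simp
qed

text \<open>\<open>hfun X\<close> and \<open>kfun X\<close> are the functions \<open>X\<^sup>vE\<close> and \<open>X\<^sup>cE\<close>.\<close>

definition hfun :: "('m \<Rightarrow> ('m, 'e) tvec) \<Rightarrow> ('m, 'e) tvec \<Rightarrow> real" where
  "hfun X w = tangent_deriv TA (vertical_lift A X w) (energy F)"

definition kfun :: "('m \<Rightarrow> ('m, 'e) tvec) \<Rightarrow> ('m, 'e) tvec \<Rightarrow> real" where
  "kfun X w = tangent_deriv TA (complete_lift A X w) (energy F)"

lemma hfun_coord:
  assumes "vector_field A X" "v \<in> slit_bundle A" "c \<in> charts_at A (fst v)"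
  shows "hfun X v = dEc c (coords c v) (0, field_coord c X (snd c (fst v)))"
  unfolding hfun_def vertical_lift_eq[OF atlas assms(1) slit_bundle_subset[OF assms(2)] assms(3)]
  by (rule tangent_deriv_energy[OF assms(2,3)])

lemma kfun_coord:
  assumes "vector_field A X" "v \<in> slit_bundle A" "c \<in> charts_at A (fst v)"
  shows "kfun X v = dEc c (coords c v) (field_coord c X (snd c (fst v)),
    frechet_derivative (field_coord c X) (at (snd c (fst v))) (snd v c))"
  unfolding kfun_def complete_lift_eq[OF atlas Hausdorff assms(1) slit_bundle_subset[OF assms(2)] assms(3)]
  by (rule tangent_deriv_energy[OF assms(2,3)])

text \<open>Product rule for dE(z)(0, X(x)): the second summand comes from the variation of the
  field along the base.\<close>

lemma hfun_has_derivative: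
  assumes X: "vector_field A X" and v: "v \<in> slit_bundle A" and c: "c \<in> charts_at A (fst v)"
  shows "((hfun X \<circ> chart_inv (tangent_chart A c)) has_derivative
    (\<lambda>\<zeta>. ddEc c (field_coord c X (snd c (fst v))) (coords c v) \<zeta>
      + dEc c (coords c v) (0, frechet_derivative (field_coord c X) (at (snd c (fst v))) (fst \<zeta>)))) (at (coords c v))"
proof -
  note cA = charts_atD(1)[OF c]
  interpret L: local_finsler "chart_image c" "Ec c" by (rule local_finsler[OF cA])
  note z = coords_in_Z[OF v c]
  have im: "snd c (fst v) \<in> chart_image c" using charts_atD(2)[OF c] by simp
  have "((\<lambda>z. field_coord c X (fst z)) has_derivative
      (\<lambda>\<zeta>. frechet_derivative (field_coord c X) (at (snd c (fst v))) (fst \<zeta>))) (at (coords c v))"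
    by (rule has_derivative_compose[where g = "field_coord c X", OF bounded_linear_imp_has_derivative[OF bounded_linear_fst]])
      (use smooth_on_has_derivative[OF smooth_field_coord[OF atlas X cA] im] in simp)
  from L.dE_apply_has_derivative[OF z this]
  have "((\<lambda>z. dEc c z (0, field_coord c X (fst z))) has_derivative
     (\<lambda>\<zeta>. ddEc c (field_coord c X (snd c (fst v))) (coords c v) \<zeta>
      + dEc c (coords c v) (0, frechet_derivative (field_coord c X) (at (snd c (fst v))) (fst \<zeta>)))) (at (coords c v))"
    by simp
  then show ?thesis
  proof (rule has_derivative_transform_within_open[OF _ L.open_Z z])
    fix z assume "z \<in> Zc c"
    then obtain x y where z: "z = (x, y)" "x \<in> chart_image c" "y \<noteq> 0" by blast
    have w: "chart_vec A c x y \<in> slit_bundle A" using chart_vec_slit_iff[OF cA z(2)] z(3) by blast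
    have "coords c (chart_vec A c x y) = (x, y)" using snd_chart_vec_same[OF atlas cA z(2)] chart_inv_image(2)[OF z(2)] by simp
    then show "dEc c z (0, field_coord c X (fst z)) = (hfun X \<circ> chart_inv (tangent_chart A c)) z"
      using hfun_coord[OF X w, of c] chart_at_chart_inv[OF cA z(2)] chart_inv_tangent_chart[OF atlas cA z(2), of y] z(1) by simp
  qed
qed

section \<open>The Euler-Lagrange equation at a single vector\<close>

definition el_at :: "('m, 'e) tvec \<Rightarrow> (('m, 'e) tvec, 'e \<times> 'e) tvec \<Rightarrow> bool" where
  "el_at v s \<longleftrightarrow> (\<forall>X. vector_field A X \<longrightarrow> tangent_deriv TA s (hfun X) - kfun X v = 0)"

lemma euler_lagrange_iff_el_at: "euler_lagrange A F S \<longleftrightarrow> (\<forall>v\<in>slit_bundle A. el_at v (S v))"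
  unfolding euler_lagrange_def el_at_def hfun_def[abs_def] kfun_def by blast

text \<open>The terms of \<open>S(X\<^sup>vE)\<close> and \<open>X\<^sup>cE\<close> that contain the derivative of \<open>X\<close> cancel, so that only the value
  of \<open>X\<close> at the base point matters; this value can be prescribed by a bump function.\<close>

lemma el_at_iff:
  assumes v: "v \<in> slit_bundle A" and c: "c \<in> charts_at A (fst v)"
  shows "el_at v (chart_vec TA (tangent_chart A c) (coords c v) (snd v c, g)) \<longleftrightarrow> g = Gc c (coords c v)"
proof -
  note vb = slit_bundle_subset[OF v] and cA = charts_atD(1)[OF c]
  interpret L: local_finsler "chart_image c" "Ec c" by (rule local_finsler[OF cA])
  let ?z = "coords c v" and ?x = "snd c (fst v)" and ?y = "snd v c"
  note z = coords_in_Z[OF v c] and d = double_chart_vec[OF vb c, of "(?y, g)"]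
  have 1: "tangent_deriv TA (chart_vec TA (tangent_chart A c) ?z (?y, g)) (hfun X) - kfun X v
      = ddEc c (field_coord c X ?x) ?z (?y, g) - dEc c ?z (field_coord c X ?x, 0)" if X: "vector_field A X" for X
  proof -
    have "tangent_deriv TA (chart_vec TA (tangent_chart A c) ?z (?y, g)) (hfun X)
        = ddEc c (field_coord c X ?x) ?z (?y, g) + dEc c ?z (0, frechet_derivative (field_coord c X) (at ?x) ?y)"
      using tangent_deriv_eq[OF atlas_TA d(1), of "tangent_chart A c", OF _ _] hfun_has_derivative[OF X v c]
        d(2,3) TA_chart[OF vb c] by simp
    moreover have "dEc c ?z (field_coord c X ?x, frechet_derivative (field_coord c X) (at ?x) ?y)
        = dEc c ?z (field_coord c X ?x, 0) + dEc c ?z (0, frechet_derivative (field_coord c X) (at ?x) ?y)"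
      using linear_add[OF L.linear_dE[OF z], of "(field_coord c X ?x, 0)"
          "(0, frechet_derivative (field_coord c X) (at ?x) ?y)"] by simp
    ultimately show ?thesis using kfun_coord[OF X v c] by simp
  qed
  have "el_at v (chart_vec TA (tangent_chart A c) ?z (?y, g)) \<longleftrightarrow> (\<forall>a. ddEc c a ?z (snd ?z, g) = dEc c ?z (a, 0))"
  proof
    assume el: "el_at v (chart_vec TA (tangent_chart A c) ?z (?y, g))"
    show "\<forall>a. ddEc c a ?z (snd ?z, g) = dEc c ?z (a, 0)"
    proof
      fix a
      obtain X where X: "vector_field A X" "field_coord c X ?x = a" using exists_vector_field[OF atlas Hausdorff c] .
      then show "ddEc c a ?z (snd ?z, g) = dEc c ?z (a, 0)" using el 1[OF X(1)] by (simp add: el_at_def)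
    qed
  qed (use 1 in \<open>simp add: el_at_def\<close>)
  then show ?thesis using L.euler_lagrange_iff[OF z, of g] by simp
qed

text \<open>In charts the projection is (x, y) \<mapsto> x, so its derivative retains the first
  component.\<close>

lemma second_order_at_iff:
  assumes v: "v \<in> tangent_bundle A" and c: "c \<in> charts_at A (fst v)"
  shows "tangent_map TA A fst (chart_vec TA (tangent_chart A c) (coords c v) (p, q)) = v \<longleftrightarrow> p = snd v c"
proof -
  note cA = charts_atD(1)[OF c] and d = double_chart_vec[OF v c, of "(p, q)"]
  let ?s = "chart_vec TA (tangent_chart A c) (coords c v) (p, q)" and ?C = "tangent_chart A c"
  have im: "snd c (fst v) \<in> chart_image c" using charts_atD(2)[OF c] by simp
  have oU: "open (chart_image c \<times> (UNIV :: 'e set))" by (rule open_Times[OF open_chart_image[OF atlas cA] open_UNIV])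
  have fi: "fst (chart_inv ?C z) = chart_inv c (fst z)" if "z \<in> chart_image c \<times> (UNIV :: 'e set)" for z
    using chart_inv_tangent_chart[OF atlas cA, of "fst z" "snd z"] that by auto
  have "tangent_map TA A fst ?s = chart_vec A c (snd c (fst (fst ?s))) (fst (snd ?s ?C))"
  proof (rule tangent_map_eq[OF atlas_TA atlas d(1) _ cA])
    show C: "?C \<in> charts_at TA (fst ?s)" using TA_chart[OF v c] d(2) by simp
    have zs: "snd ?C (fst ?s) = coords c v" unfolding d(2) by simp
    show "\<forall>\<^sub>F z in nhds (snd ?C (fst ?s)). fst (chart_inv ?C z) \<in> fst c"
      unfolding zs eventually_nhds
      using oU im fi chart_inv_image(1)[of _ c] by (intro exI[of _ "chart_image c \<times> (UNIV :: 'e set)"]) force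
    show "(snd c \<circ> fst \<circ> chart_inv ?C has_derivative fst) (at (snd ?C (fst ?s)))"
      unfolding zs
      by (rule has_derivative_transform_within_open[OF bounded_linear_imp_has_derivative[OF bounded_linear_fst] oU])
        (use im fi chart_inv_image(2)[of _ c] in auto)
  qed
  also have "\<dots> = chart_vec A c (snd c (fst v)) p" unfolding d(2,3) by simp
  finally have eq: "tangent_map TA A fst ?s = chart_vec A c (snd c (fst v)) p" .
  show ?thesis
    unfolding eq using chart_vec_coords[OF v c] snd_chart_vec_same[OF atlas cA im, of p] by metis
qed

text \<open>A chart-free pointwise characterisation of the spray: solving it in one chart solves it in all
  charts.\<close>

definition spray_at :: "('m, 'e) tvec \<Rightarrow> (('m, 'e) tvec, 'e \<times> 'e) tvec \<Rightarrow> bool" where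
  "spray_at v s \<longleftrightarrow> s \<in> tangent_space TA v \<and> tangent_map TA A fst s = v \<and> el_at v s"

lemma spray_at_iff:
  assumes v: "v \<in> slit_bundle A" and c: "c \<in> charts_at A (fst v)"
  shows "spray_at v s \<longleftrightarrow> s = chart_vec TA (tangent_chart A c) (coords c v) (snd v c, Gc c (coords c v))"
proof
  note vb = slit_bundle_subset[OF v]
  assume s: "spray_at v s"
  then have sb: "s \<in> tangent_bundle TA" "fst s = v" by (auto simp: spray_at_def tangent_space_def)
  obtain p q where pq: "snd s (tangent_chart A c) = (p, q)" by fastforce
  have eq: "s = chart_vec TA (tangent_chart A c) (coords c v) (p, q)"
    using tangent_vector_eq_chart_vec[OF atlas_TA sb(1), of "tangent_chart A c"] TA_chart[OF vb c] sb(2) pq by simp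
  have p: "p = snd v c" using second_order_at_iff[OF vb c, of p q] s eq by (simp add: spray_at_def)
  have "q = Gc c (coords c v)" using el_at_iff[OF v c, of q] s eq p by (simp add: spray_at_def)
  then show "s = chart_vec TA (tangent_chart A c) (coords c v) (snd v c, Gc c (coords c v))" using eq p by simp
next
  note vb = slit_bundle_subset[OF v]
  assume s: "s = chart_vec TA (tangent_chart A c) (coords c v) (snd v c, Gc c (coords c v))"
  then show "spray_at v s"
    unfolding spray_at_def tangent_space_def
    using double_chart_vec[OF vb c] second_order_at_iff[OF vb c] el_at_iff[OF v c] by simp
qed

text \<open>The spray is determined vector by vector, so the pointwise solutions can be collected
  into \<open>S\<close>, whose smoothness is read off the coordinate formula. Uniqueness of the
  description is pointwise too, with \<open>extensional\<close> settling the values off the slit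
  bundle.\<close>

lemma canonical_spray_properties:
  "second_order_field A (canonical_spray A F) \<and> euler_lagrange A F (canonical_spray A F) \<and>
    canonical_spray A F \<in> extensional (slit_bundle A)"
proof -
  have ex1: "\<exists>!s. spray_at v s" if v: "v \<in> slit_bundle A" for v
  proof -
    obtain c where "c \<in> charts_at A (fst v)" using tangent_bundle_charts[OF slit_bundle_subset[OF v]] by blast
    then show ?thesis by (simp add: spray_at_iff[OF v])
  qed
  define S where "S = restrict (\<lambda>v. THE s. spray_at v s) (slit_bundle A)"
  have S: "spray_at v (S v)" if "v \<in> slit_bundle A" for v
    using theI'[OF ex1[OF that]] that by (simp add: S_def)
  have "second_order_field A S"
    unfolding second_order_field_def
  proof (intro conjI ballI)
    show "vector_field_on TA (slit_bundle A) S"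
    proof (rule vector_field_onI[OF atlas_TA])
      fix v assume v: "v \<in> slit_bundle A"
      show "S v \<in> tangent_space TA v" using S[OF v] by (simp add: spray_at_def)
      obtain c where c: "c \<in> charts_at A (fst v)" using tangent_bundle_charts[OF slit_bundle_subset[OF v]] by blast
      note cA = charts_atD(1)[OF c] and vb = slit_bundle_subset[OF v]
      interpret L: local_finsler "chart_image c" "Ec c" by (rule local_finsler[OF cA])
      let ?C = "tangent_chart A c"
      have w: "chart_vec A c (fst z) (snd z) \<in> slit_bundle A" "c \<in> charts_at A (fst (chart_vec A c (fst z) (snd z)))"
        "coords c (chart_vec A c (fst z) (snd z)) = z" "chart_inv ?C z = chart_vec A c (fst z) (snd z)"
        "chart_vec A c (fst z) (snd z) \<in> fst ?C"
        if "z \<in> Zc c" for z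
      proof -
        have z: "fst z \<in> chart_image c" "snd z \<noteq> 0" using that by auto
        show 1: "chart_vec A c (fst z) (snd z) \<in> slit_bundle A" using chart_vec_slit_iff[OF cA z(1)] z(2) by blast
        show "c \<in> charts_at A (fst (chart_vec A c (fst z) (snd z)))" using chart_at_chart_inv[OF cA z(1)] by simp
        show "coords c (chart_vec A c (fst z) (snd z)) = z"
          using snd_chart_vec_same[OF atlas cA z(1)] chart_inv_image(2)[OF z(1)] by simp
        show "chart_inv ?C z = chart_vec A c (fst z) (snd z)" using chart_inv_tangent_chart[OF atlas cA z(1), of "snd z"] by simp
        show "chart_vec A c (fst z) (snd z) \<in> fst ?C" using slit_bundle_subset[OF 1] chart_inv_image(1)[OF z(1)] by simp
      qed
      have "snd (S (chart_inv ?C z)) ?C = (snd z, Gc c z)" if z: "z \<in> Zc c" for z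
      proof -
        note w = w[OF z]
        have "S (chart_inv ?C z) = chart_vec TA ?C z (snd z, Gc c z)"
          using iffD1[OF spray_at_iff[OF w(1,2)] S[OF w(1)]] snd_chart_vec_same[OF atlas cA, of "fst z" "snd z"] z
          unfolding w(3,4) by auto
        then show ?thesis
          using double_chart_vec(3)[OF slit_bundle_subset[OF w(1)] w(2)] unfolding w(3) by simp
      qed
      moreover have "smooth_on (Zc c) (\<lambda>z. (snd z, Gc c z))"
        by (intro smooth_on_Pair L.open_Z L.smooth_spray smooth_on_linear bounded_linear_snd)
      ultimately have sm: "smooth_on (Zc c) (\<lambda>z. snd (S (chart_inv ?C z)) ?C)"
        using smooth_on_cong[OF L.open_Z, of "\<lambda>z. (snd z, Gc c z)" "\<lambda>z. snd (S (chart_inv ?C z)) ?C"] by simp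
      have sub: "Zc c \<subseteq> snd ?C ` (slit_bundle A \<inter> fst ?C)"
      proof
        fix z assume z: "z \<in> Zc c"
        show "z \<in> snd ?C ` (slit_bundle A \<inter> fst ?C)"
          by (rule image_eqI[of _ _ "chart_vec A c (fst z) (snd z)"]) (use w[OF z] in simp_all)
      qed
      have mem: "snd ?C v \<in> Zc c" using coords_in_Z[OF v c] by simp
      show "\<exists>C\<in>charts_at TA v. \<exists>V. open V \<and> snd C v \<in> V \<and> V \<subseteq> snd C ` (slit_bundle A \<inter> fst C) \<and>
          smooth_on V (\<lambda>x. snd (S (chart_inv C x)) C)"
        by (intro bexI[OF _ TA_chart[OF vb c]] exI[of _ "Zc c"] conjI L.open_Z mem sub sm)
    qed
    show "tangent_map TA A fst (S v) = v" if "v \<in> slit_bundle A" for v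
      using S[OF that] by (simp add: spray_at_def)
  qed
  moreover have "euler_lagrange A F S"
    unfolding euler_lagrange_iff_el_at using S by (simp add: spray_at_def)
  moreover have Se: "S \<in> extensional (slit_bundle A)" by (simp add: S_def)
  ultimately have props: "second_order_field A S \<and> euler_lagrange A F S \<and> S \<in> extensional (slit_bundle A)"
    by blast
  have "\<exists>!S. second_order_field A S \<and> euler_lagrange A F S \<and> S \<in> extensional (slit_bundle A)"
  proof (rule ex1I[of _ S])
    show "second_order_field A S \<and> euler_lagrange A F S \<and> S \<in> extensional (slit_bundle A)" by (fact props)
    fix S' assume S': "second_order_field A S' \<and> euler_lagrange A F S' \<and> S' \<in> extensional (slit_bundle A)"
    have "spray_at v (S' v)" if "v \<in> slit_bundle A" for v
      using S' that unfolding spray_at_def second_order_field_def vector_field_on_def euler_lagrange_iff_el_at by blast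
    then have "S' v = S v" if "v \<in> slit_bundle A" for v using ex1[OF that] S[OF that] that by blast
    then show "S' = S" using S' Se extensionalityI by blast
  qed
  from theI'[OF this] show ?thesis unfolding canonical_spray_def .
qed

lemma canonical_spray_eq:
  assumes v: "v \<in> slit_bundle A" and c: "c \<in> charts_at A (fst v)"
  shows "canonical_spray A F v = chart_vec TA (tangent_chart A c) (coords c v) (snd v c, Gc c (coords c v))"
proof -
  have "spray_at v (canonical_spray A F v)"
    using canonical_spray_properties v
    unfolding spray_at_def second_order_field_def vector_field_on_def euler_lagrange_iff_el_at by blast
  then show ?thesis using spray_at_iff[OF v c] by blast
qed

lemma hfun_derivative_along_spray:
  assumes X: "vector_field A X" and v: "v \<in> slit_bundle A"
  shows "tangent_deriv TA (canonical_spray A F v) (hfun X) = kfun X v"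
  using canonical_spray_properties v X unfolding euler_lagrange_iff_el_at el_at_def by auto

end

section \<open>Geodesics\<close>

lemma smooth_on_has_vector_derivative:
  fixes x :: "real \<Rightarrow> 'a::real_normed_vector"
  assumes "smooth_on N x" "s \<in> N"
  shows "(x has_vector_derivative frechet_derivative x (at s) 1) (at s)"
proof -
  have d: "(x has_derivative frechet_derivative x (at s)) (at s)" by (rule smooth_on_has_derivative[OF assms])
  have "frechet_derivative x (at s) = (\<lambda>r. r *\<^sub>R frechet_derivative x (at s) 1)"
  proof
    fix r
    show "frechet_derivative x (at s) r = r *\<^sub>R frechet_derivative x (at s) 1"
      using linear_cmul[OF has_derivative_linear[OF d], of r 1] by simp
  qed
  then show ?thesis unfolding has_vector_derivative_def by (rule has_derivative_eq_rhs[OF d])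
qed

lemma ode_local_solution:
  fixes f :: "'a::euclidean_space \<Rightarrow> 'a"
  assumes "open S" "smooth_on S f" "x0 \<in> S"
  shows "\<exists>\<epsilon>>0. \<exists>z. z 0 = x0 \<and> (\<forall>t\<in>{-\<epsilon><..<\<epsilon>}. z t \<in> S \<and> (z has_vector_derivative f (z t)) (at t))"
proof (rule local_flow_exists[OF assms])
  fix \<epsilon> \<delta> :: real and u w
  assume e: "\<epsilon> > 0" and d: "\<delta> > 0" and u0: "\<And>x. x \<in> ball x0 \<delta> \<Longrightarrow> u 0 x = x"
    and uS: "\<And>x t. x \<in> ball x0 \<delta> \<Longrightarrow> \<bar>t\<bar> < \<epsilon> \<Longrightarrow> u t x \<in> S"
    and ud: "\<And>x t. x \<in> ball x0 \<delta> \<Longrightarrow> \<bar>t\<bar> < \<epsilon> \<Longrightarrow> ((\<lambda>t. u t x) has_vector_derivative f (u t x)) (at t)"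
  have x0: "x0 \<in> ball x0 \<delta>" using d by simp
  have h: "u t x0 \<in> S \<and> ((\<lambda>t. u t x0) has_vector_derivative f (u t x0)) (at t)" if "t \<in> {-\<epsilon><..<\<epsilon>}" for t
    using uS[OF x0, of t] ud[OF x0, of t] that by (simp add: abs_less_iff)
  show ?thesis
    by (intro exI[of _ \<epsilon>] exI[of _ "\<lambda>t. u t x0"] conjI e u0[OF x0] ballI) (use h in blast)+
qed

context finsler_manifold
begin

text \<open>The geodesic equation as a first-order system with the velocity \<open>y\<close> as an
  explicit unknown, so that the theory of first-order equations applies.\<close>

definition geo_in_chart :: "('m, 'e) chart \<Rightarrow> real set \<Rightarrow> (real \<Rightarrow> 'm) \<Rightarrow> (real \<Rightarrow> 'e) \<Rightarrow> bool" where
  "geo_in_chart c N \<gamma> y \<longleftrightarrow> open N \<and> (\<forall>s\<in>N. \<gamma> s \<in> fst c \<and> y s \<noteq> 0 \<and>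
     ((snd c \<circ> \<gamma>) has_vector_derivative y s) (at s) \<and> (y has_vector_derivative Gc c (snd c (\<gamma> s), y s)) (at s))"

lemma geo_in_chartD:
  assumes "geo_in_chart c N \<gamma> y"
  shows "open N" "\<And>s. s \<in> N \<Longrightarrow> \<gamma> s \<in> fst c" "\<And>s. s \<in> N \<Longrightarrow> y s \<noteq> 0"
    "\<And>s. s \<in> N \<Longrightarrow> ((snd c \<circ> \<gamma>) has_vector_derivative y s) (at s)"
    "\<And>s. s \<in> N \<Longrightarrow> (y has_vector_derivative Gc c (snd c (\<gamma> s), y s)) (at s)"
  using assms unfolding geo_in_chart_def by blast+

lemma geo_in_chart_subset:
  "geo_in_chart c N \<gamma> y \<Longrightarrow> open M \<Longrightarrow> M \<subseteq> N \<Longrightarrow> geo_in_chart c M \<gamma> y"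
  unfolding geo_in_chart_def by blast

lemma geo_in_chart_cong:
  assumes "geo_in_chart c N \<gamma> y" "\<And>s. s \<in> N \<Longrightarrow> \<delta> s = \<gamma> s"
  shows "geo_in_chart c N \<delta> y"
  unfolding geo_in_chart_def
proof (intro conjI ballI)
  note g = geo_in_chartD[OF assms(1)]
  show "open N" by (rule g(1))
  fix s assume s: "s \<in> N"
  show "\<delta> s \<in> fst c" "y s \<noteq> 0" using g(2,3)[OF s] assms(2)[OF s] by simp_all
  show "((snd c \<circ> \<delta>) has_vector_derivative y s) (at s)"
    by (rule has_vector_derivative_transform_within_open[OF g(4)[OF s] g(1) s]) (simp add: assms(2))
  show "(y has_vector_derivative Gc c (snd c (\<delta> s), y s)) (at s)" using g(5)[OF s] assms(2)[OF s] by simp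
qed

lemma velocity_in_chart:
  assumes c: "c \<in> A" and N: "open N" "s \<in> N" "\<And>s. s \<in> N \<Longrightarrow> \<gamma> s \<in> fst c"
    and d: "((snd c \<circ> \<gamma>) has_vector_derivative y) (at s)"
  shows "velocity A \<gamma> s = chart_vec A c (snd c (\<gamma> s)) y"
proof -
  have "\<forall>\<^sub>F r in nhds s. \<gamma> r \<in> fst c" using N unfolding eventually_nhds by blast
  from velocity_eq_chart_vec[OF atlas c this d] show ?thesis .
qed

lemma geo_velocity:
  assumes c: "c \<in> A" and g: "geo_in_chart c N \<gamma> y" and s: "s \<in> N"
  shows "velocity A \<gamma> s = chart_vec A c (snd c (\<gamma> s)) (y s)" "velocity A \<gamma> s \<in> slit_bundle A"
    "fst (velocity A \<gamma> s) = \<gamma> s" "c \<in> charts_at A (fst (velocity A \<gamma> s))"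
    "coords c (velocity A \<gamma> s) = (snd c (\<gamma> s), y s)"
proof -
  note gD = geo_in_chartD[OF g]
  show v: "velocity A \<gamma> s = chart_vec A c (snd c (\<gamma> s)) (y s)"
    by (rule velocity_in_chart[OF c gD(1) s gD(2) gD(4)[OF s]])
  have im: "snd c (\<gamma> s) \<in> chart_image c" using gD(2)[OF s] by simp
  show "velocity A \<gamma> s \<in> slit_bundle A" unfolding v using chart_vec_slit_iff[OF c im] gD(3)[OF s] by blast
  show f: "fst (velocity A \<gamma> s) = \<gamma> s" by (simp add: velocity_def)
  show "c \<in> charts_at A (fst (velocity A \<gamma> s))" unfolding f by (rule charts_atI[OF c gD(2)[OF s]])
  show "coords c (velocity A \<gamma> s) = (snd c (\<gamma> s), y s)"
    unfolding f unfolding v using snd_chart_vec_same[OF atlas c im] by simp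
qed

lemma geo_solves_ode:
  assumes "geo_in_chart c N \<gamma> y" "s \<in> N"
  shows "((\<lambda>s. (snd c (\<gamma> s), y s)) has_vector_derivative (y s, Gc c (snd c (\<gamma> s), y s))) (at s)"
  using has_vector_derivative_Pair[OF geo_in_chartD(4)[OF assms] geo_in_chartD(5)[OF assms]] by simp

lemma geo_acceleration:
  assumes c: "c \<in> A" and N: "open N" "s \<in> N" "\<And>s. s \<in> N \<Longrightarrow> \<gamma> s \<in> fst c"
    and d: "\<And>s. s \<in> N \<Longrightarrow> ((snd c \<circ> \<gamma>) has_vector_derivative y s) (at s)"
    and d2: "(y has_vector_derivative y') (at s)"
  shows "velocity TA (velocity A \<gamma>) s = chart_vec TA (tangent_chart A c) (snd c (\<gamma> s), y s) (y s, y')"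
  using velocity_of_chart_vec[OF atlas c N(1,2), of "snd c \<circ> \<gamma>" "velocity A \<gamma>" y "y s" y'] N d d2
    velocity_in_chart[OF c N(1) _ N(3) d] by simp

text \<open>Spray and acceleration both have the normal form \<open>chart_vec\<close> at the same
  point and with the same first component, so their equality is that of the second
  components.\<close>

lemma geodesic_in_chart:
  assumes g: "geodesic A F I \<gamma>" and t: "t \<in> I" and c: "c \<in> charts_at A (\<gamma> t)"
  obtains N y where "t \<in> N" "N \<subseteq> I" "geo_in_chart c N \<gamma> y"
proof -
  note cA = charts_atD(1)[OF c]
  have sm: "smooth_map_on standard_atlas I A \<gamma>" and sl: "\<And>t. t \<in> I \<Longrightarrow> velocity A \<gamma> t \<in> slit_bundle A"
    and eq: "\<And>t. t \<in> I \<Longrightarrow> canonical_spray A F (velocity A \<gamma> t) = velocity TA (velocity A \<gamma>) t"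
    using g by (auto simp: geodesic_def)
  obtain N where N: "open N" "t \<in> N" "N \<subseteq> I" "\<And>s. s \<in> N \<Longrightarrow> \<gamma> s \<in> fst c" "smooth_on N (snd c \<circ> \<gamma>)"
    using smooth_curveE[OF sm atlas t c] by blast
  define y where "y s = frechet_derivative (snd c \<circ> \<gamma>) (at s) 1" for s
  have dy: "((snd c \<circ> \<gamma>) has_vector_derivative y s) (at s)" if "s \<in> N" for s
    unfolding y_def by (rule smooth_on_has_vector_derivative[OF N(5) that])
  have sy: "smooth_on N y" unfolding y_def by (rule smooth_on_frechet_derivative[OF N(5)])
  have "y s \<noteq> 0 \<and> (y has_vector_derivative Gc c (snd c (\<gamma> s), y s)) (at s)" if s: "s \<in> N" for s
  proof -
    have sI: "s \<in> I" using s N(3) by blast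
    let ?y' = "frechet_derivative y (at s) 1"
    have d2: "(y has_vector_derivative ?y') (at s)" by (rule smooth_on_has_vector_derivative[OF sy s])
    have v: "velocity A \<gamma> s = chart_vec A c (snd c (\<gamma> s)) (y s)"
      by (rule velocity_in_chart[OF cA N(1) s N(4) dy[OF s]])
    have im: "snd c (\<gamma> s) \<in> chart_image c" using N(4)[OF s] by simp
    have vs: "velocity A \<gamma> s \<in> slit_bundle A" by (rule sl[OF sI])
    then have "y s \<noteq> 0" unfolding v using chart_vec_slit_iff[OF cA im] by blast
    have cs: "c \<in> charts_at A (fst (velocity A \<gamma> s))"
      unfolding v using chart_at_chart_inv[OF cA im] by simp
    have co: "coords c (velocity A \<gamma> s) = (snd c (\<gamma> s), y s)"
      unfolding v using snd_chart_vec_same[OF atlas cA im] chart_inv_image(2)[OF im] by simp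
    have sv: "snd (velocity A \<gamma> s) c = y s" using co by simp
    have "chart_vec TA (tangent_chart A c) (snd c (\<gamma> s), y s) (y s, Gc c (snd c (\<gamma> s), y s))
        = chart_vec TA (tangent_chart A c) (snd c (\<gamma> s), y s) (y s, ?y')"
      by (rule trans[OF canonical_spray_eq[OF vs cs, unfolded co, unfolded sv, symmetric]
            trans[OF eq[OF sI] geo_acceleration[OF cA N(1) s N(4) dy d2]]])
    then have "Gc c (snd c (\<gamma> s), y s) = ?y'"
      using double_chart_vec(3)[OF slit_bundle_subset[OF vs] cs, unfolded co] by (metis snd_conv)
    then show ?thesis using d2 \<open>y s \<noteq> 0\<close> by simp
  qed
  then have "geo_in_chart c N \<gamma> y" using N dy unfolding geo_in_chart_def by blast
  then show thesis using that N by blast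
qed

text \<open>Smoothness of the curve is a consequence of the equation, whose right-hand side is
  smooth.\<close>

lemma geodesicI:
  assumes I: "open_interval I"
    and loc: "\<And>t. t \<in> I \<Longrightarrow> \<exists>c\<in>A. \<exists>N y. t \<in> N \<and> N \<subseteq> I \<and> geo_in_chart c N \<gamma> y"
  shows "geodesic A F I \<gamma>"
  unfolding geodesic_def
proof (intro conjI ballI I)
  show "smooth_map_on standard_atlas I A \<gamma>"
    unfolding smooth_curve_iff[OF atlas]
  proof
    fix t assume "t \<in> I"
    then obtain c N y where c: "c \<in> A" and N: "t \<in> N" "N \<subseteq> I" and g: "geo_in_chart c N \<gamma> y" using loc by blast
    interpret L: local_finsler "chart_image c" "Ec c" by (rule local_finsler[OF c])
    note gD = geo_in_chartD[OF g]
    have "smooth_on (Zc c) (\<lambda>z. (snd z, Gc c z))"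
      by (intro smooth_on_Pair L.open_Z L.smooth_spray smooth_on_linear bounded_linear_snd)
    then have "smooth_on N (\<lambda>s. (snd c (\<gamma> s), y s))"
      by (rule ode_solution_smooth[OF L.open_Z _ gD(1)]) (use gD(2,3) geo_solves_ode[OF g] in auto)
    from smooth_on_linear_compose[OF gD(1) bounded_linear_fst this]
    have "smooth_on N (snd c \<circ> \<gamma>)" by (simp add: o_def)
    then show "\<exists>c\<in>A. \<exists>N. open N \<and> t \<in> N \<and> N \<subseteq> I \<and> \<gamma> ` N \<subseteq> fst c \<and> smooth_on N (snd c \<circ> \<gamma>)"
      using c N gD(1,2) by blast
  qed
  fix t assume "t \<in> I"
  then obtain c N y where c: "c \<in> A" and N: "t \<in> N" "N \<subseteq> I" and g: "geo_in_chart c N \<gamma> y" using loc by blast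
  note gD = geo_in_chartD[OF g] and v = geo_velocity[OF c g N(1)]
  show "velocity A \<gamma> t \<in> slit_bundle A" by (rule v(2))
  have "velocity TA (velocity A \<gamma>) t = chart_vec TA (tangent_chart A c) (snd c (\<gamma> t), y t) (y t, Gc c (snd c (\<gamma> t), y t))"
    by (rule geo_acceleration[OF c gD(1) N(1) gD(2) gD(4) gD(5)[OF N(1)]])
  then show "canonical_spray A F (velocity A \<gamma> t) = velocity TA (velocity A \<gamma>) t"
    using canonical_spray_eq[OF v(2,4)] v(5) by simp
qed

lemma geodesic_chart:
  assumes "geodesic A F I \<gamma>" "t \<in> I"
  obtains c where "c \<in> charts_at A (\<gamma> t)"
  using smooth_curve_chart[OF atlas _ assms(2)] assms(1) unfolding geodesic_def by blast

lemma geodesic_restrict: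
  assumes "geodesic A F I \<gamma>" "open_interval M" "M \<subseteq> I"
  shows "geodesic A F M \<gamma>"
proof (rule geodesicI[OF assms(2)])
  fix t assume t: "t \<in> M"
  then have tI: "t \<in> I" using assms(3) by blast
  obtain c where c: "c \<in> charts_at A (\<gamma> t)" using geodesic_chart[OF assms(1) tI] .
  obtain N y where N: "t \<in> N" "N \<subseteq> I" "geo_in_chart c N \<gamma> y" using geodesic_in_chart[OF assms(1) tI c] .
  have "open (N \<inter> M)" using geo_in_chartD(1)[OF N(3)] assms(2) by (auto simp: open_interval_def)
  then have "geo_in_chart c (N \<inter> M) \<gamma> y" by (rule geo_in_chart_subset[OF N(3)]) simp
  then show "\<exists>c\<in>A. \<exists>N y. t \<in> N \<and> N \<subseteq> M \<and> geo_in_chart c N \<gamma> y"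
    using t N(1) charts_atD(1)[OF c] by (intro bexI[of _ c] exI[of _ "N \<inter> M"] exI[of _ y]) auto
qed

section \<open>Existence of geodesics and of maximal extensions\<close>

lemma geodesic_exists:
  assumes v: "v \<in> slit_bundle A"
  obtains \<epsilon> \<gamma> where "\<epsilon> > 0" "geodesic A F {-\<epsilon><..<\<epsilon>} \<gamma>" "velocity A \<gamma> 0 = v"
proof -
  note vb = slit_bundle_subset[OF v]
  obtain c where c: "c \<in> charts_at A (fst v)" using tangent_bundle_charts[OF vb] by blast
  note cA = charts_atD(1)[OF c]
  interpret L: local_finsler "chart_image c" "Ec c" by (rule local_finsler[OF cA])
  have sm: "smooth_on (Zc c) (\<lambda>z. (snd z, Gc c z))"
    by (intro smooth_on_Pair L.open_Z L.smooth_spray smooth_on_linear bounded_linear_snd)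
  obtain \<epsilon> z where e: "\<epsilon> > 0" and z0: "z 0 = coords c v"
    and z: "\<And>t. t \<in> {-\<epsilon><..<\<epsilon>} \<Longrightarrow> z t \<in> Zc c \<and> (z has_vector_derivative (snd (z t), Gc c (z t))) (at t)"
    using ode_local_solution[OF L.open_Z sm coords_in_Z[OF v c]] by blast
  let ?I = "{-\<epsilon><..<\<epsilon>}"
  define \<gamma> where "\<gamma> t = chart_inv c (fst (z t))" for t
  have zi: "fst (z t) \<in> chart_image c" "snd (z t) \<noteq> 0" if "t \<in> ?I" for t using z[OF that] by auto
  have gi: "\<gamma> t \<in> fst c" "snd c (\<gamma> t) = fst (z t)" if "t \<in> ?I" for t
    using chart_inv_image[OF zi(1)[OF that]] by (simp_all add: \<gamma>_def)
  have geo: "geo_in_chart c ?I \<gamma> (\<lambda>t. snd (z t))"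
    unfolding geo_in_chart_def
  proof (intro conjI ballI)
    fix s assume s: "s \<in> ?I"
    show "\<gamma> s \<in> fst c" "snd (z s) \<noteq> 0" by (rule gi(1)[OF s], rule zi(2)[OF s])
    have zs: "(z has_vector_derivative (snd (z s), Gc c (z s))) (at s)" using z[OF s] by blast
    have "((\<lambda>t. fst (z t)) has_vector_derivative snd (z s)) (at s)"
      using bounded_linear.has_vector_derivative[OF bounded_linear_fst zs] by simp
    then show "((snd c \<circ> \<gamma>) has_vector_derivative snd (z s)) (at s)"
      by (rule has_vector_derivative_transform_within_open[OF _ open_greaterThanLessThan s]) (simp add: gi(2))
    show "((\<lambda>t. snd (z t)) has_vector_derivative Gc c (snd c (\<gamma> s), snd (z s))) (at s)"
      using bounded_linear.has_vector_derivative[OF bounded_linear_snd zs] gi(2)[OF s] by simp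
  qed simp
  have "open_interval ?I" using e by (auto simp: open_interval_def is_interval_oo)
  then have g: "geodesic A F ?I \<gamma>"
    using cA geo by (intro geodesicI) blast+
  have 0: "0 \<in> ?I" using e by simp
  have "velocity A \<gamma> 0 = chart_vec A c (fst (z 0)) (snd (z 0))"
    using geo_velocity(1)[OF cA geo 0] gi(2)[OF 0] by simp
  then have "velocity A \<gamma> 0 = v" using z0 chart_vec_coords[OF vb c] by simp
  then show thesis using that e g by blast
qed

text \<open>Zorn's lemma for graphs of geodesics makes uniqueness of geodesics dispensable.\<close>

lemma maximal_geodesic_extends:
  assumes g0: "geodesic A F I0 \<gamma>0" and t0: "t0 \<in> I0"
  obtains I \<gamma> where "maximal_geodesic A F I \<gamma>" "I0 \<subseteq> I" "\<And>t. t \<in> I0 \<Longrightarrow> \<gamma> t = \<gamma>0 t"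
proof -
  \<comment> \<open>With partial curves encoded as graphs, extension is inclusion and a chain is
    bounded by its union.\<close>
  define graph where "graph I \<gamma> = (\<lambda>t. (t, \<gamma> t)) ` I" for I :: "real set" and \<gamma> :: "real \<Rightarrow> 'm"
  have graph_iff: "(t, q) \<in> graph I \<gamma> \<longleftrightarrow> t \<in> I \<and> q = \<gamma> t" for t q I \<gamma> by (auto simp: graph_def)
  \<comment> \<open>All graphs contain the initial one; hence their domains share \<open>t0\<close>,
    and a union of such intervals is connected.\<close>
  define \<A> where "\<A> = {G. \<exists>I \<gamma>. geodesic A F I \<gamma> \<and> G = graph I \<gamma> \<and> graph I0 \<gamma>0 \<subseteq> G}"
  have ne: "\<A> \<noteq> {}" using g0 unfolding \<A>_def by blast
  have chain: "\<Union>\<C> \<in> \<A>" if C: "\<C> \<noteq> {}" "subset.chain \<A> \<C>" for \<C>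
  proof -
    have C\<A>: "\<C> \<subseteq> \<A>" and lin: "\<And>G H. G \<in> \<C> \<Longrightarrow> H \<in> \<C> \<Longrightarrow> G \<subseteq> H \<or> H \<subseteq> G"
      using C(2) unfolding subset.chain_def by auto
    have uniq: "a = b" if ab: "(t, a) \<in> \<Union>\<C>" "(t, b) \<in> \<Union>\<C>" for t a b
    proof -
      obtain G H where GH: "G \<in> \<C>" "H \<in> \<C>" "(t, a) \<in> G" "(t, b) \<in> H" using ab by blast
      then obtain K where K: "K \<in> \<C>" "(t, a) \<in> K" "(t, b) \<in> K" using lin[OF GH(1,2)] by blast
      then obtain I \<gamma> where "K = graph I \<gamma>" using C\<A> unfolding \<A>_def by blast
      then show ?thesis using K graph_iff by simp
    qed
    define I where "I = fst ` \<Union>\<C>"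
    define \<gamma> where "\<gamma> t = (THE a. (t, a) \<in> \<Union>\<C>)" for t
    have gt: "\<gamma> t = a" if "(t, a) \<in> \<Union>\<C>" for t a
      unfolding \<gamma>_def using that uniq by (intro the_equality) blast+
    have UG: "\<Union>\<C> = graph I \<gamma>"
    proof (intro set_eqI iffI)
      fix z assume z: "z \<in> \<Union>\<C>"
      obtain t a where ta: "z = (t, a)" by fastforce
      have "t \<in> I" unfolding I_def by (rule image_eqI[OF _ z]) (simp add: ta)
      then show "z \<in> graph I \<gamma>" using gt[of t a] z ta by (simp add: graph_iff)
    next
      fix z assume "z \<in> graph I \<gamma>"
      then obtain t where t: "t \<in> I" "z = (t, \<gamma> t)" by (auto simp: graph_def)
      then obtain a where "(t, a) \<in> \<Union>\<C>" unfolding I_def by force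
      then show "z \<in> \<Union>\<C>" using gt t(2) by simp
    qed
    have mem: "\<exists>J \<delta>. geodesic A F J \<delta> \<and> t \<in> J \<and> t0 \<in> J \<and> J \<subseteq> I \<and> (\<forall>s\<in>J. \<gamma> s = \<delta> s)" if t: "t \<in> I" for t
    proof -
      have "(t, \<gamma> t) \<in> \<Union>\<C>" using t UG by (simp add: graph_iff)
      then obtain G where G: "G \<in> \<C>" "(t, \<gamma> t) \<in> G" by blast
      then obtain J \<delta> where J: "geodesic A F J \<delta>" "G = graph J \<delta>" "graph I0 \<gamma>0 \<subseteq> G"
        using C\<A> unfolding \<A>_def by blast
      have sub: "(s, \<delta> s) \<in> \<Union>\<C>" if "s \<in> J" for s using G(1) J(2) that graph_iff by blast
      have "J \<subseteq> I"
      proof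
        fix s assume "s \<in> J"
        then show "s \<in> I" using sub[of s] unfolding UG graph_iff by simp
      qed
      moreover have "\<forall>s\<in>J. \<gamma> s = \<delta> s" using sub gt by blast
      moreover have "t \<in> J" using G(2) J(2) graph_iff by simp
      moreover have "(t0, \<gamma>0 t0) \<in> graph J \<delta>" using J(2,3) t0 graph_iff[of t0 "\<gamma>0 t0" I0 \<gamma>0] by blast
      then have "t0 \<in> J" using graph_iff by simp
      ultimately show ?thesis using J(1) by blast
    qed
    have "open_interval I"
    proof -
      let ?S = "{J. \<exists>\<delta>. geodesic A F J \<delta> \<and> t0 \<in> J \<and> J \<subseteq> I}"
      have oi: "open_interval J" if "J \<in> ?S" for J using that by (auto simp: geodesic_def)
      have IU: "I = \<Union>?S" using mem by blast
      have "open (\<Union>?S)" using oi by (intro open_Union) (simp add: open_interval_def)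
      then have "open I" unfolding IU[symmetric] .
      moreover have "connected (\<Union>?S)"
        using oi by (intro connected_Union) (auto simp: open_interval_def is_interval_connected)
      then have "is_interval I" unfolding IU[symmetric] by (simp add: is_interval_connected_1)
      moreover have "I \<noteq> {}"
      proof -
        obtain G where "G \<in> \<C>" using C(1) by blast
        then have "(t0, \<gamma>0 t0) \<in> \<Union>\<C>"
          using C\<A> t0 graph_iff[of t0 "\<gamma>0 t0" I0 \<gamma>0] unfolding \<A>_def by blast
        then show ?thesis unfolding UG graph_iff by blast
      qed
      ultimately show ?thesis by (simp add: open_interval_def)
    qed
    then have "geodesic A F I \<gamma>"
    proof (rule geodesicI)
      fix t assume "t \<in> I"
      then obtain J \<delta> where J: "geodesic A F J \<delta>" "t \<in> J" "J \<subseteq> I" "\<forall>s\<in>J. \<gamma> s = \<delta> s" using mem by blast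
      obtain c where c: "c \<in> charts_at A (\<delta> t)" using geodesic_chart[OF J(1,2)] .
      obtain N y where N: "t \<in> N" "N \<subseteq> J" "geo_in_chart c N \<delta> y" using geodesic_in_chart[OF J(1,2) c] .
      have "geo_in_chart c N \<gamma> y" by (rule geo_in_chart_cong[OF N(3)]) (use J(4) N(2) in blast)
      then show "\<exists>c\<in>A. \<exists>N y. t \<in> N \<and> N \<subseteq> I \<and> geo_in_chart c N \<gamma> y"
        using charts_atD(1)[OF c] N J(3) by blast
    qed
    moreover have "graph I0 \<gamma>0 \<subseteq> \<Union>\<C>" using C(1) C\<A> unfolding \<A>_def by blast
    ultimately show ?thesis using UG unfolding \<A>_def by blast
  qed
  obtain M where M: "M \<in> \<A>" "\<And>G. G \<in> \<A> \<Longrightarrow> M \<subseteq> G \<Longrightarrow> G = M"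
    using subset_Zorn_nonempty[OF ne chain] by blast
  obtain I \<gamma> where I: "geodesic A F I \<gamma>" "M = graph I \<gamma>" "graph I0 \<gamma>0 \<subseteq> M" using M(1) unfolding \<A>_def by blast
  have sub: "t \<in> I \<and> \<gamma> t = \<gamma>0 t" if "t \<in> I0" for t
    using I(2,3) that graph_iff[of t "\<gamma>0 t" I0 \<gamma>0] graph_iff[of t "\<gamma>0 t" I \<gamma>] by auto
  have "maximal_geodesic A F I \<gamma>"
    unfolding maximal_geodesic_def
  proof (intro conjI allI impI I(1))
    fix J \<delta> assume J: "geodesic A F J \<delta> \<and> I \<subseteq> J \<and> (\<forall>t\<in>I. \<delta> t = \<gamma> t)"
    have "graph I \<gamma> \<subseteq> graph J \<delta>" using J by (auto simp: graph_def)
    then have "graph J \<delta> = graph I \<gamma>" using M(2)[of "graph J \<delta>"] J I unfolding \<A>_def by blast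
    then show "J = I" using graph_iff by blast
  qed
  then show thesis using that sub by blast
qed

text \<open>The maximal geodesic agrees near 0 with a short one of initial velocity
  \<open>v\<close>, and the velocity depends on this germ only.\<close>

lemma maximal_geodesic_exists:
  assumes v: "v \<in> slit_bundle A"
  obtains I \<gamma> where "maximal_geodesic A F I \<gamma>" "0 \<in> I" "velocity A \<gamma> 0 = v"
proof -
  obtain \<epsilon> \<gamma>0 where e: "\<epsilon> > 0" and g0: "geodesic A F {-\<epsilon><..<\<epsilon>} \<gamma>0" "velocity A \<gamma>0 0 = v"
    using geodesic_exists[OF v] .
  have 0: "0 \<in> {-\<epsilon><..<\<epsilon>}" using e by simp
  obtain I \<gamma> where I: "maximal_geodesic A F I \<gamma>" "{-\<epsilon><..<\<epsilon>} \<subseteq> I" "\<And>t. t \<in> {-\<epsilon><..<\<epsilon>} \<Longrightarrow> \<gamma> t = \<gamma>0 t"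
    using maximal_geodesic_extends[OF g0(1) 0] by blast
  obtain c where c: "c \<in> charts_at A (\<gamma>0 0)" using geodesic_chart[OF g0(1) 0] .
  obtain N y where N: "0 \<in> N" "N \<subseteq> {-\<epsilon><..<\<epsilon>}" "geo_in_chart c N \<gamma>0 y" using geodesic_in_chart[OF g0(1) 0 c] .
  have "geo_in_chart c N \<gamma> y" by (rule geo_in_chart_cong[OF N(3)]) (use I(3) N(2) in blast)
  then have "velocity A \<gamma> 0 = velocity A \<gamma>0 0"
    using geo_velocity(1)[OF charts_atD(1)[OF c]] N(1,3) I(3)[OF 0] by metis
  then show thesis using that[OF I(1)] I(2) 0 g0(2) by blast
qed

section \<open>Energy and lifts along geodesics\<close>

text \<open>Local constancy becomes global because the parameter interval is connected; an arbitrary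
  function of the velocity is allowed so as to serve the energy and \<open>kfun X\<close>
  alike.\<close>

lemma geodesic_local_const:
  fixes f :: "('m, 'e) tvec \<Rightarrow> real"
  assumes g: "geodesic A F I \<gamma>"
    and loc: "\<And>t. t \<in> I \<Longrightarrow> \<exists>N. open N \<and> t \<in> N \<and> N \<subseteq> I \<and> (\<forall>s\<in>N. f (velocity A \<gamma> s) = f (velocity A \<gamma> t))"
    and st: "s \<in> I" "t \<in> I"
  shows "f (velocity A \<gamma> s) = f (velocity A \<gamma> t)"
proof -
  have oI: "open I" and cI: "connected I"
    using g by (auto simp: geodesic_def open_interval_def is_interval_connected)
  have step: "\<exists>T. openin (top_of_set I) T \<and> a \<in> T \<and> (\<forall>x\<in>T. \<forall>y\<in>T. f (velocity A \<gamma> x) = f (velocity A \<gamma> t) \<longrightarrow> f (velocity A \<gamma> y) = f (velocity A \<gamma> t))"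
    if a: "a \<in> I" for a
  proof -
    obtain N where N: "open N" "a \<in> N" "N \<subseteq> I" "\<forall>s\<in>N. f (velocity A \<gamma> s) = f (velocity A \<gamma> a)" using loc[OF a] by blast
    have "openin (top_of_set I) N" using N(1,3) by (simp add: openin_open_eq[OF oI])
    moreover have "\<forall>x\<in>N. \<forall>y\<in>N. f (velocity A \<gamma> x) = f (velocity A \<gamma> t) \<longrightarrow> f (velocity A \<gamma> y) = f (velocity A \<gamma> t)"
      using N(4) by metis
    ultimately show ?thesis using N(2) by blast
  qed
  show ?thesis
    using connected_induction_simple[OF cI st(2,1), of "\<lambda>s. f (velocity A \<gamma> s) = f (velocity A \<gamma> t)", OF refl step] .
qed

lemma constant_on_interval:
  fixes f :: "real \<Rightarrow> real"
  assumes "\<And>x. x \<in> {a<..<b} \<Longrightarrow> (f has_real_derivative 0) (at x)" "s \<in> {a<..<b}" "t \<in> {a<..<b}"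
  shows "f s = f t"
proof -
  have "\<exists>c. \<forall>x\<in>{a<..<b}. f x = c"
    using assms(1) by (intro has_derivative_zero_constant convex_real_interval)
      (auto simp: has_field_derivative_def mult_zero_left[abs_def] intro: has_derivative_at_withinI)
  then show ?thesis using assms(2,3) by metis
qed

lemma open_real_contains_interval:
  fixes N :: "real set"
  assumes "open N" "t \<in> N"
  obtains r where "r > 0" "{t - r<..<t + r} \<subseteq> N"
proof -
  obtain r where "r > 0" "ball t r \<subseteq> N" using assms open_contains_ball by blast
  then show thesis using that by (simp add: ball_eq_greaterThanLessThan)
qed

lemma energy_along_geodesic:
  assumes g: "geodesic A F I \<gamma>" and st: "s \<in> I" "t \<in> I"
  shows "energy F (velocity A \<gamma> s) = energy F (velocity A \<gamma> t)"
proof (rule geodesic_local_const[OF g _ st])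
  fix t assume t: "t \<in> I"
  obtain c where c: "c \<in> charts_at A (\<gamma> t)" using geodesic_chart[OF g t] .
  note cA = charts_atD(1)[OF c]
  obtain N y where N: "t \<in> N" "N \<subseteq> I" and geo: "geo_in_chart c N \<gamma> y" using geodesic_in_chart[OF g t c] .
  note gD = geo_in_chartD[OF geo]
  interpret L: local_finsler "chart_image c" "Ec c" by (rule local_finsler[OF cA])
  let ?z = "\<lambda>s. (snd c (\<gamma> s), y s)"
  have e: "energy F (velocity A \<gamma> s) = Ec c (?z s)" if "s \<in> N" for s
    using geo_velocity(1)[OF cA geo that] by (simp add: Ec_def)
  have z: "?z s \<in> Zc c" if "s \<in> N" for s using gD(2,3)[OF that] by simp
  have d0: "((\<lambda>s. Ec c (?z s)) has_real_derivative 0) (at s)" if s: "s \<in> N" for s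
  proof -
    have "((\<lambda>s. Ec c (?z s)) has_derivative (\<lambda>r. dEc c (?z s) (r *\<^sub>R (y s, Gc c (?z s))))) (at s)"
      by (rule has_derivative_compose[where g = "Ec c", OF geo_solves_ode[OF geo s, unfolded has_vector_derivative_def] L.dE[OF z[OF s]]])
    moreover have "(\<lambda>r. dEc c (?z s) (r *\<^sub>R (y s, Gc c (?z s)))) = (*) 0"
      using linear_cmul[OF L.linear_dE[OF z[OF s]], of _ "(y s, Gc c (?z s))"] L.energy_conserved[OF z[OF s]] by auto
    ultimately show ?thesis unfolding has_field_derivative_def by (rule has_derivative_eq_rhs)
  qed
  obtain r where r: "r > 0" "{t - r<..<t + r} \<subseteq> N" using open_real_contains_interval[OF gD(1) N(1)] .
  let ?M = "{t - r<..<t + r}"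
  have tM: "t \<in> ?M" using r(1) by simp
  have ec: "energy F (velocity A \<gamma> s) = energy F (velocity A \<gamma> t)" if s: "s \<in> ?M" for s
  proof -
    have "Ec c (?z s) = Ec c (?z t)"
      by (rule constant_on_interval[OF d0 s tM]) (use r(2) in blast)
    moreover have "s \<in> N" using r(2) s by blast
    ultimately show ?thesis using e N(1) by metis
  qed
  show "\<exists>N. open N \<and> t \<in> N \<and> N \<subseteq> I \<and> (\<forall>s\<in>N. energy F (velocity A \<gamma> s) = energy F (velocity A \<gamma> t))"
  proof (intro exI[of _ ?M] conjI ballI)
    show "open ?M" "t \<in> ?M" "?M \<subseteq> I" using tM r(2) N(2) by auto
  qed (rule ec)
qed

text \<open>The derivative of \<open>hfun X\<close> along the velocity curve is its derivative in
  the direction of the acceleration, which for a geodesic is the spray; the Euler-Lagrange equation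
  identifies it with \<open>kfun X\<close>.\<close>

lemma hfun_along_geodesic:
  assumes X: "vector_field A X" and g: "geodesic A F I \<gamma>" and t: "t \<in> I"
  shows "((\<lambda>s. hfun X (velocity A \<gamma> s)) has_real_derivative kfun X (velocity A \<gamma> t)) (at t)"
proof -
  obtain c where c: "c \<in> charts_at A (\<gamma> t)" using geodesic_chart[OF g t] .
  note cA = charts_atD(1)[OF c]
  obtain N y where N: "t \<in> N" "N \<subseteq> I" and geo: "geo_in_chart c N \<gamma> y" using geodesic_in_chart[OF g t c] .
  note gD = geo_in_chartD[OF geo] and v = geo_velocity[OF cA geo N(1)] and vb = slit_bundle_subset[OF v(2)]
  let ?C = "tangent_chart A c" and ?z = "\<lambda>s. (snd c (\<gamma> s), y s)"
  obtain L where L: "((hfun X \<circ> chart_inv ?C) has_derivative L) (at (?z t))"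
    using hfun_has_derivative[OF X v(2,4)] unfolding v(5) by blast
  have "kfun X (velocity A \<gamma> t) = tangent_deriv TA (canonical_spray A F (velocity A \<gamma> t)) (hfun X)"
    using hfun_derivative_along_spray[OF X v(2)] by simp
  also have "\<dots> = L (y t, Gc c (?z t))"
  proof -
    let ?s = "chart_vec TA ?C (coords c (velocity A \<gamma> t)) (y t, Gc c (?z t))"
    note d = double_chart_vec[OF vb v(4), of "(y t, Gc c (?z t))"]
    have s: "canonical_spray A F (velocity A \<gamma> t) = ?s" using canonical_spray_eq[OF v(2,4)] v(5) by simp
    have "tangent_deriv TA ?s (hfun X) = L (snd ?s ?C)"
    proof (rule tangent_deriv_eq[OF atlas_TA d(1)])
      show "?C \<in> charts_at TA (fst ?s)" unfolding d(2) by (rule TA_chart[OF vb v(4)])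
      have "snd ?C (velocity A \<gamma> t) = ?z t" using v(5) by simp
      then show "((hfun X \<circ> chart_inv ?C) has_derivative L) (at (snd ?C (fst ?s)))" unfolding d(2) using L by simp
    qed
    then show ?thesis unfolding s d(3) .
  qed
  finally have k: "kfun X (velocity A \<gamma> t) = L (y t, Gc c (?z t))" .
  have "((\<lambda>s. (hfun X \<circ> chart_inv ?C) (?z s)) has_derivative (\<lambda>r. L (r *\<^sub>R (y t, Gc c (?z t))))) (at t)"
    by (rule has_derivative_compose[where g = "hfun X \<circ> chart_inv ?C", OF geo_solves_ode[OF geo N(1), unfolded has_vector_derivative_def] L])
  moreover have "(\<lambda>r. L (r *\<^sub>R (y t, Gc c (?z t)))) = (\<lambda>r. r * kfun X (velocity A \<gamma> t))"
    using linear_cmul[OF has_derivative_linear[OF L], of _ "(y t, Gc c (?z t))"] k by auto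
  ultimately have "((\<lambda>s. (hfun X \<circ> chart_inv ?C) (?z s)) has_real_derivative kfun X (velocity A \<gamma> t)) (at t)"
    by (simp add: has_field_derivative_def mult_commute_abs)
  then show ?thesis
  proof (rule has_field_derivative_transform_within_open[OF _ gD(1) N(1)])
    fix s assume s: "s \<in> N"
    have "snd c (\<gamma> s) \<in> chart_image c" using gD(2)[OF s] by simp
    then show "(hfun X \<circ> chart_inv ?C) (?z s) = hfun X (velocity A \<gamma> s)"
      using geo_velocity(1)[OF cA geo s] chart_inv_tangent_chart[OF atlas cA, of "snd c (\<gamma> s)" "y s"] by simp
  qed
qed

text \<open>The convexity inequality with w = X and w = -X, where zeros of the field have to be
  treated separately. As \<open>F\<close> need not be even, the two bounds are independent.\<close>

lemma hfun_bounds: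
  assumes X: "vector_field A X" and v: "v \<in> slit_bundle A"
  shows "hfun X v \<le> energy F v + energy F (X (fst v))"
    "- hfun X v \<le> energy F v + energy F (tscale (- 1) (X (fst v)))"
proof -
  note vb = slit_bundle_subset[OF v]
  obtain c where c: "c \<in> charts_at A (fst v)" using tangent_bundle_charts[OF vb] by blast
  note cA = charts_atD(1)[OF c]
  interpret L: local_finsler "chart_image c" "Ec c" by (rule local_finsler[OF cA])
  let ?x = "snd c (fst v)" and ?y = "snd v c" and ?a = "field_coord c X (snd c (fst v))"
  have im: "?x \<in> chart_image c" using charts_atD(2)[OF c] by simp
  have y: "?y \<noteq> 0" using coords_in_Z[OF v c] by simp
  have Ev: "Ec c (?x, ?y) = energy F v" using chart_vec_coords[OF vb c] by (simp add: Ec_def)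
  have bound: "dEc c (?x, ?y) (0, a) \<le> energy F v + energy F (chart_vec A c ?x a)" for a
  proof (cases "a = 0")
    case True
    have "dEc c (?x, ?y) (0, 0) = 0" using linear_0[OF L.linear_dE[OF coords_in_Z[OF v c]]] by (simp add: zero_prod_def)
    then show ?thesis using True by (simp add: energy_def)
  next
    case False
    then show ?thesis using L.fundamental_inequality[OF im y False] Ev by (simp add: Ec_def)
  qed
  have Xv: "X (fst v) = chart_vec A c ?x ?a" by (rule vector_field_eq_chart_vec[OF atlas X c])
  show "hfun X v \<le> energy F v + energy F (X (fst v))"
    unfolding hfun_coord[OF X v c] Xv by (rule bound)
  have "dEc c (?x, ?y) (0, - ?a) = - dEc c (?x, ?y) (0, ?a)"
    using linear_neg[OF L.linear_dE[OF coords_in_Z[OF v c]], of "(0, ?a)"] by simp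
  then show "- hfun X v \<le> energy F v + energy F (tscale (- 1) (X (fst v)))"
    using bound[of "- ?a"] chart_vec_add_scale(2)[OF cA im, of "- 1" ?a] unfolding hfun_coord[OF X v c] Xv by simp
qed

end

section \<open>Affine fields\<close>

context finsler_manifold
begin

text \<open>For small \<open>t\<close> the flow of \<open>X\<close> turns \<open>\<gamma>\<close> into a geodesic, whose energy does not depend on the
  curve parameter; the derivative of this energy at \<open>t = 0\<close> is \<open>X\<^sup>cE\<close> along \<open>\<gamma>\<close>.\<close>

lemma kfun_along_geodesic:
  assumes aff: "affine_field A F X" and g: "geodesic A F I \<gamma>" and st: "s \<in> I" "t \<in> I"
  shows "kfun X (velocity A \<gamma> s) = kfun X (velocity A \<gamma> t)"
proof (rule geodesic_local_const[OF g _ st])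
  have X: "vector_field A X" using aff by (simp add: affine_field_def)
  fix s0 assume s0: "s0 \<in> I"
  obtain c where c: "c \<in> charts_at A (\<gamma> s0)" using geodesic_chart[OF g s0] .
  note cA = charts_atD(1)[OF c]
  obtain N y where N: "s0 \<in> N" "N \<subseteq> I" and geo: "geo_in_chart c N \<gamma> y" using geodesic_in_chart[OF g s0 c] .
  note gD = geo_in_chartD[OF geo]
  interpret L: local_finsler "chart_image c" "Ec c" by (rule local_finsler[OF cA])
  obtain \<epsilon> \<delta> u w where "chart_flow A X c (\<gamma> s0) \<epsilon> \<delta> u w" using chart_flow_exists[OF atlas Hausdorff X c] by blast
  note cf = chart_flowD[OF this]
  let ?x = "\<lambda>s. snd c (\<gamma> s)"
  have "isCont (snd c \<circ> \<gamma>) s" if "s \<in> N" for s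
    using gD(4)[OF that] has_vector_derivative_continuous by blast
  then have "continuous_on N (snd c \<circ> \<gamma>)" by (intro continuous_at_imp_continuous_on ballI)
  then have "open (N \<inter> (snd c \<circ> \<gamma>) -` ball (?x s0) \<delta>)"
    by (rule continuous_open_preimage[OF _ gD(1) open_ball])
  moreover have "s0 \<in> N \<inter> (snd c \<circ> \<gamma>) -` ball (?x s0) \<delta>" using N(1) cf(2) by simp
  ultimately obtain r where r: "r > 0" "{s0 - r<..<s0 + r} \<subseteq> N \<inter> (snd c \<circ> \<gamma>) -` ball (?x s0) \<delta>"
    using open_real_contains_interval by blast
  \<comment> \<open>Short enough that the curve stays in the ball of the chart flow: then for every
    time below \<epsilon> the flow transports the whole piece, as \<open>affine_field\<close>
    requires.\<close>
  define M where "M = {s0 - r<..<s0 + r}"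
  have oM: "open M" and s0M: "s0 \<in> M" using r(1) by (auto simp: M_def)
  have M: "s \<in> N" "?x s \<in> ball (?x s0) \<delta>" if "s \<in> M" for s using r(2) that by (auto simp: M_def)
  have iM: "open_interval M" using r(1) by (auto simp: M_def open_interval_def is_interval_oo)
  have MI: "M \<subseteq> I" using M(1) N(2) by blast
  have gM: "geodesic A F M \<gamma>" by (rule geodesic_restrict[OF g iM MI])
  have ci: "chart_inv c (?x s) = \<gamma> s" if "s \<in> M" for s by (rule chart_inv_snd[OF atlas cA gD(2)[OF M(1)[OF that]]])
  \<comment> \<open>Energy conservation for the geodesic transported by the flow at time
    \<open>t\<close>, written in coordinates.\<close>
  have en: "Ec c (u t (?x s), w t (?x s) (y s)) = Ec c (u t (?x s0), w t (?x s0) (y s0))"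
    if t: "\<bar>t\<bar> < \<epsilon>" and s: "s \<in> M" for t s
  proof -
    have fl: "flow A X t (\<gamma> s) = chart_inv c (u t (?x s))" if "s \<in> M" for s
      using cf(12)[OF M(2)[OF that] t] ci[OF that] by simp
    have "t \<in> flow_domain A X (\<gamma> s)" if "s \<in> M" for s
      using cf(11)[OF M(2)[OF that] t] ci[OF that] by simp
    then have gf: "geodesic A F M (flow A X t \<circ> \<gamma>)"
      using aff gM unfolding affine_field_def by blast
    have vel: "velocity A (flow A X t \<circ> \<gamma>) s = chart_vec A c (u t (?x s)) (w t (?x s) (y s))" if s: "s \<in> M" for s
    proof -
      have fc: "(flow A X t \<circ> \<gamma>) s' \<in> fst c" "snd c ((flow A X t \<circ> \<gamma>) s') = u t (?x s')" if "s' \<in> M" for s'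
        using fl[OF that] chart_inv_image[OF cf(6)[OF M(2)[OF that] t]] by simp_all
      note du = cf(8)[OF M(2)[OF s] t]
      have "((\<lambda>s. u t ((snd c \<circ> \<gamma>) s)) has_derivative (\<lambda>h. w t (?x s) (h *\<^sub>R y s))) (at s)"
        by (rule has_derivative_compose[where g = "u t", OF gD(4)[OF M(1)[OF s], unfolded has_vector_derivative_def]])
          (use du in simp)
      moreover have "(\<lambda>h. w t (?x s) (h *\<^sub>R y s)) = (\<lambda>h. h *\<^sub>R w t (?x s) (y s))"
        using linear_cmul[OF has_derivative_linear[OF du]] by blast
      ultimately have "((\<lambda>s. u t (?x s)) has_vector_derivative w t (?x s) (y s)) (at s)"
        by (simp add: has_vector_derivative_def)
      then have "((snd c \<circ> (flow A X t \<circ> \<gamma>)) has_vector_derivative w t (?x s) (y s)) (at s)"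
        by (rule has_vector_derivative_transform_within_open[OF _ oM s]) (use fc(2) in simp)
      from velocity_in_chart[OF cA oM s fc(1) this] show ?thesis using fc(2)[OF s] by simp
    qed
    have "energy F (velocity A (flow A X t \<circ> \<gamma>) s) = energy F (velocity A (flow A X t \<circ> \<gamma>) s0)"
      by (rule energy_along_geodesic[OF gf s s0M])
    then show ?thesis unfolding vel[OF s] vel[OF s0M] by (simp add: Ec_def)
  qed
  \<comment> \<open>The energy of the transported velocity as a function of flow time; its
    derivative at 0 is computed by the coordinate form of the complete lift.\<close>
  have kd: "((\<lambda>t. Ec c (u t (?x s), w t (?x s) (y s))) has_real_derivative kfun X (velocity A \<gamma> s)) (at 0)" if s: "s \<in> M" for s
  proof -
    note gv = geo_velocity[OF cA geo M(1)[OF s]] and z0 = coords_in_Z[OF geo_velocity(2,4)[OF cA geo M(1)[OF s]]]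
    have 0: "\<bar>0\<bar> < \<epsilon>" using cf(1) by simp
    have "((\<lambda>t. (u t (?x s), w t (?x s) (y s))) has_vector_derivative
        (field_coord c X (?x s), frechet_derivative (field_coord c X) (at (?x s)) (y s))) (at 0)"
      using has_vector_derivative_Pair[OF cf(7)[OF M(2)[OF s] 0] cf(9)[OF M(2)[OF s] 0, of "y s"]]
        cf(4,5)[OF M(2)[OF s]] by simp
    then have "((\<lambda>t. Ec c (u t (?x s), w t (?x s) (y s))) has_derivative
        (\<lambda>h. dEc c (?x s, y s) (h *\<^sub>R (field_coord c X (?x s), frechet_derivative (field_coord c X) (at (?x s)) (y s))))) (at 0)"
      unfolding has_vector_derivative_def
      by (rule has_derivative_compose[where g = "Ec c"]) (use L.dE[OF z0] gv(5) cf(4,5)[OF M(2)[OF s]] in simp)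
    moreover have "kfun X (velocity A \<gamma> s) = dEc c (?x s, y s) (field_coord c X (?x s), frechet_derivative (field_coord c X) (at (?x s)) (y s))"
      using kfun_coord[OF X gv(2,4)] gv(5) by simp
    moreover have "linear (dEc c (?x s, y s))" using L.linear_dE[OF z0] gv(5) by simp
    ultimately show ?thesis
      unfolding has_field_derivative_def
      by (elim has_derivative_eq_rhs) (simp only: linear_cmul real_scaleR_def mult.commute fun_eq_iff simp_thms)
  qed
  have k: "kfun X (velocity A \<gamma> s) = kfun X (velocity A \<gamma> s0)" if s: "s \<in> M" for s
  proof -
    have o: "open {-\<epsilon><..<\<epsilon>}" "0 \<in> {-\<epsilon><..<\<epsilon>}" using cf(1) by auto
    \<comment> \<open>By \<open>en\<close> the energies at \<open>s\<close> and at \<open>s0\<close>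
      are the same function of \<open>t\<close> near 0, so their derivatives at 0 agree.\<close>
    have "((\<lambda>t. Ec c (u t (?x s0), w t (?x s0) (y s0))) has_real_derivative kfun X (velocity A \<gamma> s)) (at 0)"
      by (rule has_field_derivative_transform_within_open[OF kd[OF s] o])
        (rule en[OF _ s], simp add: abs_less_iff)
    then show ?thesis using kd[OF s0M] DERIV_unique by blast
  qed
  show "\<exists>N. open N \<and> s0 \<in> N \<and> N \<subseteq> I \<and> (\<forall>s\<in>N. kfun X (velocity A \<gamma> s) = kfun X (velocity A \<gamma> s0))"
    by (intro exI[of _ M] conjI ballI oM s0M MI k)
qed

lemma hfun_affine_along_geodesic:
  assumes aff: "affine_field A F X" and g: "geodesic A F I \<gamma>" and st: "0 \<in> I" "t \<in> I"
  shows "hfun X (velocity A \<gamma> t) = hfun X (velocity A \<gamma> 0) + kfun X (velocity A \<gamma> 0) * t"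
proof -
  have X: "vector_field A X" using aff by (simp add: affine_field_def)
  let ?k = "kfun X (velocity A \<gamma> 0)"
  let ?f = "\<lambda>s. hfun X (velocity A \<gamma> s) - ?k * s"
  have cI: "convex I" using g by (auto simp: geodesic_def open_interval_def is_interval_convex)
  have "(?f has_real_derivative 0) (at s)" if s: "s \<in> I" for s
    using hfun_along_geodesic[OF X g s] kfun_along_geodesic[OF aff g s st(1)]
    by (auto intro!: derivative_eq_intros)
  then have "(?f has_derivative (\<lambda>h. 0)) (at s within I)" if "s \<in> I" for s
    using that has_derivative_at_withinI[of ?f "\<lambda>h. 0" s I] by (auto simp: has_field_derivative_def lambda_zero)
  then obtain b where "\<forall>s\<in>I. ?f s = b" using has_derivative_zero_constant[OF cI] by blast
  then have "?f t = ?f 0" using st by metis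
  then show ?thesis by simp
qed

section \<open>Boundedness forces the slope to vanish\<close>

lemma energy_bounded:
  assumes "bounded (f ` S)"
  obtains B where "\<And>p. p \<in> S \<Longrightarrow> (f p :: real)\<^sup>2 / 2 \<le> B"
proof -
  obtain b where b: "\<And>p. p \<in> S \<Longrightarrow> \<bar>f p\<bar> \<le> b" using assms by (auto simp: bounded_iff)
  have "(f p)\<^sup>2 / 2 \<le> b\<^sup>2 / 2" if "p \<in> S" for p
    using power_mono[OF b[OF that] abs_ge_zero, of 2] by simp
  then show thesis using that by blast
qed

lemma affine_function_bounded_above:
  fixes a k C :: real
  assumes "\<And>t. t \<in> T \<Longrightarrow> a + k * t \<le> C" "T = UNIV \<or> (T = {0..} \<and> k \<ge> 0)"
  shows "k = 0"
proof (rule ccontr)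
  assume k: "k \<noteq> 0"
  \<comment> \<open>Here the function has the value a + |C - a| + 1 > C. The sign of
    \<open>t\<close> is that of \<open>k\<close>, so it is admissible on the half-line when k >
    0.\<close>
  define t where "t = (\<bar>C - a\<bar> + 1) / k"
  have kt: "a + k * t = a + \<bar>C - a\<bar> + 1" using k by (simp add: t_def)
  have "t \<in> T" using assms(2) k by (auto simp: t_def)
  then show False using assms(1)[of t] kt by linarith
qed

text \<open>\<open>kfun X v\<close> is the slope of \<open>hfun X\<close> along the maximal geodesic
  with initial velocity \<open>v\<close>, and the energy terms of \<open>hfun_bounds\<close> are
  bounded along it. Under forward completeness only a half-line is available, and the sign of the
  slope decides which of the two bounds applies.\<close>

theorem kfun_zero:
  assumes aff: "affine_field A F X"
    and bnd: "(bounded ((\<lambda>p. F (X p)) ` points A) \<and> finsler_complete A F) \<or>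
         (bounded ((\<lambda>p. F (X p)) ` points A) \<and> bounded ((\<lambda>p. F (tscale (- 1) (X p))) ` points A) \<and>
          finsler_forward_complete A F)"
    and v: "v \<in> slit_bundle A"
  shows "kfun X v = 0"
proof -
  have X: "vector_field A X" using aff by (simp add: affine_field_def)
  obtain I \<gamma> where mg: "maximal_geodesic A F I \<gamma>" and I0: "0 \<in> I" and v0: "velocity A \<gamma> 0 = v"
    using maximal_geodesic_exists[OF v] .
  have g: "geodesic A F I \<gamma>" using mg by (simp add: maximal_geodesic_def)
  let ?k = "kfun X v" and ?h = "hfun X v"
  have h: "hfun X (velocity A \<gamma> t) = ?h + ?k * t" if "t \<in> I" for t
    using hfun_affine_along_geodesic[OF aff g I0 that] v0 by simp
  have sl: "velocity A \<gamma> t \<in> slit_bundle A" if "t \<in> I" for t using g that by (simp add: geodesic_def)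
  have pt: "fst (velocity A \<gamma> t) \<in> points A" if "t \<in> I" for t
    using slit_bundle_subset[OF sl[OF that]] by (simp add: tangent_bundle_iff)
  have en: "energy F (velocity A \<gamma> t) = energy F v" if "t \<in> I" for t
    using energy_along_geodesic[OF g that I0] v0 by simp
  have "bounded ((\<lambda>p. F (X p)) ` points A)" using bnd by blast
  then obtain B where B: "\<And>p. p \<in> points A \<Longrightarrow> (F (X p))\<^sup>2 / 2 \<le> B" using energy_bounded by blast
  have up: "?h + ?k * t \<le> energy F v + B" if t: "t \<in> I" for t
    using hfun_bounds(1)[OF X sl[OF t]] h[OF t] en[OF t] B[OF pt[OF t]] by (simp add: energy_def)
  from bnd show ?thesis
  proof (elim disjE conjE)
    assume "finsler_complete A F"
    then have "I = UNIV" using mg by (auto simp: finsler_complete_def)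
    then show ?thesis using affine_function_bounded_above[of UNIV ?h ?k "energy F v + B"] up by simp
  next
    assume b2: "bounded ((\<lambda>p. F (tscale (- 1) (X p))) ` points A)" and "finsler_forward_complete A F"
    then have nb: "\<not> bdd_above I" using mg by (auto simp: finsler_forward_complete_def)
    obtain B' where B': "\<And>p. p \<in> points A \<Longrightarrow> (F (tscale (- 1) (X p)))\<^sup>2 / 2 \<le> B'" using energy_bounded[OF b2] by blast
    have dn: "- ?h + (- ?k) * t \<le> energy F v + B'" if t: "t \<in> I" for t
      using hfun_bounds(2)[OF X sl[OF t]] h[OF t] en[OF t] B'[OF pt[OF t]] by (simp add: energy_def)
    have inI: "t \<in> I" if "t \<in> {0..}" for t
    proof -
      obtain s where s: "s \<in> I" "t < s" using nb by (meson bdd_above.I not_le)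
      have "is_interval I" using g by (simp add: geodesic_def open_interval_def)
      then show ?thesis using mem_is_interval_1_I[of I 0 s t] I0 s that by simp
    qed
    show ?thesis
    proof (cases "?k \<ge> 0")
      case True
      then show ?thesis using affine_function_bounded_above[of "{0..}" ?h ?k] up inI by blast
    next
      case False
      then have "- ?k = 0" using affine_function_bounded_above[of "{0..}" "- ?h" "- ?k"] dn inI by auto
      then show ?thesis by simp
    qed
  qed
qed

section \<open>Infinitesimally Killing fields are Killing\<close>

text \<open>\<open>F\<close> is nonnegative, hence determined by its square.\<close>

lemma F_chart_vec_eqI:
  assumes "c \<in> A" "x \<in> chart_image c" "x' \<in> chart_image c" "Ec c (x, y) = Ec c (x', y')"
  shows "F (chart_vec A c x y) = F (chart_vec A c x' y')"
proof -
  have "(F (chart_vec A c x y))\<^sup>2 = (F (chart_vec A c x' y'))\<^sup>2" using assms(4) by (simp add: Ec_def energy_def)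
  then show ?thesis
    using F_nonneg[OF chart_vec_in_tangent_bundle[OF atlas assms(1,2)]]
      F_nonneg[OF chart_vec_in_tangent_bundle[OF atlas assms(1,3)]] power2_eq_iff_nonneg by blast
qed

text \<open>The derivative of the energy along s \<mapsto> (u s x, w s x y) is \<open>kfun X\<close>
  at the transported vector, hence 0. Zero vectors are treated apart because the energy need not be
  smooth there.\<close>

lemma chart_flow_preserves_F:
  assumes X: "vector_field A X" and k: "\<And>v. v \<in> slit_bundle A \<Longrightarrow> kfun X v = 0"
    and c: "c \<in> A" and cf0: "chart_flow A X c p \<epsilon> \<delta> u w" and x: "x \<in> ball (snd c p) \<delta>" and t: "\<bar>t\<bar> < \<epsilon>"
  shows "F (chart_vec A c (u t x) (w t x y)) = F (chart_vec A c x y)"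
proof (rule F_chart_vec_eqI[OF c])
  note cf = chart_flowD[OF cf0]
  interpret L: local_finsler "chart_image c" "Ec c" by (rule local_finsler[OF c])
  show "u t x \<in> chart_image c" by (rule cf(6)[OF x t])
  show "x \<in> chart_image c" using cf(3) x by blast
  show "Ec c (u t x, w t x y) = Ec c (x, y)"
  proof (cases "y = 0")
    case True
    have z: "Ec c (x', 0) = 0" if "x' \<in> chart_image c" for x'
    proof -
      note ct = chart_at_chart_inv[OF c that]
      have "chart_inv c x' \<in> points A" using points_iff[of "chart_inv c x'" A] ct by blast
      note tz = tzero_in_tangent_bundle[OF atlas this] and Fz = F_zero[OF this]
      have "chart_vec A c x' 0 = tzero (chart_inv c x')"
        by (rule tangent_vector_eqI[OF chart_vec_in_tangent_bundle[OF atlas c that] tz, of _ c])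
          (use ct snd_chart_vec_same[OF atlas c that] in \<open>simp_all add: tzero_def\<close>)
      then show ?thesis using Fz by (simp add: Ec_def energy_def)
    qed
    have "w t x 0 = 0" using cf(10)[OF x t, of 0] by simp
    then show ?thesis using True z \<open>u t x \<in> chart_image c\<close> \<open>x \<in> chart_image c\<close> by simp
  next
    case False
    let ?z = "\<lambda>s. (u s x, w s x y)"
    have zZ: "?z s \<in> Zc c" if s: "\<bar>s\<bar> < \<epsilon>" for s
    proof -
      \<comment> \<open>The bound on the deviation of \<open>w\<close> from the identity keeps the
        transported vector off the zero section.\<close>
      have "w s x y \<noteq> 0"
      proof
        assume "w s x y = 0"
        then have "norm y \<le> norm y / 2" using cf(10)[OF x s, of y] by simp
        then show False using False by simp
      qed
      then show ?thesis using cf(6)[OF x s] by simp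
    qed
    have d: "((\<lambda>s. Ec c (?z s)) has_real_derivative 0) (at s)" if s: "s \<in> {-\<epsilon><..<\<epsilon>}" for s
    proof -
      have s': "\<bar>s\<bar> < \<epsilon>" using s by (simp add: abs_less_iff)
      note zs = zZ[OF s']
      have im: "u s x \<in> chart_image c" by (rule cf(6)[OF x s'])
      let ?v = "chart_vec A c (u s x) (w s x y)"
      have v: "?v \<in> slit_bundle A" using chart_vec_slit_iff[OF c im] zs by simp
      have ct: "c \<in> charts_at A (fst ?v)" using chart_at_chart_inv[OF c im] by simp
      have co: "coords c ?v = ?z s" using snd_chart_vec_same[OF atlas c im] chart_inv_image(2)[OF im] by simp
      let ?\<zeta> = "(field_coord c X (u s x), frechet_derivative (field_coord c X) (at (u s x)) (w s x y))"
      have k0: "dEc c (?z s) ?\<zeta> = 0" using kfun_coord[OF X v ct] k[OF v] co by simp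
      have "(?z has_vector_derivative ?\<zeta>) (at s)"
        by (rule has_vector_derivative_Pair[OF cf(7)[OF x s'] cf(9)[OF x s']])
      then have "((\<lambda>s. Ec c (?z s)) has_derivative (\<lambda>h. dEc c (?z s) (h *\<^sub>R ?\<zeta>))) (at s)"
        unfolding has_vector_derivative_def
        by (rule has_derivative_compose[where g = "Ec c"]) (rule L.dE[OF zs])
      moreover have "(\<lambda>h. dEc c (?z s) (h *\<^sub>R ?\<zeta>)) = (*) 0"
        using linear_cmul[OF L.linear_dE[OF zs], of _ ?\<zeta>] k0 by auto
      ultimately show ?thesis unfolding has_field_derivative_def by (rule has_derivative_eq_rhs)
    qed
    have "Ec c (?z t) = Ec c (?z 0)"
      by (rule constant_on_interval[OF d]) (use t cf(1) in \<open>auto simp: abs_less_iff\<close>)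
    then show ?thesis using cf(4,5)[OF x] by simp
  qed
qed

section \<open>Continuation of the invariance along integral curves\<close>

text \<open>The property that is continued in time. The base point and its chart \<open>b\<close>
  are fixed, while the target chart \<open>d\<close> follows the flow. Besides the invariance of
  \<open>F\<close> it records that the flow map is defined around \<open>p\<close> and
  differentiable at \<open>p\<close>, which the chain rule for later times presupposes.\<close>

definition preserves_at :: "('m \<Rightarrow> ('m, 'e) tvec) \<Rightarrow> ('m, 'e) chart \<Rightarrow> 'm \<Rightarrow> real \<Rightarrow> ('m, 'e) chart \<Rightarrow> bool" where
  "preserves_at X b p t d \<longleftrightarrow>
    (\<forall>\<^sub>F x in nhds (snd b p). t \<in> flow_domain A X (chart_inv b x) \<and> flow A X t (chart_inv b x) \<in> fst d) \<and>
    (\<exists>L. (snd d \<circ> flow A X t \<circ> chart_inv b has_derivative L) (at (snd b p))) \<and>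
    (\<forall>v\<in>tangent_bundle A. fst v = p \<longrightarrow> F (tangent_map A A (flow A X t) v) = F v)"

text \<open>The derivative condition passes to the new chart by the chain rule; the invariance of
  \<open>F\<close> does not refer to target charts.\<close>

lemma preserves_at_change_chart:
  assumes b: "b \<in> charts_at A p" and d: "d \<in> A" and d': "d' \<in> A" and P: "preserves_at X b p t d"
    and fd': "flow A X t p \<in> fst d'"
  shows "preserves_at X b p t d'"
proof -
  have bi: "chart_inv b (snd b p) = p" by (rule chart_inv_snd[OF atlas charts_atD[OF b]])
  let ?g = "snd d \<circ> flow A X t \<circ> chart_inv b"
  obtain L where ev: "\<forall>\<^sub>F x in nhds (snd b p). t \<in> flow_domain A X (chart_inv b x) \<and> flow A X t (chart_inv b x) \<in> fst d"
    and L: "(?g has_derivative L) (at (snd b p))"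
    and Fp: "\<forall>v\<in>tangent_bundle A. fst v = p \<longrightarrow> F (tangent_map A A (flow A X t) v) = F v"
    using P unfolding preserves_at_def by blast
  have fd: "flow A X t p \<in> fst d" using eventually_nhds_x_imp_x[OF ev] bi by simp
  have g0: "?g (snd b p) = snd d (flow A X t p)" by (simp add: bi)
  have "(?g \<longlongrightarrow> ?g (snd b p)) (nhds (snd b p))"
    using has_derivative_continuous[OF L] by (metis isCont_def tendsto_at_iff_tendsto_nhds)
  moreover have "?g (snd b p) \<in> overlap d d'" unfolding g0 using fd fd' by simp
  ultimately have "\<forall>\<^sub>F x in nhds (snd b p). ?g x \<in> overlap d d'"
    using open_overlap[OF atlas d d'] by (simp add: tendsto_def)
  then have ev': "\<forall>\<^sub>F x in nhds (snd b p). t \<in> flow_domain A X (chart_inv b x) \<and> flow A X t (chart_inv b x) \<in> fst d' \<and>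
      transition d d' (?g x) = (snd d' \<circ> flow A X t \<circ> chart_inv b) x"
    using ev
  proof eventually_elim
    case (elim x)
    have "chart_inv d (?g x) = flow A X t (chart_inv b x)" using chart_inv_snd[OF atlas d] elim by simp
    then show ?case using overlap_iff[OF atlas d, of "?g x" d'] elim by simp
  qed
  have "(transition d d' has_derivative frechet_derivative (transition d d') (at (?g (snd b p)))) (at (?g (snd b p)))"
    unfolding g0 by (rule transition_has_derivative[OF atlas charts_atI[OF d fd] charts_atI[OF d' fd']])
  from has_derivative_compose[OF L this]
  obtain L' where "((\<lambda>x. transition d d' (?g x)) has_derivative L') (at (snd b p))" by blast
  moreover obtain V where "open V" "snd b p \<in> V" "\<And>x. x \<in> V \<Longrightarrow> transition d d' (?g x) = (snd d' \<circ> flow A X t \<circ> chart_inv b) x"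
    using ev' unfolding eventually_nhds by blast
  ultimately have "(snd d' \<circ> flow A X t \<circ> chart_inv b has_derivative L') (at (snd b p))"
    using has_derivative_transform_within_open by blast
  moreover have "\<forall>\<^sub>F x in nhds (snd b p). t \<in> flow_domain A X (chart_inv b x) \<and> flow A X t (chart_inv b x) \<in> fst d'"
    using ev' by eventually_elim blast
  ultimately show ?thesis using Fp unfolding preserves_at_def by blast
qed

text \<open>Near \<open>p\<close> the flow at time \<open>t + s\<close> is the flow at time
  \<open>t\<close> followed by \<open>u s\<close>; the chain rule yields its derivative, and
  \<open>chart_flow_preserves_F\<close> the invariance of \<open>F\<close>.\<close>

lemma preserves_at_step:
  assumes X: "vector_field A X" and k: "\<And>v. v \<in> slit_bundle A \<Longrightarrow> kfun X v = 0"
    and b: "b \<in> charts_at A p" and c: "c \<in> A" and cf0: "chart_flow A X c q \<epsilon> \<delta> u w"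
    and P: "preserves_at X b p t c" and x1: "snd c (flow A X t p) \<in> ball (snd c q) \<delta>" and s: "\<bar>s\<bar> < \<epsilon>"
  shows "preserves_at X b p (t + s) c"
proof -
  note cf = chart_flowD[OF cf0] and bA = charts_atD[OF b]
  have bi: "chart_inv b (snd b p) = p" by (rule chart_inv_snd[OF atlas bA])
  let ?g = "snd c \<circ> flow A X t \<circ> chart_inv b" and ?x1 = "snd c (flow A X t p)"
  obtain L where ev: "\<forall>\<^sub>F x in nhds (snd b p). t \<in> flow_domain A X (chart_inv b x) \<and> flow A X t (chart_inv b x) \<in> fst c"
    and L: "(?g has_derivative L) (at (snd b p))"
    and Fp: "\<forall>v\<in>tangent_bundle A. fst v = p \<longrightarrow> F (tangent_map A A (flow A X t) v) = F v"
    using P unfolding preserves_at_def by blast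
  have g0: "?g (snd b p) = ?x1" by (simp add: bi)
  have "(?g \<longlongrightarrow> ?g (snd b p)) (nhds (snd b p))"
    using has_derivative_continuous[OF L] by (metis isCont_def tendsto_at_iff_tendsto_nhds)
  then have "\<forall>\<^sub>F x in nhds (snd b p). ?g x \<in> ball (snd c q) \<delta>"
    by (rule topological_tendstoD[OF _ open_ball]) (unfold g0, rule x1)
  then have ev': "\<forall>\<^sub>F x in nhds (snd b p). t + s \<in> flow_domain A X (chart_inv b x) \<and>
      flow A X (t + s) (chart_inv b x) \<in> fst c \<and> u s (?g x) = (snd c \<circ> flow A X (t + s) \<circ> chart_inv b) x"
    using ev
  proof eventually_elim
    case (elim x)
    let ?r = "chart_inv b x"
    have gx: "chart_inv c (?g x) = flow A X t ?r" using chart_inv_snd[OF atlas c] elim by simp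
    have "s \<in> flow_domain A X (flow A X t ?r)" "flow A X s (flow A X t ?r) = chart_inv c (u s (?g x))"
      using cf(11,12)[OF elim(1) s] gx by simp_all
    then have "t + s \<in> flow_domain A X ?r" "flow A X (t + s) ?r = chart_inv c (u s (?g x))"
      using flow_add[OF atlas Hausdorff X _ , of t ?r s] elim by simp_all
    then show ?case using chart_inv_image[OF cf(6)[OF elim(1) s]] by simp
  qed
  have "(u s has_derivative w s ?x1) (at (?g (snd b p)))" unfolding g0 by (rule cf(8)[OF x1 s])
  from has_derivative_compose[OF L this]
  have "((\<lambda>x. u s (?g x)) has_derivative (\<lambda>y. w s ?x1 (L y))) (at (snd b p))" .
  moreover obtain V where "open V" "snd b p \<in> V" "\<And>x. x \<in> V \<Longrightarrow> u s (?g x) = (snd c \<circ> flow A X (t + s) \<circ> chart_inv b) x"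
    using ev' unfolding eventually_nhds by blast
  ultimately have L': "(snd c \<circ> flow A X (t + s) \<circ> chart_inv b has_derivative (\<lambda>y. w s ?x1 (L y))) (at (snd b p))"
    using has_derivative_transform_within_open by blast
  have ev1: "\<forall>\<^sub>F x in nhds (snd b p). t + s \<in> flow_domain A X (chart_inv b x) \<and> flow A X (t + s) (chart_inv b x) \<in> fst c"
    using ev' by eventually_elim blast
  have fts: "snd c (flow A X (t + s) p) = u s ?x1" using eventually_nhds_x_imp_x[OF ev'] bi by simp
  have "F (tangent_map A A (flow A X (t + s)) v) = F v" if v: "v \<in> tangent_bundle A" "fst v = p" for v
  proof -
    have bv: "b \<in> charts_at A (fst v)" using b v(2) by simp
    have "\<forall>\<^sub>F x in nhds (snd b (fst v)). flow A X (t + s) (chart_inv b x) \<in> fst c"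
      using ev1 unfolding v(2) by eventually_elim blast
    from tangent_map_eq[OF atlas atlas v(1) bv c this L'[folded v(2)]]
    have 1: "tangent_map A A (flow A X (t + s)) v = chart_vec A c (u s ?x1) (w s ?x1 (L (snd v b)))"
      unfolding v(2) fts .
    have "\<forall>\<^sub>F x in nhds (snd b (fst v)). flow A X t (chart_inv b x) \<in> fst c"
      using ev unfolding v(2) by eventually_elim blast
    from tangent_map_eq[OF atlas atlas v(1) bv c this L[folded v(2)]]
    have 2: "tangent_map A A (flow A X t) v = chart_vec A c ?x1 (L (snd v b))"
      unfolding v(2) .
    have "F (tangent_map A A (flow A X (t + s)) v) = F (tangent_map A A (flow A X t) v)"
      unfolding 1 2 by (rule chart_flow_preserves_F[OF X k c cf0 x1 s])
    then show ?thesis using Fp v by simp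
  qed
  then show ?thesis using L' ev1 unfolding preserves_at_def by blast
qed

lemma preserves_at_zero:
  assumes X: "vector_field A X" and b: "b \<in> charts_at A p"
  shows "preserves_at X b p 0 b"
proof -
  note bA = charts_atD[OF b]
  have bi: "chart_inv b (snd b p) = p" by (rule chart_inv_snd[OF atlas bA])
  have ob: "open (chart_image b)" "snd b p \<in> chart_image b" using open_chart_image[OF atlas bA(1)] bA(2) by simp_all
  have z: "0 \<in> flow_domain A X (chart_inv b x)" "flow A X 0 (chart_inv b x) = chart_inv b x" if "x \<in> chart_image b" for x
  proof -
    have "chart_inv b x \<in> points A" using chart_at_chart_inv[OF bA(1) that] points_iff[of "chart_inv b x" A] by blast
    then show "0 \<in> flow_domain A X (chart_inv b x)" "flow A X 0 (chart_inv b x) = chart_inv b x"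
      using flow_zero[OF atlas Hausdorff X] by blast+
  qed
  have ev: "\<forall>\<^sub>F x in nhds (snd b p). 0 \<in> flow_domain A X (chart_inv b x) \<and> flow A X 0 (chart_inv b x) \<in> fst b"
    using eventually_nhds_in_open[OF ob] by eventually_elim (simp add: z chart_inv_image(1))
  have L: "(snd b \<circ> flow A X 0 \<circ> chart_inv b has_derivative (\<lambda>y. y)) (at (snd b p))"
    by (rule has_derivative_transform_within_open[OF has_derivative_ident ob]) (simp add: z chart_inv_image(2))
  have "F (tangent_map A A (flow A X 0) v) = F v" if v: "v \<in> tangent_bundle A" "fst v = p" for v
  proof -
    have bv: "b \<in> charts_at A (fst v)" using b v(2) by simp
    have "\<forall>\<^sub>F x in nhds (snd b (fst v)). flow A X 0 (chart_inv b x) \<in> fst b"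
      using ev unfolding v(2) by eventually_elim blast
    from tangent_map_eq[OF atlas atlas v(1) bv bA(1) this L[folded v(2)]]
    have "tangent_map A A (flow A X 0) v = chart_vec A b (snd b (fst v)) (snd v b)"
      using z(2)[OF ob(2)] bi v(2) by simp
    then show ?thesis using chart_vec_coords[OF v(1) bv] by simp
  qed
  then show ?thesis using ev L unfolding preserves_at_def by blast
qed

text \<open>The set of times up to which the flow is differentiable at the base point and preserves \<open>F\<close> there
  is open and closed in the domain of the integral curve.\<close>

theorem killing_if_kfun_zero:
  assumes X: "vector_field A X" and k: "\<And>v. v \<in> slit_bundle A \<Longrightarrow> kfun X v = 0"
  shows "killing_field A F X"
  unfolding killing_field_def
proof (intro conjI X allI ballI impI)
  fix t v assume v: "v \<in> tangent_bundle A" and t: "t \<in> flow_domain A X (fst v)"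
  let ?p = "fst v"
  obtain b where b: "b \<in> charts_at A ?p" using tangent_bundle_charts[OF v] by blast
  obtain I \<gamma> where ic: "integral_curve A X I \<gamma>" "0 \<in> I" "\<gamma> 0 = ?p" "t \<in> I" using flow_domainE[OF t] .
  have fl: "flow A X s ?p = \<gamma> s" if "s \<in> I" for s using flow_eq(2)[OF atlas Hausdorff X ic(1,2) that] ic(3) by simp
  define P where "P s \<longleftrightarrow> (\<exists>d\<in>A. preserves_at X b ?p s d)" for s
  have oI: "open I" and cI: "connected I"
    using ic(1) by (auto simp: integral_curve_def open_interval_def is_interval_connected)
  have sm: "smooth_map_on standard_atlas I A \<gamma>" using ic(1) by (simp add: integral_curve_def)
  have step: "\<exists>T. openin (top_of_set I) T \<and> t1 \<in> T \<and> (\<forall>r\<in>T. \<forall>s\<in>T. P r \<longrightarrow> P s)" if t1: "t1 \<in> I" for t1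
  proof -
    obtain c where c: "c \<in> charts_at A (\<gamma> t1)" using integral_curve_chart[OF atlas ic(1) t1] .
    note cA = charts_atD(1)[OF c]
    obtain \<epsilon> \<delta> u w where cf0: "chart_flow A X c (\<gamma> t1) \<epsilon> \<delta> u w" using chart_flow_exists[OF atlas Hausdorff X c] by blast
    note cf = chart_flowD[OF cf0]
    let ?V = "ball (snd c (\<gamma> t1)) \<delta>"
    have "openin (manifold_topology A) (chart_inv c ` ?V)" by (rule openin_chart_inv_image[OF atlas cA open_ball cf(3)])
    moreover have "\<gamma> t1 \<in> chart_inv c ` ?V"
      by (rule image_eqI[of _ _ "snd c (\<gamma> t1)"]) (use cf(2) chart_inv_snd[OF atlas charts_atD[OF c]] in simp_all)
    ultimately obtain N where N: "open N" "t1 \<in> N" "N \<subseteq> I" "\<And>s. s \<in> N \<Longrightarrow> \<gamma> s \<in> chart_inv c ` ?V"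
      using smooth_curve_continuous[OF atlas sm t1] by metis
    \<comment> \<open>With radius \<epsilon>/2 any two times differ by less than \<epsilon>, so the
      property passes from any time of the neighbourhood to any other; this is openness and
      closedness at once.\<close>
    let ?T = "N \<inter> ball t1 (\<epsilon>/2)"
    have "openin (top_of_set I) ?T" using N(1,3) by (auto simp: openin_open_eq[OF oI])
    moreover have "t1 \<in> ?T" using N(2) cf(1) by simp
    moreover have "P s" if r: "r \<in> ?T" and s: "s \<in> ?T" and P: "P r" for r s
    proof -
      have rN: "r \<in> N" using r by simp
      obtain x where x: "x \<in> ?V" "\<gamma> r = chart_inv c x" using N(4)[OF rN] by blast
      then have gr: "\<gamma> r \<in> fst c" "snd c (\<gamma> r) \<in> ?V" using chart_inv_image[of x c] cf(3) by auto
      have fr: "flow A X r ?p = \<gamma> r" using fl N(3) rN by blast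
      obtain d where d: "d \<in> A" "preserves_at X b ?p r d" using P by (auto simp: P_def)
      have h1: "preserves_at X b ?p r c" by (rule preserves_at_change_chart[OF b d(1) cA d(2)]) (simp add: fr gr(1))
      have h2: "snd c (flow A X r ?p) \<in> ?V" unfolding fr by (rule gr(2))
      have h3: "\<bar>s - r\<bar> < \<epsilon>" using r s dist_triangle_half_r[of t1 s \<epsilon> r] by (simp add: dist_real_def)
      have "preserves_at X b ?p (r + (s - r)) c" by (rule preserves_at_step[OF X k b cA cf0 h1 h2 h3])
      then show ?thesis using cA by (auto simp: P_def)
    qed
    ultimately show ?thesis by blast
  qed
  have "P 0" using preserves_at_zero[OF X b] charts_atD(1)[OF b] by (auto simp: P_def)
  then have "P t" by (rule connected_induction_simple[OF cI ic(2,4) _ step])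
  then show "F (tangent_map A A (flow A X t) v) = F v"
    using v unfolding P_def preserves_at_def by blast
qed

end

theorem theorem2:
  fixes A :: "('m, 'e::euclidean_space) atlas"
    and F :: "('m, 'e) tvec \<Rightarrow> real"
    and X :: "'m \<Rightarrow> ('m, 'e) tvec"
  assumes "smooth_manifold A"
    and "finsler_function A F"
    and "affine_field A F X"
    and "(bounded ((\<lambda>p. F (X p)) ` points A) \<and> finsler_complete A F) \<or>
         (bounded ((\<lambda>p. F (X p)) ` points A) \<and> bounded ((\<lambda>p. F (tscale (- 1) (X p))) ` points A) \<and>
          finsler_forward_complete A F)"
  shows "killing_field A F X"
proof -
  interpret finsler_manifold A F by unfold_locales (rule assms(1,2))+
  have "vector_field A X" using assms(3) by (simp add: affine_field_def)
  then show ?thesis by (rule killing_if_kfun_zero) (rule kfun_zero[OF assms(3,4)])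
qed

end
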